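(* There exist absolute constants $0<c\le C<\infty$ such that for every closed subset $E$ of the unit circle $\mathbb{T}$, identified with the closed subset $\Lambda^{-1}(E)$ of $\partial T$, and every integer $n\ge1$, $$c\,\operatorname{Cap}^T_n\bigl(\Lambda^{-1}(E)\bigr)\le \operatorname{Cap}_n(E)\le C\,\operatorname{Cap}^T_n\bigl(\Lambda^{-1}(E)\bigr).$$
   Context: Disc side. $\Delta$ is the open unit disc in $\mathbb{C}$, $\mathbb{T}=\partial\Delta$, $\overline{\Delta}=\Delta\cup\mathbb{T}$, and $\overline{\Delta}(z,r)$ is the closed disc of radius $r$ centered at $z$. For closed disjoint sets $E,F\subset\overline{\Delta}$, $$\operatorname{Cap}(E,F)=\inf\left\{\|\nabla u\|_{L^2(\Delta)}^2:\ u\ge1\text{ on }E,\ u\le0\text{ on }F\right\},$$ where the infimum is over real functions $u$ which are $C^1$ in $\Delta$ and such that, for each $\zeta\in(E\cup F)\setminus\Delta$, the limit $\lim_{r\to1^-}u(r\zeta)\in\mathbb{R}\cup\{+\infty\}$ exists; the value of $u$ at such a boundary point $\zeta$ is understood to be this limit. The $L^2(\Delta)$ norm is with respect to area measure. For closed $E\subseteq\mathbb{T}$, $\operatorname{Cap}_n(E):=\operatorname{Cap}(E,\overline{\Delta}(0,1-2^{-n}))$. Tree side. $T=\{(n,j):\ n\ge0,\ 1\le j\le2^n\}$ is the dyadic tree with root $o=(0,1)$. To each $(n,j)$ is associated the arc $I(n,j)=\{e^{i\theta}:\ \frac{j-1}{2^n}\le\frac{\theta}{2\pi}<\frac{j}{2^n}\}$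 of $\mathbb{T}$, and there is an edge between $(n,j)$ and $(m,i)$ iff ($n=m+1$ and $I(n,j)\subseteq I(m,i)$) or ($m=n+1$ and $I(m,i)\subseteq I(n,j)$). The level of $x=(n,j)$ is $d(x)=n$. $P(x)$ is the set of vertices on the geodesic from $o$ to $x$, endpoints included. The boundary $\partial T$ is the set of half-infinite geodesics starting at $o$; for $\zeta\in\partial T$, $P(\zeta)$ is the set of vertices of $\zeta$. For distinct $\xi,\zeta\in\partial T$, $\xi\wedge\zeta$ is the vertex of largest level in $P(\xi)\cap P(\zeta)$, and $\partial T$ carries the metric $\rho(\xi,\zeta)=2^{-d(\xi\wedge\zeta)}$ (with $\rho(\xi,\xi)=0$). The map $\Lambda:\partial T\to\mathbb{T}$ sends $\zeta$ to the unique point of $\bigcap_{x\in P(\zeta)}\overline{I(x)}$; it is continuous and surjective, and closed $E\subseteq\mathbb{T}$ is identified with $\Lambda^{-1}(E)\subseteq\partial T$. For $\varphi:T\to[0,\infty)$ put $I\varphi(\zeta)=\sum_{x\in P(\zeta)}\varphi(x)$ for $\zeta\in T\cup\partial T$, and $\|\varphi\|_{\ell^2}^2=\sum_{x\in T}\varphi(x)^2$. For closed $F\subseteq\partial T$ and integer $n\ge1$, $$\operatorname{Cap}^T_n(F)=\inf\{\|\varphi\|_{\ell^2}^2:\ \varphi\ge0,\ I\varphi\ge1\text{ on }F,\ I\varphi(x)=0\ \text{for all }x\in T\text{ with }d(x)=n-1\}.$$ *)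

theory Defs
  imports "HOL-Analysis.Analysis"
begin

section \<open>Condensers in the unit disc\<close>

definition grad :: "(complex \<Rightarrow> real) \<Rightarrow> complex \<Rightarrow> complex" where
  "grad u z = (THE D. GDERIV u z :> D)"

definition C1_disc :: "(complex \<Rightarrow> real) \<Rightarrow> bool" where
  "C1_disc u \<longleftrightarrow> u differentiable_on ball 0 1 \<and> continuous_on (ball 0 1) (grad u)"

text \<open>The energy is extended-real valued: admissible functions need not have finite energy.\<close>

definition dirichlet_energy :: "(complex \<Rightarrow> real) \<Rightarrow> ennreal" where
  "dirichlet_energy u = (\<integral>\<^sup>+ z \<in> ball 0 1. ennreal ((norm (grad u z))\<^sup>2) \<partial>lborel)"

text \<open>
  The value of \<open>u\<close> at a point of the closed disc.  On the circle it is the radial limit, meaningful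
  only where that limit exists.
\<close>

definition disc_value :: "(complex \<Rightarrow> real) \<Rightarrow> complex \<Rightarrow> ereal" where
  "disc_value u z =
     (if z \<in> ball 0 1 then ereal (u z) else Lim (at_left 1) (\<lambda>r. ereal (u (of_real r * z))))"

definition disc_admissible :: "complex set \<Rightarrow> complex set \<Rightarrow> (complex \<Rightarrow> real) \<Rightarrow> bool" where
  "disc_admissible E F u \<longleftrightarrow>
     C1_disc u \<and>
     (\<forall>z \<in> (E \<union> F) - ball 0 1.
        \<exists>l. l \<noteq> -\<infinity> \<and> ((\<lambda>r. ereal (u (of_real r * z))) \<longlongrightarrow> l) (at_left 1)) \<and>
     (\<forall>z \<in> E. disc_value u z \<ge> 1) \<and>
     (\<forall>z \<in> F. disc_value u z \<le> 0)"

definition disc_Cap :: "complex set \<Rightarrow> complex set \<Rightarrow> ennreal" where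
  "disc_Cap E F = (INF u \<in> {u. disc_admissible E F u}. dirichlet_energy u)"

definition disc_Cap_n :: "nat \<Rightarrow> complex set \<Rightarrow> ennreal" where
  "disc_Cap_n n E = disc_Cap E (cball 0 (1 - 1 / 2 ^ n))"


section \<open>The dyadic tree and its boundary\<close>

type_synonym vertex = "nat \<times> nat"

definition tree_verts :: "vertex set" where
  "tree_verts = {(n, j). 1 \<le> j \<and> j \<le> 2 ^ n}"

definition tree_root :: vertex where
  "tree_root = (0, 1)"

abbreviation level :: "vertex \<Rightarrow> nat" where
  "level x \<equiv> fst x"

definition dyadic_arc :: "vertex \<Rightarrow> complex set" where
  "dyadic_arc x =
     {cis \<theta> | \<theta>. (real (snd x) - 1) / 2 ^ fst x \<le> \<theta> / (2 * pi) \<and> \<theta> / (2 * pi) < real (snd x) / 2 ^ fst x}"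

definition tree_edges :: "(vertex \<times> vertex) set" where
  "tree_edges = {(x, y). x \<in> tree_verts \<and> y \<in> tree_verts \<and>
     (level x = level y + 1 \<and> dyadic_arc x \<subseteq> dyadic_arc y \<or>
      level y = level x + 1 \<and> dyadic_arc y \<subseteq> dyadic_arc x)}"

definition tree_dist :: "vertex \<Rightarrow> vertex \<Rightarrow> nat" where
  "tree_dist x y = (LEAST k. (x, y) \<in> tree_edges ^^ k)"

text \<open>Geodesics parametrised by an interval \<open>J\<close> of natural numbers (\<open>{..k}\<close> or \<open>UNIV\<close> below).\<close>

definition tree_geodesic :: "nat set \<Rightarrow> (nat \<Rightarrow> vertex) \<Rightarrow> bool" where
  "tree_geodesic J p \<longleftrightarrow>
     (\<forall>i \<in> J. p i \<in> tree_verts) \<and> (\<forall>i \<in> J. \<forall>j \<in> J. i \<le> j \<longrightarrow> tree_dist (p i) (p j) = j - i)"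

definition tree_boundary :: "(nat \<Rightarrow> vertex) set" where
  "tree_boundary = {\<zeta>. tree_geodesic UNIV \<zeta> \<and> \<zeta> 0 = tree_root}"

definition pred_vertex :: "vertex \<Rightarrow> vertex set" where
  "pred_vertex x = \<Union> {p ` {..k} | p k. tree_geodesic {..k} p \<and> p 0 = tree_root \<and> p k = x}"

definition pred_boundary :: "(nat \<Rightarrow> vertex) \<Rightarrow> vertex set" where
  "pred_boundary \<zeta> = range \<zeta>"

definition boundary_meet :: "(nat \<Rightarrow> vertex) \<Rightarrow> (nat \<Rightarrow> vertex) \<Rightarrow> vertex" where
  "boundary_meet \<xi> \<zeta> = (ARG_MAX level x. x \<in> pred_boundary \<xi> \<inter> pred_boundary \<zeta>)"

definition boundary_dist :: "(nat \<Rightarrow> vertex) \<Rightarrow> (nat \<Rightarrow> vertex) \<Rightarrow> real" where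
  "boundary_dist \<xi> \<zeta> = (if \<xi> = \<zeta> then 0 else 1 / 2 ^ level (boundary_meet \<xi> \<zeta>))"

definition Lambda :: "(nat \<Rightarrow> vertex) \<Rightarrow> complex" where
  "Lambda \<zeta> = (THE w. w \<in> (\<Inter>x \<in> pred_boundary \<zeta>. closure (dyadic_arc x)))"

definition Lambda_preimage :: "complex set \<Rightarrow> (nat \<Rightarrow> vertex) set" where
  "Lambda_preimage E = {\<zeta> \<in> tree_boundary. Lambda \<zeta> \<in> E}"


text \<open>
  The intersection of closed arcs defining \<open>Lambda\<close> is a single point, and the preimage of a closed
  set under \<open>Lambda\<close> is closed for the metric \<open>boundary_dist\<close>.
\<close>

lemma relpow_level_le: "(x, y) \<in> tree_edges ^^ k \<Longrightarrow> \<bar>int (level x) - int (level y)\<bar> \<le> int k"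
proof (induction k arbitrary: y)
  case 0
  then show ?case by simp
next
  case (Suc k)
  then obtain z where "(x, z) \<in> tree_edges ^^ k" and e: "(z, y) \<in> tree_edges"
    by auto
  then have "\<bar>int (level x) - int (level z)\<bar> \<le> int k"
    using Suc.IH by blast
  moreover have "\<bar>int (level z) - int (level y)\<bar> \<le> 1"
    using e unfolding tree_edges_def by auto
  ultimately show ?case by linarith
qed

lemma tree_edges_sym: "(x, y) \<in> tree_edges \<Longrightarrow> (y, x) \<in> tree_edges"
  by (auto simp: tree_edges_def)

lemma relpow_tree_edges_sym: "(x, y) \<in> tree_edges ^^ k \<Longrightarrow> (y, x) \<in> tree_edges ^^ k"
proof (induction k arbitrary: y)
  case (Suc k)
  then obtain z where "(x, z) \<in> tree_edges ^^ k" "(z, y) \<in> tree_edges"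
    by auto
  then show ?case
    using Suc.IH tree_edges_sym relpow_Suc_I2 by metis
qed simp

lemma parent_edge:
  assumes "(Suc n, j) \<in> tree_verts"
  shows "((n, (j + 1) div 2), (Suc n, j)) \<in> tree_edges"
proof -
  let ?k = "(j + 1) div 2"
  have "j = 2 * ?k \<or> j + 1 = 2 * ?k"
    by presburger
  then have k: "real j \<le> 2 * real ?k" "2 * real ?k \<le> real j + 1"
    by linarith+
  have "dyadic_arc (Suc n, j) \<subseteq> dyadic_arc (n, ?k)"
  proof
    fix z assume "z \<in> dyadic_arc (Suc n, j)"
    then obtain t where t: "z = cis t" "(real j - 1) / 2 ^ Suc n \<le> t / (2 * pi)"
        "t / (2 * pi) < real j / 2 ^ Suc n"
      by (auto simp: dyadic_arc_def)
    have "(real ?k - 1) / 2 ^ n = (2 * real ?k - 2) / 2 ^ Suc n"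
      by (simp add: field_simps)
    also have "\<dots> \<le> (real j - 1) / 2 ^ Suc n"
      using k by (intro divide_right_mono) auto
    finally have a: "(real ?k - 1) / 2 ^ n \<le> t / (2 * pi)"
      using t by linarith
    have "real j / 2 ^ Suc n \<le> (2 * real ?k) / 2 ^ Suc n"
      using k by (intro divide_right_mono) auto
    also have "\<dots> = real ?k / 2 ^ n"
      by simp
    finally have "t / (2 * pi) < real ?k / 2 ^ n"
      using t by linarith
    with a t show "z \<in> dyadic_arc (n, ?k)"
      by (auto simp: dyadic_arc_def)
  qed
  moreover have "(n, ?k) \<in> tree_verts"
    using assms by (auto simp: tree_verts_def)
  ultimately show ?thesis
    using assms by (auto simp: tree_edges_def)
qed

lemma root_path: "(n, j) \<in> tree_verts \<Longrightarrow> (tree_root, (n, j)) \<in> tree_edges ^^ n"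
proof (induction n arbitrary: j)
  case 0
  then show ?case by (auto simp: tree_root_def tree_verts_def)
next
  case (Suc n)
  have e: "((n, (j + 1) div 2), (Suc n, j)) \<in> tree_edges"
    using parent_edge Suc.prems by blast
  then have "(n, (j + 1) div 2) \<in> tree_verts"
    by (auto simp: tree_edges_def)
  then show ?case
    using Suc.IH e by auto
qed

lemma relpow_tree_dist:
  assumes "x \<in> tree_verts" "y \<in> tree_verts"
  shows "(x, y) \<in> tree_edges ^^ tree_dist x y"
proof -
  have "(x, tree_root) \<in> tree_edges ^^ level x" "(tree_root, y) \<in> tree_edges ^^ level y"
    using assms root_path relpow_tree_edges_sym by (metis prod.collapse)+
  then have "(x, y) \<in> tree_edges ^^ (level x + level y)"
    by (auto simp: relpow_add)
  then show ?thesis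
    unfolding tree_dist_def by (rule LeastI)
qed

lemma tree_dist_root:
  assumes "x \<in> tree_verts"
  shows "tree_dist tree_root x = level x"
proof -
  have "tree_dist tree_root x \<le> level x"
    unfolding tree_dist_def using assms root_path by (intro Least_le) (metis prod.collapse)
  moreover have "level x \<le> tree_dist tree_root x"
    using relpow_level_le[OF relpow_tree_dist[of tree_root x]] assms
    by (auto simp: tree_root_def tree_verts_def)
  ultimately show ?thesis by simp
qed

lemma pred_vertex_self:
  assumes "x \<in> tree_verts"
  shows "x \<in> pred_vertex x" "tree_root \<in> pred_vertex x"
proof -
  have "(tree_root, x) \<in> tree_edges ^^ level x"
    using assms root_path by (metis prod.collapse)
  then obtain p where p: "p 0 = tree_root" "p (level x) = x"
      "\<And>i. i < level x \<Longrightarrow> (p i, p (Suc i)) \<in> tree_edges"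
    by (auto simp: relpow_fun_conv)
  have path: "(p i, p j) \<in> tree_edges ^^ (j - i)" if "i \<le> j" "j \<le> level x" for i j
    using that
  proof (induction j rule: dec_induct)
    case (step j)
    then show ?case using p(3)[of j] by (auto simp: Suc_diff_le)
  qed simp
  have lev: "level (p i) = i" if "i \<le> level x" for i
    using relpow_level_le[OF path[of 0 i]] relpow_level_le[OF path[of i "level x"]] that p
    by (auto simp: tree_root_def)
  have vert: "p i \<in> tree_verts" if "i \<le> level x" for i
    using that p(2) p(3)[of i] assms by (cases "i = level x") (auto simp: tree_edges_def)
  have "tree_dist (p i) (p j) = j - i" if "i \<le> j" "j \<le> level x" for i j
  proof (rule antisym)
    show "tree_dist (p i) (p j) \<le> j - i"
      unfolding tree_dist_def using path[OF that] by (rule Least_le)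
    have "i \<le> level x" using that by simp
    then show "j - i \<le> tree_dist (p i) (p j)"
      using relpow_level_le[OF relpow_tree_dist[OF vert[of i] vert[of j]]] lev[of i] lev[of j] that
      by simp
  qed
  then have "tree_geodesic {..level x} p"
    using vert by (auto simp: tree_geodesic_def)
  then have "p ` {..level x} \<subseteq> pred_vertex x"
    using p(1,2) unfolding pred_vertex_def by blast
  then show "x \<in> pred_vertex x" "tree_root \<in> pred_vertex x"
    using p(1,2) by auto
qed

lemma boundary_vert: "\<zeta> \<in> tree_boundary \<Longrightarrow> \<zeta> k \<in> tree_verts"
  by (auto simp: tree_boundary_def tree_geodesic_def)

lemma boundary_level:
  assumes "\<zeta> \<in> tree_boundary"
  shows "level (\<zeta> k) = k"
proof -
  have "tree_dist (\<zeta> 0) (\<zeta> k) = k - 0"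
    using assms unfolding tree_boundary_def tree_geodesic_def by blast
  then show ?thesis
    using assms tree_dist_root[OF boundary_vert[OF assms, of k]] by (simp add: tree_boundary_def)
qed

lemma boundary_arc_Suc:
  assumes "\<zeta> \<in> tree_boundary"
  shows "dyadic_arc (\<zeta> (Suc k)) \<subseteq> dyadic_arc (\<zeta> k)"
proof -
  have "tree_dist (\<zeta> k) (\<zeta> (Suc k)) = 1"
    using assms by (auto simp: tree_boundary_def tree_geodesic_def)
  then have "(\<zeta> k, \<zeta> (Suc k)) \<in> tree_edges"
    using relpow_tree_dist[OF boundary_vert[OF assms] boundary_vert[OF assms], of k "Suc k"] by simp
  then show ?thesis
    using boundary_level[OF assms] by (auto simp: tree_edges_def)
qed

lemma dyadic_arc_nonempty: "dyadic_arc x \<noteq> {}"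
proof -
  have "cis (2 * pi * ((real (snd x) - 1) / 2 ^ fst x)) \<in> dyadic_arc x"
    unfolding dyadic_arc_def
    by (rule CollectI, rule exI[of _ "2 * pi * ((real (snd x) - 1) / 2 ^ fst x)"])
       (simp add: divide_strict_right_mono)
  then show ?thesis by blast
qed

lemma dist_cis_le: "dist (cis a) (cis b) \<le> \<bar>a - b\<bar>"
proof -
  have "cis a = cis b * cis (a - b)"
    by (simp add: cis_mult)
  then have "dist (cis a) (cis b) = norm (cis b * (cis (a - b) - 1))"
    by (simp add: dist_norm algebra_simps)
  also have "\<dots> = norm (cis (a - b) - 1)"
    by (simp add: norm_mult)
  also have "\<dots> \<le> \<bar>a - b\<bar>"
    using dist_exp_i_1[of "a - b"] abs_sin_x_le_abs_x[of "(a - b) / 2"]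
    by (simp add: cis_conv_exp)
  finally show ?thesis .
qed

lemma dist_dyadic_arc_le:
  assumes "z \<in> dyadic_arc x" "w \<in> dyadic_arc x"
  shows "dist z w \<le> 2 * pi / 2 ^ level x"
proof -
  obtain a where a: "z = cis a" "(real (snd x) - 1) / 2 ^ fst x \<le> a / (2 * pi)"
      "a / (2 * pi) < real (snd x) / 2 ^ fst x"
    using assms(1) by (auto simp: dyadic_arc_def)
  obtain b where b: "w = cis b" "(real (snd x) - 1) / 2 ^ fst x \<le> b / (2 * pi)"
      "b / (2 * pi) < real (snd x) / 2 ^ fst x"
    using assms(2) by (auto simp: dyadic_arc_def)
  have "(real (snd x) - 1) / 2 ^ fst x = real (snd x) / 2 ^ fst x - 1 / 2 ^ fst x"
    by (simp add: diff_divide_distrib)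
  then have "\<bar>a / (2 * pi) - b / (2 * pi)\<bar> \<le> 1 / 2 ^ fst x"
    using a b by linarith
  then have "\<bar>a - b\<bar> / (2 * pi) \<le> 1 / 2 ^ fst x"
    by (simp flip: diff_divide_distrib)
  then have "\<bar>a - b\<bar> \<le> 1 / 2 ^ fst x * (2 * pi)"
    by (subst (asm) pos_divide_le_eq) auto
  then have "\<bar>a - b\<bar> \<le> 2 * pi / 2 ^ level x"
    by (simp only: times_divide_eq_left mult_1_left)
  then show ?thesis
    using dist_cis_le[of a b] unfolding a(1) b(1) by (rule order_trans[rotated])
qed

lemma dist_closure_dyadic_arc_le:
  assumes "z \<in> closure (dyadic_arc x)" "w \<in> closure (dyadic_arc x)"
  shows "dist z w \<le> 2 * pi / 2 ^ level x"
proof -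
  have "bounded (dyadic_arc x)"
    using dist_dyadic_arc_le dyadic_arc_nonempty unfolding bounded_def by blast
  then have "dist z w \<le> diameter (closure (dyadic_arc x))"
    using assms by (intro diameter_bounded_bound) auto
  also have "\<dots> = diameter (dyadic_arc x)"
    using \<open>bounded (dyadic_arc x)\<close> by (rule diameter_closure)
  also have "\<dots> \<le> 2 * pi / 2 ^ level x"
    using dist_dyadic_arc_le by (intro diameter_le) (auto simp: dist_norm)
  finally show ?thesis .
qed

lemma ex1_Lambda:
  assumes "\<zeta> \<in> tree_boundary"
  shows "\<exists>!w. w \<in> (\<Inter>x \<in> pred_boundary \<zeta>. closure (dyadic_arc x))"
proof -
  let ?S = "\<lambda>k. closure (dyadic_arc (\<zeta> k))"
  have "\<exists>l. \<forall>k. l \<in> ?S k"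
  proof (rule decreasing_closed_nest)
    show "closed (?S k)" for k by simp
    show "?S k \<noteq> {}" for k using dyadic_arc_nonempty by simp
    show "?S n \<subseteq> ?S m" if "m \<le> n" for m n
      using lift_Suc_antimono_le[of "\<lambda>k. dyadic_arc (\<zeta> k)", OF boundary_arc_Suc[OF assms] that]
      by (rule closure_mono)
    show "\<exists>n. \<forall>x\<in>?S n. \<forall>y\<in>?S n. dist x y < e" if "e > 0" for e :: real
    proof -
      obtain n where "2 * pi / e < 2 ^ n"
        using real_arch_pow[of 2 "2 * pi / e"] by auto
      then have "2 * pi / 2 ^ n < e"
        using that by (simp add: field_simps)
      then show ?thesis
        using dist_closure_dyadic_arc_le[of _ "\<zeta> n"]
        unfolding boundary_level[OF assms] by (intro exI[of _ n] ballI) (rule le_less_trans)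
    qed
  qed blast
  then obtain w where w: "\<And>k. w \<in> ?S k" by blast
  show ?thesis
  proof (rule ex1I)
    show "w \<in> (\<Inter>x \<in> pred_boundary \<zeta>. closure (dyadic_arc x))"
      using w by (auto simp: pred_boundary_def)
    fix v assume "v \<in> (\<Inter>x \<in> pred_boundary \<zeta>. closure (dyadic_arc x))"
    then have v: "v \<in> ?S k" for k by (auto simp: pred_boundary_def)
    show "v = w"
    proof (rule ccontr)
      assume "v \<noteq> w"
      then have p: "dist v w > 0" by simp
      obtain n where "2 * pi / dist v w < 2 ^ n"
        using real_arch_pow[of 2 "2 * pi / dist v w"] by auto
      then have "2 * pi / 2 ^ n < dist v w"
        using p by (simp add: field_simps)
      then show False
        using dist_closure_dyadic_arc_le[OF v[of n] w[of n]] boundary_level[OF assms, of n]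
        by simp
    qed
  qed
qed

lemma Lambda_in_arc:
  assumes "\<zeta> \<in> tree_boundary"
  shows "Lambda \<zeta> \<in> closure (dyadic_arc (\<zeta> k))"
  using theI'[OF ex1_Lambda[OF assms]] by (auto simp: Lambda_def pred_boundary_def)

lemma dyadic_arc_inj:
  assumes "x \<in> tree_verts" "y \<in> tree_verts" "level x = level y"
    "z \<in> dyadic_arc x" "z \<in> dyadic_arc y"
  shows "x = y"
proof -
  obtain a where a: "z = cis a" "(real (snd x) - 1) / 2 ^ fst x \<le> a / (2 * pi)"
      "a / (2 * pi) < real (snd x) / 2 ^ fst x"
    using assms(4) by (auto simp: dyadic_arc_def)
  obtain b where b: "z = cis b" "(real (snd y) - 1) / 2 ^ fst x \<le> b / (2 * pi)"
      "b / (2 * pi) < real (snd y) / 2 ^ fst x"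
    using assms(3,5) by (auto simp: dyadic_arc_def)
  have v: "1 \<le> snd x" "snd x \<le> 2 ^ fst x" "1 \<le> snd y" "snd y \<le> 2 ^ fst x"
    using assms(1-3) by (auto simp: tree_verts_def)
  have r: "0 \<le> t \<and> t < 2 * pi"
    if "(real m - 1) / 2 ^ n \<le> t / (2 * pi)" "t / (2 * pi) < real m / 2 ^ n"
      "1 \<le> m" "m \<le> 2 ^ n" for t m n
  proof -
    have "0 \<le> (real m - 1) / 2 ^ n" using that by simp
    moreover have "real m / 2 ^ n \<le> 1"
      using that by (simp add: of_nat_le_numeral_power_cancel_iff)
    ultimately have "0 \<le> t / (2 * pi)" "t / (2 * pi) < 1" using that by linarith+
    then show ?thesis using pi_gt_zero by (simp add: field_simps zero_le_divide_iff)
  qed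
  have "0 \<le> a" "a < 2 * pi" "0 \<le> b" "b < 2 * pi"
    using r[OF a(2,3) v(1,2)] r[OF b(2,3) v(3,4)] by auto
  moreover have "cos a = cos b" "sin a = sin b"
    using a(1) b(1) by (metis cis.simps(1), metis cis.simps(2))
  moreover from this obtain n :: int where n: "a = b + 2 * pi * n"
    using sin_cos_eq_iff[of a b] by auto
  ultimately have "2 * pi * real_of_int n < 2 * pi * 1" "2 * pi * (- 1) < 2 * pi * real_of_int n"
    by linarith+
  then have "real_of_int n < 1" "- 1 < real_of_int n"
    by (simp_all only: mult_less_cancel_left_pos pi_gt_zero zero_less_mult_iff zero_less_numeral simp_thms)
  then have "n = 0" by linarith
  then have "a = b" using n by simp
  then have "(real (snd x) - 1) / 2 ^ fst x < real (snd y) / 2 ^ fst x"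
      "(real (snd y) - 1) / 2 ^ fst x < real (snd x) / 2 ^ fst x"
    using a(2,3) b(2,3) by (metis le_less_trans)+
  then have "real (snd x) - 1 < real (snd y)" "real (snd y) - 1 < real (snd x)"
    by (simp_all add: divide_less_cancel)
  then have "snd x = snd y" by linarith
  with assms(3) show ?thesis by (simp add: prod_eq_iff)
qed

lemma boundary_agree_below:
  assumes "\<xi> \<in> tree_boundary" "\<zeta> \<in> tree_boundary" "\<xi> k = \<zeta> k" "m \<le> k"
  shows "\<xi> m = \<zeta> m"
proof -
  have "dyadic_arc (\<xi> k) \<subseteq> dyadic_arc (\<xi> m)" "dyadic_arc (\<zeta> k) \<subseteq> dyadic_arc (\<zeta> m)"
    using assms(4) boundary_arc_Suc[OF assms(1)] boundary_arc_Suc[OF assms(2)]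
      lift_Suc_antimono_le[of "\<lambda>k. dyadic_arc (\<xi> k)" m k]
      lift_Suc_antimono_le[of "\<lambda>k. dyadic_arc (\<zeta> k)" m k]
    by blast+
  then obtain z where "z \<in> dyadic_arc (\<xi> m)" "z \<in> dyadic_arc (\<zeta> m)"
    using dyadic_arc_nonempty[of "\<xi> k"] assms(3) by auto
  then show ?thesis
    using assms boundary_level boundary_vert by (intro dyadic_arc_inj) auto
qed

lemma boundary_meet_level:
  assumes "\<xi> \<in> tree_boundary" "\<zeta> \<in> tree_boundary" "\<xi> \<noteq> \<zeta>"
  shows "\<xi> k = \<zeta> k \<longleftrightarrow> k \<le> level (boundary_meet \<xi> \<zeta>)"
proof -
  let ?P = "\<lambda>x. x \<in> pred_boundary \<xi> \<inter> pred_boundary \<zeta>"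
  have P: "?P x \<longleftrightarrow> x = \<xi> (level x) \<and> x = \<zeta> (level x)" for x
    unfolding pred_boundary_def
    by (metis IntE IntI imageE rangeI boundary_level[OF assms(1)] boundary_level[OF assms(2)])
  obtain b where b: "\<xi> b \<noteq> \<zeta> b" using assms(3) by blast
  have "\<forall>x. ?P x \<longrightarrow> level x \<le> b"
    using P b boundary_agree_below[OF assms(1,2)] by (metis nle_le)
  moreover have "?P (\<xi> 0)"
    using assms by (auto simp: tree_boundary_def pred_boundary_def intro: range_eqI[of _ _ 0])
  ultimately have "?P (boundary_meet \<xi> \<zeta>) \<and> (\<forall>y. ?P y \<longrightarrow> level y \<le> level (boundary_meet \<xi> \<zeta>))"
    unfolding boundary_meet_def by (intro arg_max_nat_lemma[of ?P "\<xi> 0" level "Suc b"]) auto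
  then show ?thesis
    using P boundary_agree_below[OF assms(1,2)] boundary_level[OF assms(1)]
    by metis
qed

lemma boundary_dist_le_iff:
  assumes "\<xi> \<in> tree_boundary" "\<zeta> \<in> tree_boundary"
  shows "boundary_dist \<xi> \<zeta> \<le> 1 / 2 ^ k \<longleftrightarrow> \<xi> k = \<zeta> k"
proof (cases "\<xi> = \<zeta>")
  case False
  then show ?thesis
    using boundary_meet_level[OF assms False, of k]
    by (simp add: boundary_dist_def divide_le_eq_1 field_simps)
qed (simp add: boundary_dist_def)

lemma boundary_meet_commute: "boundary_meet \<xi> \<zeta> = boundary_meet \<zeta> \<xi>"
  by (simp add: boundary_meet_def Int_commute)

interpretation tree_boundary: Metric_space tree_boundary boundary_dist
proof
  show "0 \<le> boundary_dist x y" for x y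
    by (simp add: boundary_dist_def)
  show "boundary_dist x y = boundary_dist y x" for x y
    by (simp add: boundary_dist_def boundary_meet_commute eq_commute)
  show "boundary_dist x y = 0 \<longleftrightarrow> x = y" for x y
    by (simp add: boundary_dist_def)
  fix x y z assume m: "x \<in> tree_boundary" "y \<in> tree_boundary" "z \<in> tree_boundary"
  show "boundary_dist x z \<le> boundary_dist x y + boundary_dist y z"
  proof (cases "x = y \<or> y = z")
    case False
    let ?a = "level (boundary_meet x y)" and ?b = "level (boundary_meet y z)"
    let ?k = "min ?a ?b"
    have "x ?k = y ?k" "y ?k = z ?k"
      using False m boundary_meet_level by auto
    then have "boundary_dist x z \<le> 1 / 2 ^ ?k"
      using m boundary_dist_le_iff by auto
    also have "\<dots> \<le> 1 / 2 ^ ?a + 1 / 2 ^ ?b"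
      by (simp add: min_def)
    finally show ?thesis
      using False by (simp add: boundary_dist_def)
  qed (auto simp: boundary_dist_def)
qed

lemma closedin_Lambda_preimage:
  assumes "closed E"
  shows "closedin tree_boundary.mtopology (Lambda_preimage E)"
  unfolding tree_boundary.closedin_metric
proof (intro conjI allI impI)
  show "Lambda_preimage E \<subseteq> tree_boundary"
    by (auto simp: Lambda_preimage_def)
  fix \<zeta> assume z: "\<zeta> \<in> tree_boundary - Lambda_preimage E"
  then have "Lambda \<zeta> \<in> - E" by (auto simp: Lambda_preimage_def)
  moreover have "open (- E)" using assms by auto
  ultimately obtain e where e: "e > 0" "ball (Lambda \<zeta>) e \<subseteq> - E"
    by (meson open_contains_ball)
  obtain n where "2 * pi / e < 2 ^ n"
    using real_arch_pow[of 2 "2 * pi / e"] by auto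
  then have n: "2 * pi / 2 ^ n < e"
    using e by (simp add: field_simps)
  have "\<xi> \<notin> Lambda_preimage E" if "\<xi> \<in> tree_boundary.mball \<zeta> (1 / 2 ^ n)" for \<xi>
  proof -
    have x: "\<xi> \<in> tree_boundary" "\<zeta> n = \<xi> n"
      using that z boundary_dist_le_iff[of \<zeta> \<xi> n] by auto
    then have "dist (Lambda \<zeta>) (Lambda \<xi>) \<le> 2 * pi / 2 ^ level (\<zeta> n)"
      using z Lambda_in_arc[of \<zeta> n] Lambda_in_arc[of \<xi> n]
      by (intro dist_closure_dyadic_arc_le) auto
    then have "Lambda \<xi> \<in> ball (Lambda \<zeta>) e"
      using n z boundary_level[of \<zeta> n] by auto
    then show ?thesis
      using e by (auto simp: Lambda_preimage_def)
  qed
  then show "\<exists>r>0. disjnt (Lambda_preimage E) (tree_boundary.mball \<zeta> r)"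
    by (intro exI[of _ "1 / 2 ^ n"]) (auto simp: disjnt_def)
qed


section \<open>Capacity on the tree\<close>

definition sum_along :: "(vertex \<Rightarrow> real) \<Rightarrow> vertex set \<Rightarrow> ennreal" where
  "sum_along \<phi> P = (\<Sum>\<^sub>\<infinity>x \<in> P. ennreal (\<phi> x))"

definition tree_energy :: "(vertex \<Rightarrow> real) \<Rightarrow> ennreal" where
  "tree_energy \<phi> = (\<Sum>\<^sub>\<infinity>x \<in> tree_verts. ennreal ((\<phi> x)\<^sup>2))"

definition tree_admissible :: "nat \<Rightarrow> (nat \<Rightarrow> vertex) set \<Rightarrow> (vertex \<Rightarrow> real) \<Rightarrow> bool" where
  "tree_admissible n F \<phi> \<longleftrightarrow>
     (\<forall>x \<in> tree_verts. \<phi> x \<ge> 0) \<and>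
     (\<forall>\<zeta> \<in> F. sum_along \<phi> (pred_boundary \<zeta>) \<ge> 1) \<and>
     (\<forall>x \<in> tree_verts. level x = n - 1 \<longrightarrow> sum_along \<phi> (pred_vertex x) = 0)"

text \<open>Only meaningful for \<open>n \<ge> 1\<close>, because of the truncated subtraction \<open>n - 1\<close>.\<close>

definition tree_Cap_n :: "nat \<Rightarrow> (nat \<Rightarrow> vertex) set \<Rightarrow> ennreal" where
  "tree_Cap_n n F = (INF \<phi> \<in> {\<phi>. tree_admissible n F \<phi>}. tree_energy \<phi>)"

end

theory Submission
  imports Defs
begin

text \<open>
  From the disc to the tree: in the Whitney cell of each vertex \<open>x\<close> choose a radius and an angle
  on which the energy of \<open>u\<close> is at most its mean, and let \<open>a x\<close> be the value of \<open>u\<close> at the resulting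
  point. Neighbouring values are joined by one radial and one circular path of small energy, so the
  weights \<open>\<phi> x = \<bar>a x - a (parent x)\<bar>\<close> are controlled by the energy of \<open>u\<close>. If \<open>\<zeta>\<close> represents a point
  of \<open>E\<close>, then circular arcs join the points chosen along \<open>\<zeta>\<close> to the ray ending there, and their
  energies tend to \<open>0\<close>; so \<open>a\<close> inherits the radial limit and \<open>\<phi>\<close> is admissible. Here it matters
  that the total energy is finite: it excludes exceptional rays.

  From the tree to the disc: attach to each vertex of level \<open>k\<close> a bump that increases along rays
  from \<open>0\<close> at \<open>\<bar>z\<bar>\<^sup>2 = 1 - 2\<^sup>-\<^sup>k\<close> and lives over a neighbourhood of its arc. A combination with weights
  \<open>\<phi> \<ge> 0\<close> is monotone along rays, hence has radial limits, which dominate the path sums of \<open>\<phi>\<close>. The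
  bumps of different levels overlap down to the circle, but the Cauchy-Schwarz inequality with
  weights growing like \<open>2\<^sup>k\<^sup>/\<^sup>2\<close> leaves only the integrable factor \<open>(1 - \<bar>z\<bar>\<^sup>2)\<^sup>-\<^sup>1\<^sup>/\<^sup>2\<close>.
\<close>

section \<open>Polar coordinates\<close>

text \<open>From disc to tree the obstacle is that the values of \<open>u\<close> on
  \<open>E\<close> are prescribed along single rays, whereas the energy controls only averages over
  rays. The good angle of a cell is therefore not the angle of the ray in question. The energy of
  the whole circular arc at the good radius is controlled instead, and this arc meets every ray
  through the cell. From tree to disc the bumps keep rising up to the circle, with gradient of order
  \<open>2 ^ k\<close> all the way. Cauchy-Schwarz with equal weights would count the active levels,
  and integrating that count over the support of a bump would lose an unbounded factor of order
  \<open>level x - n + 1\<close>. With geometric weights the deepest active level dominates the sum,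
  and the powers of 2 cancel for each vertex. Angles live in \<open>{0..2*pi}\<close>, cut at the
  point 1. Cells never cross the cut, because arcs are nested in the arcs of their ancestors. Bumps
  do cross it, so their angular supports are handled up to shifts by 2 pi.\<close>

lemma Basis_real2: "(Basis :: (real^2) set) = {axis 1 1, axis 2 1}"
  by (auto simp: Basis_vec_def) (metis exhaust_2)

text \<open>The Jacobian formula is applied in \<open>real^2\<close>. This transport and the next
  one, both checked on boxes, move the result to \<open>complex\<close> and to
  \<open>real \<times> real\<close>, where Tonelli's theorem applies.\<close>

lemma distr_real2_complex:
  "distr lborel borel (\<lambda>v::real^2. Complex (v$1) (v$2)) = lborel"
proof (rule lborel_eqI[symmetric])
  fix l u :: complex
  assume le: "\<And>b. b \<in> Basis \<Longrightarrow> l \<bullet> b \<le> u \<bullet> b"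
  let ?T = "\<lambda>v::real^2. Complex (v$1) (v$2)"
  have T: "?T \<in> borel_measurable borel"
    unfolding Complex_eq by measurable
  have "?T -` box l u = box (vector [Re l, Im l]) (vector [Re u, Im u])"
    by (auto simp: box_def Basis_real2 Basis_complex_def inner_axis inner_complex_def)
  then show "emeasure (distr lborel borel ?T) (box l u) = (\<Prod>b\<in>Basis. (u - l) \<bullet> b)"
    using T le[of 1] le[of \<i>]
    by (simp add: emeasure_distr emeasure_lborel_box_eq inner_axis Basis_real2 axis_eq_axis
        Basis_complex_def inner_complex_def complex_eq_iff)
qed simp

lemma distr_real2_prod:
  "distr lborel borel (\<lambda>v::real^2. (v$1, v$2)) = (lborel :: (real \<times> real) measure)"
proof (rule lborel_eqI[symmetric])
  fix l u :: "real \<times> real"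
  assume le: "\<And>b. b \<in> Basis \<Longrightarrow> l \<bullet> b \<le> u \<bullet> b"
  let ?T = "\<lambda>v::real^2. (v$1, v$2)"
  have T: "?T \<in> borel_measurable borel"
    by (intro borel_measurable_continuous_onI continuous_intros)
  have "?T -` box l u = box (vector [fst l, snd l]) (vector [fst u, snd u])"
    by (auto simp: box_def Basis_real2 Basis_prod_def inner_axis inner_prod_def)
  then show "emeasure (distr lborel borel ?T) (box l u) = (\<Prod>b\<in>Basis. (u - l) \<bullet> b)"
    using T le[of "(1, 0)"] le[of "(0, 1)"]
    by (simp add: emeasure_distr emeasure_lborel_box_eq inner_axis Basis_real2 axis_eq_axis
        Basis_prod_def inner_prod_def mult.commute)
qed simp

definition polar2 :: "real^2 \<Rightarrow> real^2" where
  "polar2 v = vector [v$1 * cos (v$2), v$1 * sin (v$2)]"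

definition polar2' :: "real^2 \<Rightarrow> real^2 \<Rightarrow> real^2" where
  "polar2' v h = vector [h$1 * cos (v$2) - v$1 * (h$2 * sin (v$2)), h$1 * sin (v$2) + v$1 * (h$2
    * cos (v$2))]"

definition polar_strip :: "(real^2) set" where
  "polar_strip = {v. 0 < v$1 \<and> 0 \<le> v$2 \<and> v$2 < 2 * pi}"

lemma has_derivative_polar2: "(polar2 has_derivative polar2' v) (at v within S)"
proof -
  have *: "((\<lambda>x. x $ i) has_derivative (\<lambda>h. h $ i)) (at v within S)" for i :: 2 and v :: "real^2"
    and S
    by (rule bounded_linear_imp_has_derivative) (rule bounded_linear_vec_nth)
  have "((\<lambda>v. v$1 * cos (v$2)) has_derivative (\<lambda>h. h$1 * cos (v$2) - v$1 * (h$2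
    * sin (v$2)))) (at v within S)"
    "((\<lambda>v. v$1 * sin (v$2)) has_derivative (\<lambda>h. h$1 * sin (v$2) + v$1 * (h$2
      * cos (v$2)))) (at v within S)"
    by (auto intro!: derivative_eq_intros * simp: algebra_simps)
  then show ?thesis
    unfolding polar2_def[abs_def] polar2'_def[abs_def]
    by (subst has_derivative_componentwise_within) (auto simp: Basis_real2 inner_axis)
qed

lemma det_polar2': "det (matrix (polar2' v)) = v$1"
proof -
  have "det (matrix (polar2' v)) = v$1 * (cos (v$2))\<^sup>2 + v$1 * (sin (v$2))\<^sup>2"
    by (simp add: det_2 matrix_def polar2'_def axis_def power2_eq_square)
  then show ?thesis
    by (simp flip: distrib_left)
qed

lemma polar2_Complex: "Complex (polar2 v $ 1) (polar2 v $ 2) = rcis (v$1) (v$2)"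
  by (simp add: polar2_def complex_eq_iff)

lemma inj_on_polar2: "inj_on polar2 polar_strip"
proof (rule inj_onI)
  fix v w assume *: "v \<in> polar_strip" "w \<in> polar_strip" "polar2 v = polar2 w"
  then have e: "rcis (v$1) (v$2) = rcis (w$1) (w$2)"
    using polar2_Complex[of v] polar2_Complex[of w] by simp
  have "v$1 = norm (rcis (v$1) (v$2))" "w$1 = norm (rcis (w$1) (w$2))"
    using * by (auto simp: polar_strip_def)
  then have 1: "v$1 = w$1" using e by simp
  then have "cis (v$2) = cis (w$2)" using e * by (auto simp: polar_strip_def rcis_def)
  then have 2: "v$2 = w$2"
    using * Arg2pi_unique[of 1 "v$2" "cis (v$2)"] Arg2pi_unique[of 1 "w$2" "cis (w$2)"]
    by (auto simp: polar_strip_def cis_conv_exp)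
  show "v = w" using 1 2 by (simp add: vec_eq_iff forall_2)
qed

lemma image_polar2: "polar2 ` polar_strip = UNIV - {0}"
proof (intro equalityI subsetI)
  fix w assume "w \<in> polar2 ` polar_strip"
  then obtain v where v: "v \<in> polar_strip" "w = polar2 v" by blast
  then have "norm (Complex (w$1) (w$2)) = v$1"
    using polar2_Complex[of v] by (auto simp: polar_strip_def)
  then show "w \<in> UNIV - {0}" using v by (auto simp: polar_strip_def complex_norm)
next
  fix w :: "real^2" assume w: "w \<in> UNIV - {0}"
  let ?z = "Complex (w$1) (w$2)"
  let ?v = "vector [norm ?z, Arg2pi ?z] :: real^2"
  have "?z \<noteq> 0" using w by (auto simp: complex_eq_iff vec_eq_iff forall_2)
  then have v: "?v \<in> polar_strip" by (auto simp: polar_strip_def Arg2pi_ge_0 Arg2pi_lt_2pi)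
  have "rcis (norm ?z) (Arg2pi ?z) = ?z"
    using Arg2pi_eq[of ?z] by (simp add: rcis_def cis_conv_exp mult.commute)
  then have "Complex (polar2 ?v $ 1) (polar2 ?v $ 2) = ?z"
    using polar2_Complex[of ?v] by simp
  then have "polar2 ?v = w" by (simp add: vec_eq_iff forall_2)
  then show "w \<in> polar2 ` polar_strip" using v by (metis imageI)
qed

lemma polar_strip_borel [measurable]: "polar_strip \<in> sets borel"
  unfolding polar_strip_def by measurable

lemma polar2_measurable [measurable]: "polar2 \<in> borel_measurable borel"
  using has_derivative_polar2
  by (intro borel_measurable_continuous_onI) (meson has_derivative_continuous_on)

lemma emeasure_polar2:
  assumes B: "B \<in> sets borel" "emeasure lborel B < \<infinity>"
  shows "(\<integral>\<^sup>+v. ennreal (v$1) * indicator B (polar2 v) * indicator polar_strip v \<partial>lborel)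
    = emeasure lborel B"
proof -
  have lm: "B \<in> lmeasurable" using B by (auto simp: fmeasurable_def)
  \<comment> \<open>The change of variables formula integrates functions with values in a space of
    vectors, so the scalar indicator is packed into \<open>real^1\<close>.\<close>
  let ?f = "\<lambda>w. vec (indicator B w) :: real^1"
  have i: "(indicat_real B has_integral measure lborel B) UNIV"
    using lm B by (simp add: lmeasurable_iff_has_integral)
  have "(indicat_real B) absolutely_integrable_on UNIV"
    using i by (intro nonnegative_absolutely_integrable_1) (auto simp: has_integral_iff)
  then have a: "(indicat_real B) absolutely_integrable_on (UNIV - {0})"
    by (rule set_integrable_subset) auto
  have ii: "integral (UNIV - {0}) (indicat_real B) = measure lborel B"
  proof -
    have "integral (UNIV - {0}) (indicat_real B) = integral UNIV (indicat_real B)"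
      by (rule integral_spike_set; rule negligible_subset[of "{0}"]) auto
    then show ?thesis using i by (simp add: has_integral_iff)
  qed
  have "?f absolutely_integrable_on (polar2 ` polar_strip) \<and>
     integral (polar2 ` polar_strip) ?f = vec (measure lborel B)"
    using a ii unfolding image_polar2
    by (simp add: absolutely_integrable_on_1_iff integral_on_1_eq)
  then have "(\<lambda>v. \<bar>det (matrix (polar2' v))\<bar>
    *\<^sub>R ?f (polar2 v)) absolutely_integrable_on polar_strip \<and>
     integral polar_strip (\<lambda>v. \<bar>det (matrix (polar2' v))\<bar> *\<^sub>R ?f (polar2 v))
       = vec (measure lborel B)"
    by (subst has_absolute_integral_change_of_variables[OF _ has_derivative_polar2 inj_on_polar2])
       (use polar_strip_borel in auto)
  then have "((\<lambda>v. \<bar>v$1\<bar> * indicator B (polar2 v)) has_integral measure lborel B) polar_strip"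
    by (simp add: absolutely_integrable_on_1_iff integral_on_1_eq det_polar2' vec_eq_iff
        has_integral_iff absolutely_integrable_on_def)
  then have "(\<integral>\<^sup>+v. ennreal (\<bar>v$1\<bar> * indicator B (polar2 v)) * indicator polar_strip v \<partial>lborel)
    = measure lborel B"
    by (intro nn_integral_has_integral_lebesgue') auto
  moreover have "(\<integral>\<^sup>+v. ennreal (v$1) * indicator B (polar2 v) * indicator polar_strip v \<partial>lborel)
     = (\<integral>\<^sup>+v. ennreal (\<bar>v$1\<bar> * indicator B (polar2 v)) * indicator polar_strip v \<partial>lborel)"
    by (intro nn_integral_cong) (auto simp: indicator_def polar_strip_def)
  ultimately show ?thesis
    using B by (simp add: emeasure_eq_ennreal_measure)
qed

lemma rcis_measurable: "(\<lambda>v::real^2. rcis (v$1) (v$2)) \<in> borel_measurable borel"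
  unfolding rcis_def cis_conv_exp
  by (intro borel_measurable_continuous_onI continuous_intros)

lemma distr_polar:
  "distr (density lborel (\<lambda>v. ennreal (v$1) * indicator polar_strip v)) borel (\<lambda>v::real^2.
    rcis (v$1) (v$2)) = lborel"
proof (rule lborel_eqI[symmetric])
  fix l u :: complex
  assume le: "\<And>b. b \<in> Basis \<Longrightarrow> l \<bullet> b \<le> u \<bullet> b"
  let ?T = "\<lambda>v::real^2. Complex (v$1) (v$2)"
  let ?B = "?T -` box l u"
  have T: "?T \<in> borel_measurable borel"
    unfolding Complex_eq by measurable
  have B: "?B \<in> sets borel" using measurable_sets_borel[OF T, of "box l u"] by simp
  have eB: "emeasure lborel ?B = emeasure lborel (box l u)"
    using emeasure_distr[of ?T lborel borel "box l u"] T by (simp add: distr_real2_complex)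
  have "emeasure (distr (density lborel (\<lambda>v. ennreal (v$1)
    * indicator polar_strip v)) borel (\<lambda>v::real^2. rcis (v$1) (v$2))) (box l u)
     = (\<integral>\<^sup>+v. ennreal (v$1) * indicator ?B (polar2 v) * indicator polar_strip v \<partial>lborel)"
    using rcis_measurable
    by (subst emeasure_distr; simp add: emeasure_density measurable_sets_borel)
       (auto intro!: nn_integral_cong simp: indicator_def polar2_Complex)
  also have "\<dots> = emeasure lborel ?B"
    by (rule emeasure_polar2[OF B]) (use emeasure_lborel_box_finite[of l u] in \<open>simp add: eB\<close>)
  also have "\<dots> = (\<Prod>b\<in>Basis. (u - l) \<bullet> b)"
    using le by (simp add: eB emeasure_lborel_box)
  finally show "emeasure (distr (density lborel (\<lambda>v. ennreal (v$1)
    * indicator polar_strip v)) borel (\<lambda>v::real^2. rcis (v$1) (v$2))) (box l u)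
     = (\<Prod>b\<in>Basis. (u - l) \<bullet> b)" .
qed simp

lemma nn_integral_polar:
  assumes f [measurable]: "f \<in> borel_measurable (borel :: complex measure)"
  shows "(\<integral>\<^sup>+z. f z \<partial>lborel) =
    (\<integral>\<^sup>+\<theta>. \<integral>\<^sup>+r. f (rcis r \<theta>) * ennreal r * indicator {0<..} r
      * indicator {0..<2*pi} \<theta> \<partial>lborel \<partial>lborel)"
proof -
  let ?g = "\<lambda>(r, \<theta>). f (rcis r \<theta>) * ennreal r * indicator {0<..} r * indicator {0..<2*pi} \<theta>"
  have rc [measurable]: "(\<lambda>(r, \<theta>). rcis r \<theta>) \<in> borel_measurable (borel \<Otimes>\<^sub>M borel)"
    unfolding borel_prod case_prod_beta rcis_def cis_conv_exp
    by (intro borel_measurable_continuous_onI continuous_intros)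
  have g [measurable]: "?g \<in> borel_measurable (borel \<Otimes>\<^sub>M borel)"
    by measurable
  have "(\<integral>\<^sup>+z. f z \<partial>lborel) = (\<integral>\<^sup>+v. (ennreal (v$1) * indicator polar_strip v)
    * f (rcis (v$1) (v$2)) \<partial>(lborel :: (real^2) measure))"
    by (subst distr_polar[symmetric])
       (use rcis_measurable in \<open>simp add: nn_integral_distr nn_integral_density\<close>)
  also have "\<dots> = (\<integral>\<^sup>+v. ?g (v$1, v$2) \<partial>(lborel :: (real^2) measure))"
    by (intro nn_integral_cong) (auto simp: polar_strip_def indicator_def mult_ac)
  also have "\<dots> = (\<integral>\<^sup>+p. ?g p \<partial>(lborel :: (real \<times> real) measure))"
  proof -
    have "(\<lambda>v::real^2. (v$1, v$2)) \<in> borel_measurable borel"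
      by (intro borel_measurable_continuous_onI continuous_intros)
    then have "(\<integral>\<^sup>+p. ?g p \<partial>distr lborel borel (\<lambda>v::real^2. (v$1, v$2)))
      = (\<integral>\<^sup>+v. ?g (v$1, v$2) \<partial>(lborel :: (real^2) measure))"
      by (intro nn_integral_distr) (use g in \<open>auto simp: borel_prod\<close>)
    then show ?thesis by (simp only: distr_real2_prod)
  qed
  also have "\<dots> = (\<integral>\<^sup>+\<theta>. \<integral>\<^sup>+r. ?g (r, \<theta>) \<partial>lborel \<partial>lborel)"
    unfolding lborel_prod[symmetric]
    by (rule lborel_pair.nn_integral_snd[symmetric]) (use g in simp)
  finally show ?thesis by simp
qed

section \<open>Paths in the dyadic tree\<close>

definition parent :: "vertex \<Rightarrow> vertex" where
  "parent x = (level x - 1, (snd x + 1) div 2)"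

text \<open>Both vertices have level \<open>k\<close>, and both arcs contain the nonempty arc of
  \<open>\<zeta> (Suc k)\<close>; distinct arcs of one level are disjoint.\<close>

lemma boundary_parent:
  assumes "\<zeta> \<in> tree_boundary"
  shows "\<zeta> k = parent (\<zeta> (Suc k))"
proof -
  obtain j where j: "\<zeta> (Suc k) = (Suc k, j)"
    using boundary_level[OF assms, of "Suc k"] by (metis prod.collapse)
  have v: "(Suc k, j) \<in> tree_verts"
    using boundary_vert[OF assms, of "Suc k"] j by simp
  have e: "((k, (j + 1) div 2), (Suc k, j)) \<in> tree_edges"
    using parent_edge[OF v] .
  obtain z where z: "z \<in> dyadic_arc (Suc k, j)"
    using dyadic_arc_nonempty by blast
  show ?thesis
  proof (rule dyadic_arc_inj)
    show "z \<in> dyadic_arc (\<zeta> k)" using boundary_arc_Suc[OF assms, of k] z j by auto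
    show "z \<in> dyadic_arc (parent (\<zeta> (Suc k)))" using e z j by (auto simp: tree_edges_def parent_def)
  qed (use e j boundary_level[OF assms, of k] boundary_vert[OF assms, of k] in \<open>auto
    simp: tree_edges_def parent_def\<close>)
qed

lemma parent_in_tree_verts: "x \<in> tree_verts \<Longrightarrow> 1 \<le> level x \<Longrightarrow> parent x \<in> tree_verts"
  using parent_edge[of "level x - 1" "snd x"] by (auto simp: parent_def tree_edges_def)

text \<open>An edge changes the level by exactly one, so a level difference bounds the distance from
  below, and the chain of parents attains this bound.\<close>

lemma level_path_geodesic:
  assumes v: "\<And>i. p i \<in> tree_verts" and l: "\<And>i. level (p i) = i"
    and p: "\<And>i. p i = parent (p (Suc i))"
  shows "tree_geodesic J p"
proof -
  have e: "(p i, p (Suc i)) \<in> tree_edges" for i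
  proof -
    have *: "(Suc i, snd (p (Suc i))) = p (Suc i)" using l[of "Suc i"] by (metis prod.collapse)
    have **: "p i = (i, (snd (p (Suc i)) + 1) div 2)"
      using p[of i] l[of "Suc i"] by (simp add: parent_def)
    have "((i, (snd (p (Suc i)) + 1) div 2), (Suc i, snd (p (Suc i)))) \<in> tree_edges"
      by (rule parent_edge) (use * v[of "Suc i"] in simp)
    then show ?thesis unfolding * **[symmetric] .
  qed
  have path: "(p i, p j) \<in> tree_edges ^^ (j - i)" if "i \<le> j" for i j
    using that
  proof (induction j rule: dec_induct)
    case (step j)
    then show ?case using e[of j] by (auto simp: Suc_diff_le)
  qed simp
  have "tree_dist (p i) (p j) = j - i" if "i \<le> j" for i j
  proof (rule antisym)
    show "tree_dist (p i) (p j) \<le> j - i"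
      unfolding tree_dist_def using path[OF that] by (rule Least_le)
    show "j - i \<le> tree_dist (p i) (p j)"
      using relpow_level_le[OF relpow_tree_dist[OF v[of i] v[of j]]] l[of i] l[of j] that by simp
  qed
  then show ?thesis using v by (auto simp: tree_geodesic_def)
qed

text \<open>On a geodesic from the root the position equals the distance from the root, which is the
  level. Weights supported on levels at least \<open>n\<close> therefore have vanishing sums at
  level \<open>n - 1\<close>.\<close>

lemma pred_vertex_level_le:
  assumes "y \<in> pred_vertex x"
  shows "level y \<le> level x" "y \<in> tree_verts"
proof -
  obtain p k i where p: "tree_geodesic {..k} p" "p 0 = tree_root" "p k = x" "y = p i" "i \<le> k"
    using assms by (auto simp: pred_vertex_def)
  have v: "p m \<in> tree_verts" if "m \<le> k" for m
    using p that by (auto simp: tree_geodesic_def)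
  have "level (p m) = m" if "m \<le> k" for m
  proof -
    have "tree_dist (p 0) (p m) = m - 0" using p(1) that unfolding tree_geodesic_def by blast
    then show ?thesis using tree_dist_root[OF v[OF that]] p(2) by simp
  qed
  then show "level y \<le> level x" "y \<in> tree_verts"
    using p v by auto
qed

text \<open>An interval of angles rather than a set of points: the two ends \<open>0\<close> and
  \<open>2 * pi\<close> stay apart although both represent the point 1.\<close>

definition closed_arc :: "vertex \<Rightarrow> real set" where
  "closed_arc x = {2 * pi * (real (snd x) - 1) / 2 ^ level x .. 2 * pi
    * real (snd x) / 2 ^ level x}"

lemma closure_dyadic_arc_subset: "closure (dyadic_arc x) \<subseteq> cis ` closed_arc x"
proof (rule closure_minimal)
  show "dyadic_arc x \<subseteq> cis ` closed_arc x"
  proof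
    fix z assume "z \<in> dyadic_arc x"
    then obtain t where "z = cis t" "(real (snd x) - 1) / 2 ^ fst x \<le> t / (2 * pi)"
        "t / (2 * pi) < real (snd x) / 2 ^ fst x"
      by (auto simp: dyadic_arc_def)
    then show "z \<in> cis ` closed_arc x"
      unfolding closed_arc_def by (intro image_eqI[of _ _ t]) (auto simp: field_simps less_imp_le)
  qed
  have "compact (cis ` closed_arc x)"
    unfolding closed_arc_def cis_conv_exp
    by (intro compact_continuous_image continuous_intros) auto
  then show "closed (cis ` closed_arc x)" by (rule compact_imp_closed)
qed

lemma closed_arc_subset:
  assumes "x \<in> tree_verts"
  shows "closed_arc x \<subseteq> {0..2 * pi}"
proof -
  have "1 \<le> real (snd x)" "real (snd x) \<le> 2 ^ level x"
    using assms by (auto simp: tree_verts_def of_nat_le_numeral_power_cancel_iff)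
  then have "0 \<le> 2 * pi * (real (snd x) - 1) / 2 ^ level x" "2 * pi * real (snd x) / 2 ^ level x
    \<le> 2 * pi"
    by (auto simp: field_simps)
  then show ?thesis by (auto simp: closed_arc_def)
qed

lemma closed_arc_parent_subset:
  assumes "1 \<le> level x"
  shows "closed_arc x \<subseteq> closed_arc (parent x)"
proof -
  obtain k j where x: "x = (Suc k, j)" using assms by (cases x) (auto simp: Suc_le_eq gr0_conv_Suc)
  let ?m = "(j + 1) div 2"
  have "j = 2 * ?m \<or> j + 1 = 2 * ?m" by presburger
  then have k: "real j \<le> 2 * real ?m" "2 * real ?m \<le> real j + 1" by linarith+
  have "2 * pi * (real ?m - 1) / 2 ^ k = 2 * pi * (2 * real ?m - 2) / 2 ^ Suc k"
    by (simp add: field_simps)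
  also have "\<dots> \<le> 2 * pi * (real j - 1) / 2 ^ Suc k"
    using k by (intro divide_right_mono mult_left_mono) auto
  finally have "2 * pi * (real ?m - 1) / 2 ^ k \<le> 2 * pi * (real j - 1) / 2 ^ Suc k" .
  moreover have "2 * pi * real j / 2 ^ Suc k \<le> 2 * pi * (2 * real ?m) / 2 ^ Suc k"
    using k by (intro divide_right_mono mult_left_mono) auto
  then have "2 * pi * real j / 2 ^ Suc k \<le> 2 * pi * real ?m / 2 ^ k"
    by (simp add: field_simps)
  ultimately show ?thesis by (auto simp: closed_arc_def x parent_def)
qed

section \<open>Oscillation along paths\<close>

text \<open>A function exceeding its mean at every point of an interval of positive length would
  have too large an integral. This selects the good angles and the good radii.\<close>

lemma ex_le_mean:
  fixes f :: "real \<Rightarrow> ennreal"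
  assumes f [measurable]: "f \<in> borel_measurable borel" and ab: "a < b"
  shows "\<exists>s\<in>{a..b}. ennreal (b - a) * f s \<le> (\<integral>\<^sup>+x\<in>{a..b}. f x \<partial>lborel)"
proof (rule ccontr)
  assume "\<not> ?thesis"
  then have gt: "\<And>s. s \<in> {a..b} \<Longrightarrow> (\<integral>\<^sup>+x\<in>{a..b}. f x \<partial>lborel) < ennreal (b - a) * f s"
    by (auto simp: not_le)
  define I where "I = (\<integral>\<^sup>+x\<in>{a..b}. f x \<partial>lborel)"
  have "I < top" using gt[of a] ab unfolding I_def
    by (metis atLeastAtMost_iff less_le_not_le order_le_less top.not_eq_extremum top_greatest)
  then obtain i where i: "I = ennreal i" "0 \<le> i" by (cases I) auto
  define c where "c = i / (b - a)"
  have c: "0 \<le> c" "I = ennreal c * ennreal (b - a)"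
    using i ab by (auto simp: c_def ennreal_mult'[symmetric])
  have lt: "ennreal c < f s" if "s \<in> {a..b}" for s
  proof (rule ccontr)
    assume "\<not> ennreal c < f s"
    then have "ennreal (b - a) * f s \<le> ennreal (b - a) * ennreal c" by (intro mult_left_mono) auto
    then show False using gt[OF that] c(2) unfolding I_def by (simp add: mult.commute)
  qed
  have "(\<integral>\<^sup>+x. ennreal c * indicator {a..b} x \<partial>lborel) < (\<integral>\<^sup>+x. f x * indicator {a..b} x \<partial>lborel)"
  proof (rule nn_integral_less)
    show "(\<integral>\<^sup>+x. ennreal c * indicator {a..b} x \<partial>lborel) \<noteq> \<infinity>"
      using ab by (simp add: nn_integral_cmult ennreal_mult'[symmetric] c)
    show "AE x in lborel. ennreal c * indicator {a..b} x \<le> f x * indicator {a..b} x"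
      using lt by (auto simp: indicator_def less_imp_le)
    show "\<not> (AE x in lborel. f x * indicator {a..b} x \<le> ennreal c * indicator {a..b} x)"
    proof
      assume "AE x in lborel. f x * indicator {a..b} x \<le> ennreal c * indicator {a..b} x"
      then have "AE x in lborel. x \<notin> {a..b}"
        by eventually_elim (use lt in \<open>fastforce simp: indicator_def not_le split: if_splits\<close>)
      then have "{a..b} \<in> null_sets lborel" by (simp add: AE_iff_null_sets)
      then show False using ab by (auto simp: null_sets_def)
    qed
  qed auto
  then show False using c(2) ab unfolding I_def by (simp add: nn_integral_cmult)
qed

text \<open>The set lies in \<open>{m..m + d}\<close> for its least element \<open>m\<close>. The
  overlap counts for levels, arcs and bumps all reduce to this.\<close>

lemma card_spread_le:
  fixes A :: "nat set"
  assumes "\<And>a b. a \<in> A \<Longrightarrow> b \<in> A \<Longrightarrow> b \<le> a + d"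
  shows "finite A \<and> card A \<le> Suc d"
proof (cases "A = {}")
  case False
  then obtain m where m: "m \<in> A" by blast
  let ?m = "LEAST m. m \<in> A"
  have "?m \<in> A" using m by (rule LeastI)
  then have "A \<subseteq> {?m..?m + d}" using assms by (auto intro: Least_le)
  then show ?thesis
    using card_mono[of "{?m..?m + d}" A] finite_subset[of A "{?m..?m + d}"] by simp
qed simp

lemma GDERIV_unique:
  assumes "GDERIV u z :> D" "GDERIV u z :> D'"
  shows "D = D'"
proof -
  have "(\<lambda>h. h \<bullet> D) = (\<lambda>h. h \<bullet> D')"
    using assms unfolding gderiv_def by (rule has_derivative_unique)
  then have "h \<bullet> (D - D') = 0" for h by (metis inner_diff_right eq_iff_diff_eq_0)
  then show ?thesis by (metis inner_eq_zero_iff eq_iff_diff_eq_0)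
qed

lemma grad_eqI: "GDERIV u z :> D \<Longrightarrow> grad u z = D"
  unfolding grad_def using GDERIV_unique by blast

text \<open>\<open>grad\<close> is a definite description, so existence must be supplied: the
  derivative is real-linear on the plane and hence an inner product with the vector of its values at
  \<open>1\<close> and \<open>\<i>\<close>.\<close>

lemma C1_disc_GDERIV:
  assumes "C1_disc u" "z \<in> ball 0 1"
  shows "GDERIV u z :> grad u z"
proof -
  have "u differentiable (at z)"
    using assms differentiable_on_eq_differentiable_at[of "ball 0 1" u] by (simp add: C1_disc_def)
  then obtain D where D: "(u has_derivative D) (at z)" by (auto simp: differentiable_def)
  then have lin: "linear D" by (rule has_derivative_linear)
  have "D h = h \<bullet> Complex (D 1) (D \<i>)" for h
  proof -
    have "h = Re h *\<^sub>R 1 + Im h *\<^sub>R \<i>" by (simp add: complex_eq_iff)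
    then have "D h = D (Re h *\<^sub>R 1 + Im h *\<^sub>R \<i>)" by (rule arg_cong)
    also have "\<dots> = Re h *\<^sub>R D 1 + Im h *\<^sub>R D \<i>"
      by (simp only: linear_add[OF lin] linear_scale[OF lin])
    finally show ?thesis by (simp add: inner_complex_def)
  qed
  then have "D = (\<lambda>h. h \<bullet> Complex (D 1) (D \<i>))" by blast
  then have "GDERIV u z :> Complex (D 1) (D \<i>)" using D unfolding gderiv_def by simp
  then show ?thesis using grad_eqI by metis
qed

text \<open>Fundamental theorem along the curve, then Cauchy-Schwarz in the parameter. Speed at most
  1 bounds the derivative of \<open>u\<close> along the curve by the norm of its gradient.\<close>

lemma path_energy:
  assumes u: "C1_disc u"
    and \<gamma>: "\<And>t. t \<in> {a..b} \<Longrightarrow> \<gamma> t \<in> ball 0 1"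
      "\<And>t. (\<gamma> has_vector_derivative \<gamma>' t) (at t)" "\<And>t. t \<in> {a..b} \<Longrightarrow> norm (\<gamma>' t) \<le> 1"
      "continuous_on UNIV \<gamma>'"
    and pq: "p \<in> {a..b}" "q \<in> {a..b}"
  shows "ennreal ((u (\<gamma> q) - u (\<gamma> p))\<^sup>2) \<le>
    ennreal (b - a) * (\<integral>\<^sup>+t\<in>{a..b}. ennreal ((norm (grad u (\<gamma> t)))\<^sup>2) \<partial>lborel)"
proof -
  have main: "ennreal ((u (\<gamma> q) - u (\<gamma> p))\<^sup>2) \<le>
    ennreal (b - a) * (\<integral>\<^sup>+t\<in>{a..b}. ennreal ((norm (grad u (\<gamma> t)))\<^sup>2) \<partial>lborel)"
    if pq: "p \<in> {a..b}" "q \<in> {a..b}" and lt: "p < q" for p q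
  proof -
    define h where "h t = u (\<gamma> t)" for t
    define h' where "h' t = \<gamma>' t \<bullet> grad u (\<gamma> t)" for t
    define F where "F t = (norm (grad u (\<gamma> t)))\<^sup>2" for t
    have sub: "{p..q} \<subseteq> {a..b}" using pq by auto
    have c\<gamma>: "continuous_on {p..q} \<gamma>"
      using \<gamma>(2) by (meson continuous_at_imp_continuous_on has_vector_derivative_continuous)
    have cg: "continuous_on {p..q} (\<lambda>t. grad u (\<gamma> t))"
      using u unfolding C1_disc_def
      by (intro continuous_on_compose2[OF _ c\<gamma>, of "ball 0 1" "grad u"]) (use \<gamma>(1) sub in auto)
    have ch': "continuous_on {p..q} h'"
      unfolding h'_def using \<gamma>(4) by (intro continuous_intros cg) (auto intro: continuous_on_subset)
    have cF: "continuous_on {p..q} F" unfolding F_def by (intro continuous_intros cg)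
    have hd: "(h has_vector_derivative h' t) (at t within {p..q})" if "t \<in> {p..q}" for t
    proof -
      have "(u has_derivative (\<lambda>k. k \<bullet> grad u (\<gamma> t))) (at (\<gamma> t))"
        using C1_disc_GDERIV[OF u \<gamma>(1)] that sub unfolding gderiv_def by auto
      then have "((u \<circ> \<gamma>) has_vector_derivative (\<gamma>' t \<bullet> grad u (\<gamma> t))) (at t)"
        by (rule vector_derivative_diff_chain_within[OF \<gamma>(2) has_derivative_at_withinI])
      then show ?thesis unfolding h_def h'_def comp_def by (rule has_vector_derivative_at_within)
    qed
    have hi: "(h' has_integral (h q - h p)) {p..q}"
      using lt hd by (intro fundamental_theorem_of_calculus) auto
    \<comment> \<open>\<open>c\<close> is the mean slope. Integrating
      \<open>2 * c * h' - c\<^sup>2 \<le> F\<close>, which follows from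
      \<open>(h' - c)\<^sup>2 \<ge> 0\<close>, gives Cauchy-Schwarz with the optimal
      constant.\<close>
    define c where "c = (h q - h p) / (q - p)"
    have "((\<lambda>t. 2 * c * h' t - c\<^sup>2) has_integral (2 * c * (h q - h p) - (q - p) * c\<^sup>2)) {p..q}"
      using has_integral_diff[OF has_integral_mult_right[OF hi, of "2*c"] has_integral_const_real[of "c\<^sup>2" p q]] lt
      by (simp add: content_real)
    moreover have "2 * c * h' t - c\<^sup>2 \<le> F t" if "t \<in> {p..q}" for t
    proof -
      have "\<bar>h' t\<bar> \<le> norm (\<gamma>' t) * norm (grad u (\<gamma> t))"
        unfolding h'_def by (rule Cauchy_Schwarz_ineq2)
      also have "\<dots> \<le> norm (grad u (\<gamma> t))"
        using \<gamma>(3)[of t] that sub by (intro mult_left_le_one_le) auto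
      finally have "(h' t)\<^sup>2 \<le> F t" unfolding F_def by (metis abs_le_square_iff abs_norm_cancel)
      moreover have "0 \<le> (h' t - c)\<^sup>2" by simp
      ultimately show ?thesis by (simp add: power2_eq_square algebra_simps)
    qed
    moreover have Fi: "(F has_integral integral {p..q} F) {p..q}"
      using integrable_continuous_interval[OF cF] by (rule integrable_integral)
    ultimately have "2 * c * (h q - h p) - (q - p) * c\<^sup>2 \<le> integral {p..q} F"
      using has_integral_le by blast
    moreover have "(2 * c * (h q - h p) - (q - p) * c\<^sup>2) * (q - p) = (h q - h p)\<^sup>2"
    proof -
      have "c * (q - p) = h q - h p" using lt by (simp add: c_def)
      then show ?thesis by algebra
    qed
    ultimately have "(h q - h p)\<^sup>2 \<le> integral {p..q} F * (q - p)"
      using lt mult_right_mono[of _ "integral {p..q} F" "q - p"]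
        by (metis diff_ge_0_iff_ge less_imp_le)
    also have "\<dots> \<le> integral {p..q} F * (b - a)"
      using pq lt by (intro mult_left_mono integral_nonneg integrable_continuous_interval cF) (auto simp: F_def)
    finally have "ennreal ((h q - h p)\<^sup>2) \<le> ennreal (b - a) * ennreal (integral {p..q} F)"
      using pq by (subst ennreal_mult'[symmetric]) (auto simp: mult.commute intro: ennreal_leI)
    also have "ennreal (integral {p..q} F) = (\<integral>\<^sup>+t\<in>{p..q}. ennreal (F t) \<partial>lborel)"
      by (rule nn_integral_has_integral_lebesgue'[symmetric, OF _ Fi]) (simp add: F_def)
    also have "\<dots> \<le> (\<integral>\<^sup>+t\<in>{a..b}. ennreal (F t) \<partial>lborel)"
      using sub by (intro nn_integral_mono) (auto simp: indicator_def)
    finally show ?thesis unfolding h_def F_def by (simp add: mult_left_mono)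
  qed
  consider "p < q" | "p = q" | "q < p" by linarith
  then show ?thesis
    by cases (use main[OF pq] main[OF pq(2,1)] in \<open>auto simp: power2_commute\<close>)
qed

section \<open>Energies of polar boxes\<close>

text \<open>Cutting off outside the disc gives a function that is Borel on the whole plane, whatever
  \<open>grad u\<close> is elsewhere.\<close>

definition sq_grad :: "(complex \<Rightarrow> real) \<Rightarrow> complex \<Rightarrow> ennreal" where
  "sq_grad u z = ennreal ((norm (grad u z))\<^sup>2) * indicator (ball 0 1) z"

lemma dirichlet_energy_eq: "dirichlet_energy u = (\<integral>\<^sup>+z. sq_grad u z \<partial>lborel)"
  by (simp add: dirichlet_energy_def sq_grad_def)

lemma sq_grad_measurable [measurable]:
  assumes "C1_disc u"
  shows "sq_grad u \<in> borel_measurable borel"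
proof -
  have "continuous_on (ball 0 1) (\<lambda>z. (norm (grad u z))\<^sup>2)"
    using assms unfolding C1_disc_def by (intro continuous_intros) auto
  then have "(\<lambda>z. indicator (ball 0 1) z *\<^sub>R (norm (grad u z))\<^sup>2) \<in> borel_measurable borel"
    by (rule borel_measurable_continuous_on_indicator[rotated]) simp
  then have "(\<lambda>z. ennreal (indicator (ball 0 1) z *\<^sub>R (norm (grad u z))\<^sup>2))
    \<in> borel_measurable borel"
    by measurable
  also have "(\<lambda>z. ennreal (indicator (ball 0 1) z *\<^sub>R (norm (grad u z))\<^sup>2)) = sq_grad u"
    by (auto simp: sq_grad_def indicator_def)
  finally show ?thesis .
qed

lemma rcis_measurable_pair [measurable]:
  "(\<lambda>p. rcis (fst p) (snd p)) \<in> borel_measurable (borel \<Otimes>\<^sub>M borel)"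
  unfolding borel_prod rcis_def cis_conv_exp
  by (intro borel_measurable_continuous_onI continuous_intros)

lemma rcis_measurable_comp [measurable]:
  assumes [measurable]: "f \<in> borel_measurable M" "g \<in> borel_measurable M"
  shows "(\<lambda>x. rcis (f x) (g x)) \<in> borel_measurable M"
proof -
  have "(\<lambda>x. (f x, g x)) \<in> M \<rightarrow>\<^sub>M (borel \<Otimes>\<^sub>M borel)" by measurable
  from measurable_compose[OF this rcis_measurable_pair] show ?thesis by simp
qed

text \<open>The Jacobian \<open>r\<close> is left out on purpose: in this form the radial and the
  circular integrals are slices of one product integral.\<close>

definition box_energy :: "(complex \<Rightarrow> real) \<Rightarrow> real set \<Rightarrow> real set \<Rightarrow> ennreal" where
  "box_energy u S T = (\<integral>\<^sup>+\<theta>\<in>T. (\<integral>\<^sup>+r\<in>S. sq_grad u (rcis r \<theta>) \<partial>lborel) \<partial>lborel)"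

lemma box_energy_mono: "S \<subseteq> S' \<Longrightarrow> T \<subseteq> T' \<Longrightarrow> box_energy u S T \<le> box_energy u S' T'"
  unfolding box_energy_def
  by (intro nn_integral_mono mult_mono) (auto simp: indicator_def)

text \<open>For radii at least 1/4 the missing Jacobian costs a factor 4. The angle
  \<open>2 * pi\<close>, absent from polar coordinates, is a null set.\<close>

lemma box_energy_le_dirichlet:
  assumes [measurable]: "C1_disc u"
  shows "box_energy u {1/4..} {0..2*pi} \<le> 4 * dirichlet_energy u"
proof -
  have "box_energy u {1/4..} {0..2*pi} = (\<integral>\<^sup>+\<theta>\<in>{0..<2*pi}. (\<integral>\<^sup>+r\<in>{1/4..}.
    sq_grad u (rcis r \<theta>) \<partial>lborel) \<partial>lborel)"
    unfolding box_energy_def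
    by (rule nn_integral_cong_AE) (use AE_lborel_singleton[of "2*pi"] in eventually_elim, auto
      simp: indicator_def)
  also have "\<dots> = (\<integral>\<^sup>+\<theta>. \<integral>\<^sup>+r. sq_grad u (rcis r \<theta>) * indicator {1/4..} r
    * indicator {0..<2*pi} \<theta> \<partial>lborel \<partial>lborel)"
    by (simp add: nn_integral_multc)
  also have "\<dots> \<le> (\<integral>\<^sup>+\<theta>. \<integral>\<^sup>+r. 4 * (sq_grad u (rcis r \<theta>) * ennreal r * indicator {0<..} r
    * indicator {0..<2*pi} \<theta>) \<partial>lborel \<partial>lborel)"
  proof (intro nn_integral_mono)
    fix \<theta> r :: real
    have "1 \<le> 4 * ennreal r" if "1/4 \<le> r"
    proof -
      have "1 = ennreal 1" by simp
      also have "\<dots> \<le> ennreal (4 * r)" using that by (intro ennreal_leI) auto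
      finally show ?thesis by (simp add: ennreal_mult')
    qed
    then show "sq_grad u (rcis r \<theta>) * indicator {1/4..} r * indicator {0..<2*pi} \<theta> \<le>
      4 * (sq_grad u (rcis r \<theta>) * ennreal r * indicator {0<..} r * indicator {0..<2*pi} \<theta>)"
      using mult_left_mono[of 1 "4 * ennreal r" "sq_grad u (rcis r \<theta>)"]
      by (auto simp: indicator_def mult_ac)
  qed
  also have "\<dots> = 4 * (\<integral>\<^sup>+\<theta>. \<integral>\<^sup>+r. (sq_grad u (rcis r \<theta>) * ennreal r * indicator {0<..} r
    * indicator {0..<2*pi} \<theta>) \<partial>lborel \<partial>lborel)"
    by (simp add: nn_integral_cmult)
  also have "\<dots> = 4 * dirichlet_energy u"
    unfolding dirichlet_energy_eq by (subst nn_integral_polar[of "sq_grad u"]) auto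
  finally show ?thesis .
qed

text \<open>
  The Whitney cell of \<open>x\<close> has radii \<open>whitney_radii (level x)\<close>; \<open>wide_radii\<close> also covers the radii of
  the parent cell. Both stay away from \<open>0\<close>, so the weight \<open>r\<close> of polar coordinates is harmless.
\<close>

definition whitney_radii :: "nat \<Rightarrow> real set" where
  "whitney_radii k = {1 - 3 / 2 ^ (k+2) .. 1 - 1 / 2 ^ (k+1)}"

definition wide_radii :: "nat \<Rightarrow> real set" where
  "wide_radii k = {max (1/4) (1 - 3 / 2 ^ (k+1)) .. 1 - 1 / 2 ^ (k+1)}"

lemma wide_radii_bounds:
  assumes "r \<in> wide_radii k"
  shows "1/4 \<le> r" "r < 1"
proof -
  have "r \<le> 1 - 1 / 2 ^ (k+1)" "(0::real) < 1 / 2 ^ (k+1)" using assms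
    by (auto simp: wide_radii_def)
  then show "r < 1" by linarith
  show "1/4 \<le> r" using assms by (simp add: wide_radii_def)
qed

lemma whitney_subset_wide: "whitney_radii k \<subseteq> wide_radii k"
proof -
  have "(1::real) \<le> 2 ^ k" by simp
  then have "1/4 \<le> 1 - 3 / (2::real) ^ (k+2)" "1 - 3 / (2::real) ^ (k+1)
    \<le> 1 - 3 / (2::real) ^ (k+2)"
    by (auto simp: field_simps)
  then show ?thesis by (auto simp: whitney_radii_def wide_radii_def)
qed

lemma whitney_subset_wide_Suc: "whitney_radii k \<subseteq> wide_radii (Suc k)"
proof -
  have "(1::real) \<le> 2 ^ k" by simp
  then have "1/4 \<le> 1 - 3 / (2::real) ^ (k+2)" "1 - 1 / (2::real) ^ (k+1)
    \<le> 1 - 1 / (2::real) ^ (k+2)"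
    by (auto simp: field_simps)
  then show ?thesis by (auto simp: whitney_radii_def wide_radii_def)
qed

abbreviation cell_energy :: "(complex \<Rightarrow> real) \<Rightarrow> vertex \<Rightarrow> ennreal" where
  "cell_energy u x \<equiv> box_energy u (wide_radii (level x)) (closed_arc x)"

definition radial_energy :: "(complex \<Rightarrow> real) \<Rightarrow> nat \<Rightarrow> real \<Rightarrow> ennreal" where
  "radial_energy u k \<theta> = (\<integral>\<^sup>+r\<in>wide_radii k. sq_grad u (rcis r \<theta>) \<partial>lborel)"

definition arc_energy :: "(complex \<Rightarrow> real) \<Rightarrow> vertex \<Rightarrow> real \<Rightarrow> ennreal" where
  "arc_energy u x r = (\<integral>\<^sup>+\<theta>\<in>closed_arc x. sq_grad u (rcis r \<theta>) \<partial>lborel)"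

text \<open>The mean is taken over \<open>wide_radii\<close>, so the chosen ray is also good at the
  radius selected for the parent. The arc has length 2 pi / 2^k; only 1 / 2^k of it is kept.\<close>

lemma ex_good_angle:
  assumes [measurable]: "C1_disc u"
  shows "\<exists>\<theta>\<in>closed_arc x. ennreal (1 / 2 ^ level x) * radial_energy u (level x) \<theta> \<le> cell_energy u x"
proof -
  have m: "radial_energy u (level x) \<in> borel_measurable borel"
    unfolding radial_energy_def[abs_def] wide_radii_def by measurable
  let ?a = "2 * pi * (real (snd x) - 1) / 2 ^ level x"
    and ?b = "2 * pi * real (snd x) / 2 ^ level x"
  have d: "?b - ?a = 2 * pi / 2 ^ level x" by (simp add: field_simps)
  have "?a < ?b" by (simp add: divide_strict_right_mono)
  from ex_le_mean[OF m this] obtain \<theta> where \<theta>: "\<theta> \<in> closed_arc x"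
    "ennreal (2 * pi / 2 ^ level x) * radial_energy u (level x) \<theta> \<le> cell_energy u x"
    unfolding d closed_arc_def[symmetric] box_energy_def radial_energy_def by blast
  have "ennreal (1 / 2 ^ level x) \<le> ennreal (2 * pi / 2 ^ level x)"
    using pi_gt3 by (intro ennreal_leI divide_right_mono) auto
  then show ?thesis using \<theta> by (meson order_trans mult_right_mono zero_le)
qed

text \<open>The radius is sought in the narrow interval \<open>whitney_radii\<close>, of length 1 /
  2^(k+2), which lies in the wide radii of the vertex and of its children. Tonelli turns the
  integral of \<open>arc_energy\<close> into a box energy.\<close>

lemma ex_good_radius:
  assumes [measurable]: "C1_disc u"
  shows "\<exists>r\<in>whitney_radii (level x). ennreal (1 / 2 ^ (level x + 2)) * arc_energy u x r
    \<le> cell_energy u x"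
proof -
  have m: "arc_energy u x \<in> borel_measurable borel"
    unfolding arc_energy_def[abs_def] closed_arc_def by measurable
  let ?a = "1 - 3 / 2 ^ (level x+2) :: real" and ?b = "1 - 1 / 2 ^ (level x+1) :: real"
  have d: "?b - ?a = 1 / 2 ^ (level x + 2)" by (simp add: field_simps)
  then have "?a < ?b" by (smt (verit) zero_less_divide_1_iff zero_less_power)
  from ex_le_mean[OF m this] obtain r where r: "r \<in> whitney_radii (level x)"
    "ennreal (1 / 2 ^ (level x + 2)) * arc_energy u x r
      \<le> (\<integral>\<^sup>+r\<in>whitney_radii (level x). arc_energy u x r \<partial>lborel)"
    unfolding d whitney_radii_def[symmetric] by blast
  have [measurable]: "whitney_radii (level x) \<in> sets borel" "closed_arc x \<in> sets borel"
    by (simp_all add: whitney_radii_def closed_arc_def)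
  have "(\<integral>\<^sup>+r\<in>whitney_radii (level x). arc_energy u x r \<partial>lborel)
    = (\<integral>\<^sup>+r. \<integral>\<^sup>+\<theta>. sq_grad u (rcis r \<theta>) * indicator (closed_arc x) \<theta>
      * indicator (whitney_radii (level x)) r \<partial>lborel \<partial>lborel)"
    unfolding arc_energy_def by (simp add: nn_integral_multc)
  also have "\<dots> = (\<integral>\<^sup>+\<theta>. \<integral>\<^sup>+r. sq_grad u (rcis r \<theta>) * indicator (closed_arc x) \<theta>
    * indicator (whitney_radii (level x)) r \<partial>lborel \<partial>lborel)"
    by (rule lborel_pair.Fubini') measurable
  also have "\<dots> = (\<integral>\<^sup>+\<theta>. \<integral>\<^sup>+r. sq_grad u (rcis r \<theta>) * indicator (whitney_radii (level x)) r
    * indicator (closed_arc x) \<theta> \<partial>lborel \<partial>lborel)"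
    by (simp add: mult_ac)
  also have "\<dots> = box_energy u (whitney_radii (level x)) (closed_arc x)"
    unfolding box_energy_def by (simp add: nn_integral_multc)
  also have "\<dots> \<le> cell_energy u x"
    using whitney_subset_wide by (rule box_energy_mono) simp
  finally show ?thesis using r by (meson order_trans)
qed

lemma radial_oscillation:
  assumes u: "C1_disc u" and "r \<in> wide_radii k" "s \<in> wide_radii k"
  shows "ennreal ((u (rcis r \<theta>) - u (rcis s \<theta>))\<^sup>2) \<le> ennreal (1 / 2 ^ k) * radial_energy u k \<theta>"
proof -
  let ?a = "max (1/4) (1 - 3 / 2 ^ (k+1)) :: real" and ?b = "1 - 1 / 2 ^ (k+1) :: real"
  have w: "wide_radii k = {?a..?b}" by (simp add: wide_radii_def)
  have inb: "rcis t \<theta> \<in> ball 0 1" if "t \<in> {?a..?b}" for t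
    using wide_radii_bounds[of t k] that w by auto
  have der: "((\<lambda>t. rcis t \<theta>) has_vector_derivative cis \<theta>) (at t)" for t
    unfolding rcis_def by (auto intro!: derivative_eq_intros has_vector_derivative_of_real)
  have "ennreal ((u (rcis r \<theta>) - u (rcis s \<theta>))\<^sup>2) \<le>
    ennreal (?b - ?a) * (\<integral>\<^sup>+t\<in>{?a..?b}. ennreal ((norm (grad u (rcis t \<theta>)))\<^sup>2) \<partial>lborel)"
    by (rule path_energy[OF u inb der]) (use assms w in auto)
  also have "(\<integral>\<^sup>+t\<in>{?a..?b}. ennreal ((norm (grad u (rcis t \<theta>)))\<^sup>2) \<partial>lborel) = radial_energy u k \<theta>"
    unfolding radial_energy_def w sq_grad_def
    by (intro nn_integral_cong) (use inb in \<open>auto simp: indicator_def\<close>)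
  \<comment> \<open>The radial length is at most 3/2^(k+1) - 1/2^(k+1) = 1/2^k; the cut at 1/4 only
    shortens it.\<close>
  also have "ennreal (?b - ?a) * radial_energy u k \<theta> \<le> ennreal (1 / 2 ^ k) * radial_energy u k \<theta>"
    by (intro mult_right_mono ennreal_leI) (auto simp: field_simps max_def)
  finally show ?thesis .
qed

text \<open>The arc has angular length 8 pi / 2^(k+2), and 8 pi < 26. The factor 1 / 2^(k+2) is kept
  apart so that \<open>ex_good_radius\<close> applies directly.\<close>

lemma arc_oscillation:
  assumes u: "C1_disc u" and r: "0 \<le> r" "r < 1" and "s \<in> closed_arc x" "t \<in> closed_arc x"
  shows "ennreal ((u (rcis r s) - u (rcis r t))\<^sup>2)
    \<le> 26 * (ennreal (1 / 2 ^ (level x + 2)) * arc_energy u x r)"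
proof -
  let ?a = "2 * pi * (real (snd x) - 1) / 2 ^ level x"
    and ?b = "2 * pi * real (snd x) / 2 ^ level x"
  have inb: "rcis r t \<in> ball 0 1" for t using r by auto
  have der: "((\<lambda>t. rcis r t) has_vector_derivative (of_real r * (\<i> * cis t))) (at t)" for t
    unfolding rcis_def cis_conv_exp
      by (auto intro!: derivative_eq_intros has_vector_derivative_real_field simp: mult_ac)
  have cont: "continuous_on UNIV (\<lambda>t. of_real r * (\<i> * cis t))"
    unfolding cis_conv_exp by (intro continuous_intros)
  have "ennreal ((u (rcis r s) - u (rcis r t))\<^sup>2) \<le>
    ennreal (?b - ?a) * (\<integral>\<^sup>+t\<in>{?a..?b}. ennreal ((norm (grad u (rcis r t)))\<^sup>2) \<partial>lborel)"
    by (rule path_energy[OF u inb der _ cont]) (use assms in \<open>auto simp: closed_arc_def norm_mult\<close>)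
  also have "(\<integral>\<^sup>+t\<in>{?a..?b}. ennreal ((norm (grad u (rcis r t)))\<^sup>2) \<partial>lborel) = arc_energy u x r"
    unfolding arc_energy_def closed_arc_def sq_grad_def
    by (intro nn_integral_cong) (use inb in \<open>auto simp: indicator_def\<close>)
  also have "ennreal (?b - ?a) * arc_energy u x r
    \<le> (26 * ennreal (1 / 2 ^ (level x + 2))) * arc_energy u x r"
  proof (rule mult_right_mono)
    have "?b - ?a = 8 * pi * (1 / 2 ^ (level x + 2))" by (simp add: field_simps)
    also have "\<dots> \<le> 26 * (1 / 2 ^ (level x + 2))"
      using pi_approx by (intro mult_right_mono) auto
    finally have "ennreal (?b - ?a) \<le> ennreal (26 * (1 / 2 ^ (level x + 2)))" by (rule ennreal_leI)
    then show "ennreal (?b - ?a) \<le> 26 * ennreal (1 / 2 ^ (level x + 2))"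
      by (metis ennreal_mult' ennreal_numeral zero_le_numeral)
  qed simp
  finally show ?thesis by (simp only: mult.assoc)
qed


section \<open>Bounded overlap of the enlarged Whitney cells\<close>

definition nbhd_radii :: "nat \<Rightarrow> real set" where
  "nbhd_radii k = {r. 1/4 \<le> r \<and> 1/2 \<le> 2 ^ k * (1 - r) \<and> 2 ^ k * (1 - r) \<le> 3}"

definition nbhd_arc :: "vertex \<Rightarrow> real set" where
  "nbhd_arc x = {\<theta>. 0 \<le> \<theta> \<and> \<theta> \<le> 2 * pi \<and> real (snd x) - 2 \<le> 2 ^ level x * \<theta> / (2 * pi) \<and>
     2 ^ level x * \<theta> / (2 * pi) \<le> real (snd x) + 1}"

lemma wide_subset_nbhd: "wide_radii k \<subseteq> nbhd_radii k"
  by (auto simp: wide_radii_def nbhd_radii_def field_simps)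

text \<open>On \<open>wide_radii k\<close> the quantity \<open>2 ^ k * (1 - r)\<close> lies in
  [1/2, 3/2], and one level further it doubles to [1, 3]. The bound 1/2 in \<open>nbhd_radii\<close>
  thus serves the vertex itself and the bound 3 its parent.\<close>

lemma wide_subset_nbhd_Suc: "wide_radii k \<subseteq> nbhd_radii (Suc k)"
  by (auto simp: wide_radii_def nbhd_radii_def field_simps)

lemma closed_arc_subset_nbhd:
  assumes "x \<in> tree_verts" "level y = level x" "snd x \<le> snd y + 1" "snd y \<le> snd x + 1"
  shows "closed_arc x \<subseteq> nbhd_arc y"
proof
  fix \<theta> assume t: "\<theta> \<in> closed_arc x"
  then have "0 \<le> \<theta>" "\<theta> \<le> 2 * pi" using closed_arc_subset[OF assms(1)] by auto
  moreover have "real (snd x) - 1 \<le> 2 ^ level x * \<theta> / (2 * pi)" "2 ^ level x * \<theta> / (2 * pi)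
    \<le> real (snd x)"
    using t by (auto simp: closed_arc_def field_simps)
  moreover have "real (snd x) \<le> real (snd y) + 1" "real (snd y) \<le> real (snd x) + 1"
    using assms by linarith+
  ultimately show "\<theta> \<in> nbhd_arc y"
    using assms(2) by (auto simp: nbhd_arc_def)
qed

text \<open>The parent adds the sibling arc, on the left or on the right according to the parity of
  the index; hence the margin of one arc on both sides in \<open>nbhd_arc\<close>.\<close>

lemma closed_arc_parent_subset_nbhd:
  assumes "x \<in> tree_verts" "1 \<le> level x"
  shows "closed_arc (parent x) \<subseteq> nbhd_arc x"
proof
  fix \<theta> assume t: "\<theta> \<in> closed_arc (parent x)"
  obtain k j where x: "x = (Suc k, j)" using assms by (cases x) (auto simp: Suc_le_eq gr0_conv_Suc)
  let ?m = "(j + 1) div 2"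
  have "j = 2 * ?m \<or> j + 1 = 2 * ?m" by presburger
  then have k: "real j \<le> 2 * real ?m" "2 * real ?m \<le> real j + 1" by linarith+
  have "0 \<le> \<theta>" "\<theta> \<le> 2 * pi" using closed_arc_subset[OF parent_in_tree_verts[OF assms]] t by auto
  moreover have "2 * real ?m - 2 \<le> 2 ^ Suc k * \<theta> / (2 * pi)" "2 ^ Suc k * \<theta> / (2 * pi)
    \<le> 2 * real ?m"
    using t by (auto simp: closed_arc_def parent_def x field_simps)
  ultimately show "\<theta> \<in> nbhd_arc x"
    using k by (auto simp: nbhd_arc_def x simp del: power_Suc)
qed

text \<open>12 = 3 * 4. A fixed radius admits levels whose scales differ by a factor at most 6,
  hence at most three of them, and at each level an angle lies in at most four enlarged
  arcs.\<close>

lemma card_nbhd_le: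
  assumes "finite X"
  shows "card {x \<in> X. r \<in> nbhd_radii (level x) \<and> \<theta> \<in> nbhd_arc x} \<le> 12"
proof -
  let ?K = "{k. r \<in> nbhd_radii k}" and ?J = "\<lambda>k. {j. \<theta> \<in> nbhd_arc (k, j)}"
  have K: "finite ?K \<and> card ?K \<le> Suc 2"
  proof (rule card_spread_le)
    fix a b assume "a \<in> ?K" "b \<in> ?K"
    then have ab: "1/2 \<le> 2 ^ a * (1 - r)" "2 ^ b * (1 - r) \<le> 3" by (auto simp: nbhd_radii_def)
    show "b \<le> a + 2"
    proof (rule ccontr)
      assume "\<not> b \<le> a + 2"
      then have "(2::real) ^ (a + 3) \<le> 2 ^ b" by (intro power_increasing) auto
      moreover have "0 < 2 ^ a * (1 - r)" using ab(1) by linarith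
      then have "0 < 1 - r" by (rule zero_less_mult_pos) simp
      ultimately have "2 ^ (a + 3) * (1 - r) \<le> 2 ^ b * (1 - r)" by (intro mult_right_mono) auto
      moreover have "2 ^ (a + 3) * (1 - r) = 8 * (2 ^ a * (1 - r))" by (simp add: power_add)
      ultimately show False using ab by linarith
    qed
  qed
  have J: "finite (?J k) \<and> card (?J k) \<le> Suc 3" for k
  proof (rule card_spread_le)
    fix a b assume "a \<in> ?J k" "b \<in> ?J k"
    then have "real b - 2 \<le> 2 ^ k * \<theta> / (2 * pi)" "2 ^ k * \<theta> / (2 * pi) \<le> real a + 1"
      unfolding nbhd_arc_def by simp_all
    then show "b \<le> a + 3" by linarith
  qed
  have "{x \<in> X. r \<in> nbhd_radii (level x) \<and> \<theta> \<in> nbhd_arc x} \<subseteq> Sigma ?K ?J"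
    by auto
  then have "card {x \<in> X. r \<in> nbhd_radii (level x) \<and> \<theta> \<in> nbhd_arc x} \<le> card (Sigma ?K ?J)"
    using K J by (intro card_mono finite_SigmaI) auto
  also have "\<dots> = (\<Sum>k\<in>?K. card (?J k))" using K J by (intro card_SigmaI) auto
  also have "\<dots> \<le> (\<Sum>k\<in>?K. 4)" using J by (intro sum_mono) simp
  also have "\<dots> \<le> 12" using K by simp
  finally show ?thesis .
qed

lemma nbhd_borel [measurable]: "nbhd_radii k \<in> sets borel" "nbhd_arc x \<in> sets borel"
  unfolding nbhd_radii_def nbhd_arc_def by measurable

text \<open>48 = 12 * 4: the overlap count times the loss from the omitted Jacobian.\<close>

lemma sum_nbhd_energy_le:
  assumes u [measurable]: "C1_disc u" and X: "finite X"
  shows "(\<Sum>x\<in>X. box_energy u (nbhd_radii (level x)) (nbhd_arc x)) \<le> 48 * dirichlet_energy u"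
proof -
  let ?F = "\<lambda>x \<theta> r. sq_grad u (rcis r \<theta>) * indicator (nbhd_radii (level x)) r
    * indicator (nbhd_arc x) \<theta>"
  have "(\<Sum>x\<in>X. box_energy u (nbhd_radii (level x)) (nbhd_arc x))
    = (\<Sum>x\<in>X. \<integral>\<^sup>+\<theta>. \<integral>\<^sup>+r. ?F x \<theta> r \<partial>lborel \<partial>lborel)"
    unfolding box_energy_def by (simp add: nn_integral_multc)
  also have "\<dots> = (\<integral>\<^sup>+\<theta>. \<integral>\<^sup>+r. (\<Sum>x\<in>X. ?F x \<theta> r) \<partial>lborel \<partial>lborel)"
    by (simp add: nn_integral_sum)
  also have "\<dots> \<le> (\<integral>\<^sup>+\<theta>. \<integral>\<^sup>+r. 12 * (sq_grad u (rcis r \<theta>) * indicator {1/4..} r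
    * indicator {0..2*pi} \<theta>) \<partial>lborel \<partial>lborel)"
  proof (intro nn_integral_mono)
    fix \<theta> r :: real
    let ?A = "{x \<in> X. r \<in> nbhd_radii (level x) \<and> \<theta> \<in> nbhd_arc x}"
    let ?g = "sq_grad u (rcis r \<theta>) * indicator {1/4..} r * indicator {0..2*pi} \<theta>"
    have "(\<Sum>x\<in>X. ?F x \<theta> r) = (\<Sum>x\<in>?A. ?g)"
      using X by (intro sum.mono_neutral_cong_right) (auto
        simp: indicator_def nbhd_radii_def nbhd_arc_def)
    also have "\<dots> = of_nat (card ?A) * ?g" by simp
    also have "\<dots> \<le> of_nat 12 * ?g"
      using card_nbhd_le[OF X] by (intro mult_right_mono) (auto simp del: of_nat_numeral)
    finally show "(\<Sum>x\<in>X. ?F x \<theta> r) \<le> 12 * ?g" by simp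
  qed
  also have "\<dots> = 12 * box_energy u {1/4..} {0..2*pi}"
    unfolding box_energy_def by (simp add: nn_integral_cmult nn_integral_multc)
  also have "\<dots> \<le> 12 * (4 * dirichlet_energy u)"
    using box_energy_le_dirichlet[OF u] by (rule mult_left_mono) simp
  finally show ?thesis by (simp add: mult.assoc[symmetric])
qed

section \<open>The tree capacity is bounded by the disc capacity\<close>

lemma infsum_ennreal_le:
  fixes f :: "'a \<Rightarrow> ennreal"
  assumes "\<And>F. finite F \<Longrightarrow> F \<subseteq> A \<Longrightarrow> sum f F \<le> b"
  shows "infsum f A \<le> b"
  using assms by (intro infsum_le_finite_sums nonneg_summable_on_complete) auto

lemma sum_le_infsum_ennreal:
  fixes f :: "'a \<Rightarrow> ennreal"
  assumes "finite F" "F \<subseteq> A"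
  shows "sum f F \<le> infsum f A"
proof -
  have "infsum f F \<le> infsum f A" using assms
    by (intro infsum_mono_neutral nonneg_summable_on_complete) auto
  then show ?thesis using assms by simp
qed

lemma ennreal_sq_add_le:
  assumes "ennreal ((a - b)\<^sup>2) \<le> A" "ennreal ((b - c)\<^sup>2) \<le> B"
  shows "ennreal ((a - c)\<^sup>2) \<le> 2 * (A + B)"
proof -
  have "0 \<le> (a - b - (b - c))\<^sup>2" by simp
  then have "(a - c)\<^sup>2 \<le> 2 * ((a - b)\<^sup>2 + (b - c)\<^sup>2)" by (simp add: power2_eq_square algebra_simps)
  then have "ennreal ((a - c)\<^sup>2) \<le> ennreal (2 * ((a - b)\<^sup>2 + (b - c)\<^sup>2))" by (rule ennreal_leI)
  also have "\<dots> = 2 * (ennreal ((a - b)\<^sup>2) + ennreal ((b - c)\<^sup>2))"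
    by (simp add: ennreal_mult' ennreal_plus)
  also have "\<dots> \<le> 2 * (A + B)" using assms by (intro mult_left_mono add_mono) auto
  finally show ?thesis .
qed

lemma sum_le_sum_along:
  assumes z: "\<zeta> \<in> tree_boundary" and \<phi>: "\<And>x. x \<in> tree_verts \<Longrightarrow> 0 \<le> \<phi> x" and fin: "finite K"
  shows "ennreal (\<Sum>k\<in>K. \<phi> (\<zeta> k)) \<le> sum_along \<phi> (pred_boundary \<zeta>)"
proof -
  have inj: "inj \<zeta>" using boundary_level[OF z] by (metis injI)
  have "ennreal (\<Sum>k\<in>K. \<phi> (\<zeta> k)) = (\<Sum>k\<in>K. ennreal (\<phi> (\<zeta> k)))"
    using \<phi> boundary_vert[OF z] by (intro sum_ennreal[symmetric]) auto
  also have "\<dots> = (\<Sum>x\<in>\<zeta> ` K. ennreal (\<phi> x))"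
    using inj by (subst sum.reindex) (auto intro: inj_on_subset)
  also have "\<dots> \<le> sum_along \<phi> (pred_boundary \<zeta>)"
    unfolding sum_along_def pred_boundary_def using fin by (intro sum_le_infsum_ennreal) auto
  finally show ?thesis .
qed

text \<open>2592 = 54 * 48. Here 54 = 2 * (1 + 26) collects the radial leg, the circular leg at the
  radius of the parent and the factor 2 of \<open>ennreal_sq_add_le\<close>; 48 is the overlap
  constant.\<close>

lemma tree_Cap_n_le_dirichlet_energy:
  assumes adm: "disc_admissible E (cball 0 (1 - 1 / 2 ^ n)) u" and E: "E \<subseteq> sphere 0 1"
    and n: "1 \<le> n"
  shows "tree_Cap_n n (Lambda_preimage E) \<le> 2592 * dirichlet_energy u"
proof (cases "dirichlet_energy u = \<infinity>")
  case True
  then show ?thesis by (simp add: ennreal_mult_top)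
next
  case False
  have u: "C1_disc u" using adm by (simp add: disc_admissible_def)
  let ?e = "\<lambda>x. box_energy u (nbhd_radii (level x)) (nbhd_arc x)"
  obtain th where th: "\<And>x. th x \<in> closed_arc x"
      "\<And>x. ennreal (1 / 2 ^ level x) * radial_energy u (level x) (th x) \<le> cell_energy u x"
    using ex_good_angle[OF u] by metis
  obtain rh where rh: "\<And>x. rh x \<in> whitney_radii (level x)"
      "\<And>x. ennreal (1 / 2 ^ (level x + 2)) * arc_energy u x (rh x) \<le> cell_energy u x"
    using ex_good_radius[OF u] by metis
  have rh_wide: "rh x \<in> wide_radii (level x)" for x
    using rh(1) whitney_subset_wide by blast
  have rh01: "0 \<le> rh x" "rh x < 1" for x
    using wide_radii_bounds[OF rh_wide[of x]] by auto
  define a where "a x = u (rcis (rh x) (th x))" for x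
  \<comment> \<open>Valid for every angle of the arc, in particular for the ray towards a point of
    \<open>E\<close>, which need not be a good angle.\<close>
  have arc: "ennreal ((u (rcis (rh x) t) - a x)\<^sup>2) \<le> 26 * cell_energy u x" if "t \<in> closed_arc x"
    for x t
    unfolding a_def
    using arc_oscillation[OF u rh01 that th(1), of x] mult_left_mono[OF rh(2)[of x], of 26]
    by (rule order_trans) simp
  have cell_le: "cell_energy u x \<le> ?e x" if "x \<in> tree_verts" for x
    using that by (intro box_energy_mono wide_subset_nbhd closed_arc_subset_nbhd) auto
  \<comment> \<open>Only increments from level \<open>n\<close> on are counted; those above may be
    dropped because \<open>a\<close> is already nonpositive at level \<open>n - 1\<close>.\<close>
  define \<phi> where "\<phi> x = (if n \<le> level x then \<bar>a x - a (parent x)\<bar> else 0)" for x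
  have phi_le: "ennreal ((\<phi> x)\<^sup>2) \<le> 54 * ?e x" if x: "x \<in> tree_verts" for x
  proof (cases "n \<le> level x")
    case True
    then have l: "1 \<le> level x" using n by simp
    have lp: "Suc (level (parent x)) = level x" using l by (simp add: parent_def)
    have "rh (parent x) \<in> wide_radii (level x)"
      using rh(1)[of "parent x"] whitney_subset_wide_Suc[of "level (parent x)"] lp by auto
    from radial_oscillation[OF u rh_wide this]
    have "ennreal ((a x - u (rcis (rh (parent x)) (th x)))\<^sup>2)
      \<le> ennreal (1 / 2 ^ level x) * radial_energy u (level x) (th x)"
      unfolding a_def .
    also have "\<dots> \<le> ?e x" using th(2) cell_le[OF x] by (rule order_trans)
    finally have 1: "ennreal ((a x - u (rcis (rh (parent x)) (th x)))\<^sup>2) \<le> ?e x" .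
    have "th x \<in> closed_arc (parent x)" using th(1) closed_arc_parent_subset[OF l] by blast
    from arc[OF this]
    have "ennreal ((u (rcis (rh (parent x)) (th x)) - a (parent x))\<^sup>2)
      \<le> 26 * cell_energy u (parent x)" .
    also have "\<dots> \<le> 26 * ?e x"
      using wide_subset_nbhd_Suc[of "level (parent x)"] closed_arc_parent_subset_nbhd[OF x l] lp
      by (intro mult_left_mono box_energy_mono) auto
    finally have "ennreal ((a x - a (parent x))\<^sup>2) \<le> 2 * (?e x + 26 * ?e x)"
      using ennreal_sq_add_le[OF 1] by blast
    also have "\<dots> = 54 * ?e x"
    proof -
      have "2 * (?e x + 26 * ?e x) = (2 * (1 + 26)) * ?e x"
        by (simp only: distrib_left distrib_right mult_1_left mult.assoc)
      then show ?thesis by simp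
    qed
    finally show ?thesis using True by (simp add: \<phi>_def)
  qed (simp add: \<phi>_def)
  have energy: "tree_energy \<phi> \<le> 2592 * dirichlet_energy u"
    unfolding tree_energy_def
  proof (rule infsum_ennreal_le)
    fix F assume F: "finite F" "F \<subseteq> tree_verts"
    have "(\<Sum>x\<in>F. ennreal ((\<phi> x)\<^sup>2)) \<le> (\<Sum>x\<in>F. 54 * ?e x)"
      using phi_le F by (intro sum_mono) auto
    also have "\<dots> = 54 * (\<Sum>x\<in>F. ?e x)" by (simp add: sum_distrib_left)
    also have "\<dots> \<le> 54 * (48 * dirichlet_energy u)"
      using sum_nbhd_energy_le[OF u F(1)] by (rule mult_left_mono) simp
    finally show "(\<Sum>x\<in>F. ennreal ((\<phi> x)\<^sup>2)) \<le> 2592 * dirichlet_energy u"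
      by (simp add: mult.assoc[symmetric])
  qed
  have "tree_admissible n (Lambda_preimage E) \<phi>"
    unfolding tree_admissible_def
  proof (intro conjI ballI impI)
    show "0 \<le> \<phi> x" for x by (simp add: \<phi>_def)
    show "sum_along \<phi> (pred_vertex x) = 0" if "level x = n - 1" for x
    proof -
      have "\<phi> y = 0" if "y \<in> pred_vertex x" for y
      proof -
        have "\<not> n \<le> level y"
          using pred_vertex_level_le(1)[OF that] \<open>level x = n - 1\<close> n by linarith
        then show ?thesis by (simp add: \<phi>_def)
      qed
      then show ?thesis unfolding sum_along_def by (intro infsum_0) simp
    qed
  next
    fix \<zeta> assume "\<zeta> \<in> Lambda_preimage E"
    then have z: "\<zeta> \<in> tree_boundary" and w: "Lambda \<zeta> \<in> E" by (auto simp: Lambda_preimage_def)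
    note lev = boundary_level[OF z]
    have "\<exists>t\<in>closed_arc (\<zeta> k). cis t = Lambda \<zeta>" for k
    proof -
      have "Lambda \<zeta> \<in> cis ` closed_arc (\<zeta> k)"
        using Lambda_in_arc[OF z, of k] closure_dyadic_arc_subset by blast
      then show ?thesis by (metis imageE)
    qed
    \<comment> \<open>The angle is chosen for each \<open>k\<close> separately, since for the point
      1 it may be \<open>0\<close> or \<open>2 * pi\<close>.\<close>
    then obtain t where t: "\<And>k. t k \<in> closed_arc (\<zeta> k)" "\<And>k. cis (t k) = Lambda \<zeta>" by metis
    define b where "b k = u (of_real (rh (\<zeta> k)) * Lambda \<zeta>)" for k
    have b: "b k = u (rcis (rh (\<zeta> k)) (t k))" for k
      by (simp add: b_def rcis_def t)
    define er where "er k = enn2real (?e (\<zeta> k))" for k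
    have fin: "?e x < \<infinity>" for x
      using sum_nbhd_energy_le[OF u, of "{x}"] False
      by (auto simp: less_top[symmetric] top_unique ennreal_mult_eq_top_iff)
    have er: "?e (\<zeta> k) = ennreal (er k)" for k
      using fin[of "\<zeta> k"] by (simp add: er_def)
    have inj: "inj \<zeta>" using lev by (metis injI)
    \<comment> \<open>The vertices of a geodesic are distinct, so every partial sum is bounded by
      the overlap estimate. This is what makes the circular corrections tend to 0.\<close>
    have "summable er"
    proof (rule summableI_nonneg_bounded)
      show "0 \<le> er k" for k by (simp add: er_def)
      show "(\<Sum>k<N. er k) \<le> enn2real (48 * dirichlet_energy u)" for N
      proof -
        have "ennreal (\<Sum>k<N. er k) = (\<Sum>k<N. ?e (\<zeta> k))"
          unfolding er by (rule sum_ennreal[symmetric]) (simp add: er_def)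
        also have "\<dots> = (\<Sum>x\<in>\<zeta> ` {..<N}. ?e x)"
          using inj by (subst sum.reindex) (auto intro: inj_on_subset)
        also have "\<dots> \<le> 48 * dirichlet_energy u" by (rule sum_nbhd_energy_le[OF u]) simp
        finally have "ennreal (\<Sum>k<N. er k) \<le> 48 * dirichlet_energy u" .
        moreover have "48 * dirichlet_energy u < \<infinity>"
          using False by (simp add: ennreal_mult_less_top less_top)
        ultimately show ?thesis
          by (metis enn2real_mono enn2real_ennreal infinity_ennreal_def sum_nonneg enn2real_nonneg er_def)
      qed
    qed
    then have er0: "er \<longlonglongrightarrow> 0" by (rule summable_LIMSEQ_zero)
    have ba: "(b k - a (\<zeta> k))\<^sup>2 \<le> 26 * er k" for k
    proof -
      have "ennreal ((b k - a (\<zeta> k))\<^sup>2) \<le> 26 * ?e (\<zeta> k)"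
        using arc[OF t(1)[of k]] mult_left_mono[OF cell_le[OF boundary_vert[OF z, of k]], of 26]
          unfolding b
        by (rule order_trans) simp
      also have "\<dots> = ennreal (26 * er k)" unfolding er by (simp add: ennreal_mult' er_def)
      finally show ?thesis by (simp add: er_def)
    qed
    have lim_rh: "filterlim (\<lambda>k. rh (\<zeta> k)) (at_left 1) sequentially"
    proof -
      have "(\<lambda>k. rh (\<zeta> k)) \<longlonglongrightarrow> 1"
      proof (rule tendsto_sandwich)
        have "(\<lambda>k. inverse (2 ^ k) :: real) \<longlonglongrightarrow> 0"
          by (rule LIMSEQ_inverse_realpow_zero) simp
        from tendsto_diff[OF tendsto_const[of 1] tendsto_mult_left[OF this, of "3/4"]]
        show "(\<lambda>k. 1 - 3 / 4 * inverse (2 ^ k) :: real) \<longlonglongrightarrow> 1" by simp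
        have "1 - 3 / 4 * inverse (2 ^ k) \<le> rh (\<zeta> k)" for k
        proof -
          have "3 / (2::real) ^ (k + 2) = 3 / 4 * inverse (2 ^ k)" by (simp add: field_simps)
          moreover have "1 - 3 / (2::real) ^ (k + 2) \<le> rh (\<zeta> k)"
            using rh(1)[of "\<zeta> k"] unfolding lev whitney_radii_def by (simp only: atLeastAtMost_iff)
          ultimately show ?thesis by linarith
        qed
        then show "\<forall>\<^sub>F k in sequentially. 1 - 3 / 4 * inverse (2 ^ k) \<le> rh (\<zeta> k)"
          by simp
        show "\<forall>\<^sub>F k in sequentially. rh (\<zeta> k) \<le> 1"
          by (intro always_eventually allI less_imp_le rh01(2))
      qed simp
      then show ?thesis by (simp add: filterlim_at rh01(2) less_imp_neq[OF rh01(2)])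
    qed
    have wns: "Lambda \<zeta> \<notin> ball 0 1" using w E by auto
    then obtain l where l: "((\<lambda>r. ereal (u (of_real r * Lambda \<zeta>))) \<longlongrightarrow> l) (at_left 1)"
      using adm w unfolding disc_admissible_def by blast
    have "Lim (at_left 1) (\<lambda>r. ereal (u (of_real r * Lambda \<zeta>))) = l"
      using l by (intro tendsto_Lim) auto
    then have l1: "1 \<le> l" using adm w wns unfolding disc_admissible_def disc_value_def by metis
    have bl: "(\<lambda>k. ereal (b k)) \<longlonglongrightarrow> l"
      unfolding b_def using filterlim_compose[OF l lim_rh] .
    \<comment> \<open>\<open>whitney_radii (n - 1)\<close> ends exactly at
      \<open>1 - 1 / 2 ^ n\<close>, the radius of the inner disc on which \<open>u\<close> is
      nonpositive.\<close>
    have a0: "a (\<zeta> (n - 1)) \<le> 0"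
    proof -
      have "rh (\<zeta> (n-1)) \<le> 1 - 1 / 2 ^ n"
      proof -
        have "n - 1 + 1 = n" using n by simp
        then show ?thesis
          using rh(1)[of "\<zeta> (n-1)"] unfolding lev whitney_radii_def
            by (simp only: atLeastAtMost_iff)
      qed
      then have "rcis (rh (\<zeta> (n-1))) (th (\<zeta> (n-1))) \<in> cball 0 (1 - 1 / 2 ^ n)"
        "rcis (rh (\<zeta> (n-1))) (th (\<zeta> (n-1))) \<in> ball 0 1"
        using rh01[of "\<zeta> (n-1)"] by auto
      then show ?thesis using adm unfolding disc_admissible_def disc_value_def a_def by fastforce
    qed
    show "1 \<le> sum_along \<phi> (pred_boundary \<zeta>)"
    proof (rule dense_le)
      fix y :: ennreal assume "y < 1"
      then obtain c where c: "y = ennreal c" "0 \<le> c" "c < 1"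
        by (cases y) (auto simp: ennreal_less_one_iff)
      \<comment> \<open>The gap \<open>1 - c\<close> is split in two: one \<open>d\<close> for the
        distance of \<open>b N\<close> from the limit, one for the arc between the ray and the good
        point. The threshold \<open>d\<^sup>2 / 26\<close> below turns \<open>ba\<close> into an
        error less than \<open>d\<close>.\<close>
      define d where "d = (1 - c) / 2"
      have d: "0 < d" using c by (simp add: d_def)
      have "\<forall>\<^sub>F k in sequentially. ereal (1 - d) < ereal (b k)"
        using l1 d by (intro order_tendstoD(1)[OF bl]) (auto intro: less_le_trans[of _ 1])
      moreover have "\<forall>\<^sub>F k in sequentially. er k < d\<^sup>2 / 26"
        using d by (intro order_tendstoD(2)[OF er0]) auto
      moreover have "\<forall>\<^sub>F k in sequentially. n \<le> k" by (rule eventually_ge_at_top)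
      ultimately have "\<forall>\<^sub>F k in sequentially. ereal (1 - d) < ereal (b k) \<and> er k < d\<^sup>2 / 26 \<and> n \<le> k"
        by eventually_elim auto
      then obtain N where N: "1 - d < b N" "er N < d\<^sup>2 / 26" "n \<le> N"
        by (auto simp: eventually_sequentially)
      have "(b N - a (\<zeta> N))\<^sup>2 < d\<^sup>2" using ba[of N] N(2) by linarith
      then have "b N - a (\<zeta> N) < d" using d by (simp add: power_less_imp_less_base less_imp_le)
      then have aN: "c < a (\<zeta> N)" using N(1) by (simp add: d_def field_simps)
      have "a (\<zeta> N) \<le> a (\<zeta> N) - a (\<zeta> (n - 1))" using a0 by simp
      also have "\<dots> = (\<Sum>k\<in>{n-1..<N}. a (\<zeta> (Suc k)) - a (\<zeta> k))"
        using N(3) sum_Suc_diff'[of "n-1" N "\<lambda>k. a (\<zeta> k)"] by simp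
      also have "\<dots> \<le> (\<Sum>k\<in>{n-1..<N}. \<phi> (\<zeta> (Suc k)))"
      proof (rule sum_mono)
        fix k assume "k \<in> {n-1..<N}"
        then have "n \<le> Suc k" by auto
        then have "\<phi> (\<zeta> (Suc k)) = \<bar>a (\<zeta> (Suc k)) - a (\<zeta> k)\<bar>"
          unfolding \<phi>_def lev boundary_parent[OF z, of k, symmetric] by simp
        then show "a (\<zeta> (Suc k)) - a (\<zeta> k) \<le> \<phi> (\<zeta> (Suc k))" by linarith
      qed
      also have "\<dots> = (\<Sum>k\<in>Suc ` {n-1..<N}. \<phi> (\<zeta> k))"
        by (subst sum.reindex) auto
      finally have "ennreal c \<le> ennreal (\<Sum>k\<in>Suc ` {n-1..<N}. \<phi> (\<zeta> k))"
        using aN by (intro ennreal_leI) simp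
      also have "\<dots> \<le> sum_along \<phi> (pred_boundary \<zeta>)"
        by (rule sum_le_sum_along[OF z]) (auto simp: \<phi>_def)
      finally show "y \<le> sum_along \<phi> (pred_boundary \<zeta>)" using c by simp
    qed
  qed
  then have "tree_Cap_n n (Lambda_preimage E) \<le> tree_energy \<phi>"
    unfolding tree_Cap_n_def by (intro INF_lower) simp
  then show ?thesis using energy by (rule order_trans)
qed

section \<open>Bumps attached to boundary points\<close>

text \<open>The positive part is squared because competitors must be C1, which the positive part
  itself is not.\<close>

definition ramp2 :: "real \<Rightarrow> real" where
  "ramp2 t = (max 0 t)\<^sup>2"

lemma ramp2_nonneg [simp]: "0 \<le> ramp2 t"
  by (simp add: ramp2_def)

lemma ramp2_eq_0_iff [simp]: "ramp2 t = 0 \<longleftrightarrow> t \<le> 0"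
  by (auto simp: ramp2_def max_def)

lemma ramp2_mono: "s \<le> t \<Longrightarrow> ramp2 s \<le> ramp2 t"
  unfolding ramp2_def by (intro power_mono) auto

lemma ramp2_le: "t \<le> a \<Longrightarrow> 0 \<le> a \<Longrightarrow> ramp2 t \<le> a\<^sup>2"
  unfolding ramp2_def by (intro power_mono) auto

lemma continuous_on_ramp2 [continuous_intros]:
  "continuous_on S f \<Longrightarrow> continuous_on S (\<lambda>x. ramp2 (f x))"
  unfolding ramp2_def by (intro continuous_intros)

lemma DERIV_ramp2: "(ramp2 has_field_derivative 2 * max 0 t) (at t)"
proof -
  consider "t < 0" | "t = 0" | "0 < t" by linarith
  then show ?thesis
  proof cases
    case 1
    have "((\<lambda>x. 0) has_field_derivative 2 * max 0 t) (at t)" using 1 by simp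
    then show ?thesis
      by (rule has_field_derivative_transform_within_open[where S =
        "{..<0}"]) (use 1 in \<open>auto simp: ramp2_def\<close>)
  next
    case 3
    have "((\<lambda>x. x\<^sup>2) has_field_derivative 2 * max 0 t) (at t)"
      using 3 by (auto intro!: derivative_eq_intros)
    then show ?thesis
      by (rule has_field_derivative_transform_within_open[where S =
        "{0<..}"]) (use 3 in \<open>auto simp: ramp2_def\<close>)
  next
    case 2
    \<comment> \<open>Caratheodory's criterion at the corner: the difference quotient is
      \<open>max 0 z\<close>, continuous with value 0.\<close>
    have "ramp2 z - ramp2 0 = max 0 z * (z - 0)" for z
      by (auto simp: ramp2_def max_def power2_eq_square)
    moreover have "isCont (max (0::real)) 0" by (intro continuous_intros)
    ultimately show ?thesis unfolding 2 by (subst CARAT_DERIV) (auto intro!: exI[of _ "max 0"])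
  qed
qed

text \<open>
  \<open>depth\<close> is positive only for \<open>\<bar>z\<bar> > 1 - 2\<^sup>-\<^sup>k\<close>. The threshold 11 in \<open>nearness\<close> exceeds \<open>\<pi>\<^sup>2 + 1\<close>, so
  \<open>nearness \<ge> 1\<close> on the whole arc of length \<open>2\<pi> / 2\<^sup>k\<close> centred at \<open>c\<close>.
\<close>

definition depth :: "nat \<Rightarrow> complex \<Rightarrow> real" where
  "depth k z = 1 - 2 ^ k * (1 - (norm z)\<^sup>2)"

definition nearness :: "nat \<Rightarrow> complex \<Rightarrow> complex \<Rightarrow> real" where
  "nearness k c z = 11 - 4 ^ k * (2 - 2 * ((z \<bullet> c) * inverse (norm z)))"

definition bump :: "nat \<Rightarrow> complex \<Rightarrow> complex \<Rightarrow> real" where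
  "bump k c z = ramp2 (depth k z) * ramp2 (nearness k c z)"

text \<open>Gradient of the cosine of the angle between \<open>z\<close> and a unit vector
  \<open>c\<close>: the component of \<open>c\<close> orthogonal to \<open>z\<close>, divided by
  \<open>norm z\<close>.\<close>

definition grad_cos :: "complex \<Rightarrow> complex \<Rightarrow> complex" where
  "grad_cos c z = inverse (norm z) *\<^sub>R (c - ((z \<bullet> c) * (inverse (norm z))\<^sup>2) *\<^sub>R z)"

definition grad_bump :: "nat \<Rightarrow> complex \<Rightarrow> complex \<Rightarrow> complex" where
  "grad_bump k c z =
     ramp2 (depth k z) *\<^sub>R (2 * max 0 (nearness k c z)) *\<^sub>R (2 * 4 ^ k) *\<^sub>R grad_cos c z +
     ramp2 (nearness k c z) *\<^sub>R (2 * max 0 (depth k z)) *\<^sub>R (2 * 2 ^ k) *\<^sub>R z"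

lemma GDERIV_norm_sq: "GDERIV (\<lambda>z::complex. (norm z)\<^sup>2) z :> 2 *\<^sub>R z"
  unfolding gderiv_def power2_norm_eq_inner
  by (auto intro!: derivative_eq_intros simp: inner_commute)

lemma GDERIV_inner_left: "GDERIV (\<lambda>z::complex. z \<bullet> c) z :> c"
  unfolding gderiv_def by (auto intro!: derivative_eq_intros)

lemma GDERIV_affine:
  assumes "GDERIV f z :> D"
  shows "GDERIV (\<lambda>z. a + b * f z) z :> b *\<^sub>R D"
proof -
  have "((\<lambda>t. a + b * t) has_field_derivative b) (at (f z))"
    by (auto intro!: derivative_eq_intros)
  from GDERIV_DERIV_compose[OF assms this] show ?thesis .
qed

lemma GDERIV_depth: "GDERIV (depth k) z :> (2 * 2 ^ k) *\<^sub>R z"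
proof -
  have "GDERIV (\<lambda>z. (1 - 2 ^ k) + 2 ^ k * (norm z)\<^sup>2) z :> 2 ^ k *\<^sub>R 2 *\<^sub>R z"
    by (rule GDERIV_affine[OF GDERIV_norm_sq])
  moreover have "depth k = (\<lambda>z. (1 - 2 ^ k) + 2 ^ k * (norm z)\<^sup>2)"
    by (auto simp: depth_def algebra_simps)
  ultimately show ?thesis by (simp add: mult.commute)
qed

lemma GDERIV_nearness:
  assumes "z \<noteq> 0"
  shows "GDERIV (nearness k c) z :> (2 * 4 ^ k) *\<^sub>R grad_cos c z"
proof -
  have "GDERIV (\<lambda>z. inverse (norm z)) z :> - (inverse (norm z))\<^sup>2 *\<^sub>R sgn z"
    using GDERIV_inverse[OF GDERIV_norm[OF assms]] assms by simp
  from GDERIV_mult[OF GDERIV_inner_left[of c] this]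
  have "GDERIV (\<lambda>z. (z \<bullet> c) * inverse (norm z)) z :> grad_cos c z"
    by (rule GDERIV_subst) (simp add: grad_cos_def sgn_div_norm algebra_simps power2_eq_square)
  from GDERIV_affine[OF this, of "11 - 2 * 4 ^ k" "2 * 4 ^ k"]
  show ?thesis unfolding nearness_def[abs_def] by (simp add: algebra_simps)
qed

text \<open>From level 1 on a bump vanishes near the origin, so the singularity of
  \<open>nearness\<close> at 0 does no harm.\<close>

lemma depth_nonpos:
  assumes "1 \<le> k" "norm z \<le> 1/2"
  shows "depth k z \<le> 0"
proof -
  have "(norm z)\<^sup>2 \<le> (1/2)\<^sup>2" using assms by (intro power_mono) auto
  then have "1/2 \<le> 1 - (norm z)\<^sup>2" by (simp add: power2_eq_square)
  moreover have "(2::real) ^ 1 \<le> 2 ^ k" using assms by (intro power_increasing) auto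
  ultimately have "2 * (1/2) \<le> 2 ^ k * (1 - (norm z)\<^sup>2)" by (intro mult_mono) auto
  then show ?thesis by (simp add: depth_def)
qed

lemma GDERIV_bump:
  assumes k: "1 \<le> k"
  shows "GDERIV (bump k c) z :> grad_bump k c z"
proof (cases "z = 0")
  case False
  from GDERIV_mult[OF GDERIV_DERIV_compose[OF GDERIV_depth[of k z] DERIV_ramp2]
      GDERIV_DERIV_compose[OF GDERIV_nearness[OF False, of k c] DERIV_ramp2]]
  show ?thesis unfolding bump_def[abs_def] grad_bump_def .
next
  case True
  have "((\<lambda>z. 0) has_derivative (\<lambda>h. h \<bullet> 0)) (at (0::complex))" by simp
  then have "(bump k c has_derivative (\<lambda>h. h \<bullet> 0)) (at 0)"
    by (rule has_derivative_transform_within_open[OF _ open_ball[of 0 "1/2"]])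
       (use depth_nonpos[OF k] in \<open>auto simp: bump_def\<close>)
  moreover have "grad_bump k c 0 = 0"
    using depth_nonpos[OF k, of 0] by (simp add: grad_bump_def)
  ultimately show ?thesis unfolding gderiv_def True by simp
qed

lemma continuous_on_grad_bump:
  assumes k: "1 \<le> k"
  shows "continuous_on UNIV (grad_bump k c)"
proof -
  have "grad_bump k c z = 0" if "z \<in> ball 0 (1/2)" for z
    using depth_nonpos[OF k, of z] that by (simp add: grad_bump_def max_absorb1)
  then have 1: "continuous_on (ball 0 (1/2)) (grad_bump k c)"
    by (subst continuous_on_cong[OF refl, of _ _ "\<lambda>_. 0"]) auto
  have 2: "continuous_on (- {0}) (grad_bump k c)"
    unfolding grad_bump_def grad_cos_def depth_def nearness_def
    by (intro continuous_intros) auto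
  have "continuous_on (ball 0 (1/2) \<union> - {0}) (grad_bump k c)"
    by (rule continuous_on_open_Un[OF _ _ 1 2]) auto
  moreover have "ball 0 (1/2) \<union> - {0} = (UNIV :: complex set)" by auto
  ultimately show ?thesis by simp
qed

definition bump_support :: "nat \<Rightarrow> complex \<Rightarrow> complex set" where
  "bump_support k c = {z \<in> ball 0 1. 0 < depth k z \<and> 0 < nearness k c z}"

text \<open>Pythagoras: the component of \<open>c\<close> orthogonal to \<open>z\<close> has length
  equal to the sine of the angle between them.\<close>

lemma norm_grad_cos:
  assumes "z \<noteq> 0" "norm c = 1"
  shows "(norm (grad_cos c z))\<^sup>2 = (inverse (norm z))\<^sup>2 * (1 - ((z \<bullet> c) * inverse (norm z))\<^sup>2)"
proof -
  let ?i = "inverse (norm z)"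
  have c: "c \<bullet> c = 1" using assms(2) by (simp add: dot_square_norm)
  have z: "(z \<bullet> z) * ?i\<^sup>2 = 1" using assms(1)
    by (simp add: dot_square_norm power_mult_distrib[symmetric] flip: power_mult_distrib)
  have "(norm (grad_cos c z))\<^sup>2 = ?i\<^sup>2 * (norm (c - ((z \<bullet> c) * ?i\<^sup>2) *\<^sub>R z))\<^sup>2"
    by (simp add: grad_cos_def power_mult_distrib)
  also have "(norm (c - ((z \<bullet> c) * ?i\<^sup>2) *\<^sub>R z))\<^sup>2
    = 1 - 2 * (z \<bullet> c)\<^sup>2 * ?i\<^sup>2 + (z \<bullet> c)\<^sup>2 * ?i\<^sup>2 * ((z \<bullet> z) * ?i\<^sup>2)"
    unfolding power2_norm_eq_inner
    by (simp add: inner_diff c inner_commute[of c z] power2_eq_square algebra_simps)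
  also have "\<dots> = 1 - ((z \<bullet> c) * ?i)\<^sup>2" unfolding z by (simp add: power_mult_distrib)
  finally show ?thesis .
qed

text \<open>The derivative of \<open>nearness\<close> carries a factor 4^k, but on the support 4^k *
  (1 - cos) < 11/2 makes the sine of order 2^-k, so only 2^k remains. The angular part contributes 2
  * 11 * 2 * 7 and the radial part 121 * 2 * 2, together 792, rounded up to 800.\<close>

lemma norm_grad_bump_le:
  assumes k: "1 \<le> k" and c: "norm c = 1" and z: "norm z < 1"
  shows "norm (grad_bump k c z) \<le> 800 * 2 ^ k * indicator (bump_support k c) z"
proof (cases "z \<in> bump_support k c")
  case False
  then have "depth k z \<le> 0 \<or> nearness k c z \<le> 0" using z by (auto simp: bump_support_def)
  then show ?thesis using False by (auto simp: grad_bump_def max_def)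
next
  case True
  let ?A = "depth k z" and ?B = "nearness k c z" and ?C = "(z \<bullet> c) * inverse (norm z)"
  have AB: "0 < ?A" "0 < ?B" using True by (auto simp: bump_support_def)
  then have z2: "1/2 < norm z" using depth_nonpos[OF k, of z] by linarith
  then have z0: "z \<noteq> 0" by auto
  have "(norm z)\<^sup>2 \<le> 1" using z by (simp add: power_le_one)
  then have A1: "?A \<le> 1" by (simp add: depth_def)
  have "\<bar>z \<bullet> c\<bar> \<le> norm z" using Cauchy_Schwarz_ineq2[of z c] c by simp
  then have "\<bar>?C\<bar> \<le> 1" using z0 by (simp add: abs_mult field_simps)
  then have C: "?C \<le> 1" "- 1 \<le> ?C" by linarith+
  then have "0 \<le> 4 ^ k * (2 - 2 * ?C)" by simp
  then have B: "?B \<le> 11" unfolding nearness_def by linarith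
  have rA: "ramp2 ?A \<le> 1" "ramp2 ?B \<le> 121" using ramp2_le[OF A1] ramp2_le[OF B] by auto
  have "(2 ^ k * norm (grad_cos c z))\<^sup>2 = 4 ^ k * (norm (grad_cos c z))\<^sup>2"
    by (simp add: power_mult_distrib power2_eq_square flip: power_mult_distrib)
  also have "\<dots> = (inverse (norm z))\<^sup>2 * ((4 ^ k * (1 - ?C)) * (1 + ?C))"
    unfolding norm_grad_cos[OF z0 c] by (simp add: power2_eq_square algebra_simps)
  also have "\<dots> \<le> 2\<^sup>2 * ((11 / 2) * 2)"
  proof (intro mult_mono power_mono)
    show "inverse (norm z) \<le> 2" using le_imp_inverse_le[of "1/2" "norm z"] z2 by simp
    show "4 ^ k * (1 - ?C) \<le> 11 / 2" using AB(2) by (simp add: nearness_def algebra_simps)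
  qed (use C in auto)
  also have "\<dots> \<le> 7\<^sup>2" by simp
  finally have G: "2 ^ k * norm (grad_cos c z) \<le> 7" by (rule power2_le_imp_le) simp
  have "norm (grad_bump k c z) \<le> ramp2 ?A * ((2 * ?B) * ((2 * 4 ^ k) * norm (grad_cos c z))) +
     ramp2 ?B * ((2 * ?A) * ((2 * 2 ^ k) * norm z))"
    unfolding grad_bump_def using AB by (intro norm_triangle_le) (simp add: mult.assoc)
  also have "(2 * 4 ^ k) * norm (grad_cos c z) = 2 * 2 ^ k * (2 ^ k * norm (grad_cos c z))"
    by (simp flip: power_mult_distrib)
  also have "ramp2 ?A * ((2 * ?B) * (2 * 2 ^ k * (2 ^ k * norm (grad_cos c z))))
    \<le> 1 * ((2 * 11) * (2 * 2 ^ k * 7))"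
    using rA B AB G by (intro mult_mono) auto
  also have "ramp2 ?B * ((2 * ?A) * ((2 * 2 ^ k) * norm z)) \<le> 121 * ((2 * 1) * ((2 * 2 ^ k) * 1))"
    using rA A1 AB z by (intro mult_mono) auto
  finally have "norm (grad_bump k c z) \<le> 792 * 2 ^ k" by simp
  also have "\<dots> \<le> 800 * 2 ^ k" by simp
  finally show ?thesis using True by simp
qed

section \<open>Overlap of the bumps\<close>

text \<open>Taylor expansion with cubic remainder: \<open>y\<^sup>2 \<le> 3\<close> for
  \<open>y\<close> up to pi/2, so the remainder y^3 / 6 is at most y / 2.\<close>

lemma sin_ge_half:
  assumes "0 \<le> y" "y \<le> pi / 2"
  shows "y / 2 \<le> sin (y::real)"
proof -
  have "\<bar>sin y - (\<Sum>m<3. sin_coeff m * y ^ m)\<bar> \<le> inverse (fact 3) * \<bar>y\<bar> ^ 3"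
    by (rule Maclaurin_sin_bound)
  also have "(\<Sum>m<3. sin_coeff m * y ^ m) = y"
    by (simp add: eval_nat_numeral sin_coeff_def)
  finally have "\<bar>sin y - y\<bar> \<le> y ^ 3 / 6" using assms by (simp add: eval_nat_numeral)
  then have "y - sin y \<le> y ^ 3 / 6" by linarith
  moreover have "y\<^sup>2 \<le> (8/5)\<^sup>2" using assms pi_approx by (intro power_mono) auto
  then have "y * y\<^sup>2 \<le> y * 3" using assms by (intro mult_left_mono) (auto simp: power2_eq_square)
  then have "y ^ 3 / 6 \<le> y / 2" by (simp add: eval_nat_numeral)
  ultimately show ?thesis by linarith
qed

text \<open>By the half-angle formula the right side, a squared chord length, is 4
  sin^2(x/2).\<close>

lemma two_minus_two_cos_ge:
  assumes "\<bar>x\<bar> \<le> pi"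
  shows "x\<^sup>2 / 4 \<le> 2 - 2 * cos (x::real)"
proof -
  have "\<bar>x\<bar> / 2 / 2 \<le> sin (\<bar>x\<bar> / 2)" using assms by (intro sin_ge_half) auto
  then have "(\<bar>x\<bar> / 4)\<^sup>2 \<le> (sin (\<bar>x\<bar> / 2))\<^sup>2" by (intro power_mono) auto
  moreover have "cos x = 1 - 2 * (sin (\<bar>x\<bar> / 2))\<^sup>2"
    using cos_double_sin[of "\<bar>x\<bar> / 2"] by simp
  ultimately show ?thesis by (simp add: power_divide)
qed

lemma two_minus_two_cos_le: "2 - 2 * cos x \<le> (x::real)\<^sup>2"
proof -
  have "\<bar>sin (x/2)\<bar>\<^sup>2 \<le> \<bar>x/2\<bar>\<^sup>2" by (intro power_mono abs_sin_x_le_abs_x) simp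
  moreover have "cos x = 1 - 2 * (sin (x / 2))\<^sup>2"
    using cos_double_sin[of "x / 2"] by simp
  ultimately show ?thesis by (simp add: power_divide)
qed

text \<open>A difference of two angles from [0, 2 pi) is brought into [-pi, pi] by one of three
  shifts; there the squared chord is at least a quarter of the squared angle, and 4 * 11 <
  7^2.\<close>

lemma cos_near_1_cases:
  fixes x B :: real
  assumes x: "\<bar>x\<bar> < 2 * pi" and B: "0 \<le> B" and c: "2 - 2 * cos x < 11 * B\<^sup>2"
  shows "\<exists>m\<in>{-1, 0, 1::real}. \<bar>x - 2 * pi * m\<bar> \<le> 7 * B"
proof -
  obtain m :: real where m: "m \<in> {-1, 0, 1}" "\<bar>x - 2 * pi * m\<bar> \<le> pi"
  proof -
    consider "x < - pi" | "\<bar>x\<bar> \<le> pi" | "pi < x" by linarith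
    then show thesis by cases (use that[of "-1"] that[of 0] that[of 1] x in auto)
  qed
  have "cos (x - 2 * pi * m) = cos x"
    using m(1) by (auto simp: cos_diff cos_add)
  then have "(x - 2 * pi * m)\<^sup>2 / 4 < 11 * B\<^sup>2"
    using two_minus_two_cos_ge[OF m(2)] c by linarith
  moreover have "(7 * B)\<^sup>2 = 49 * B\<^sup>2" "0 \<le> B\<^sup>2" by (simp_all add: power_mult_distrib)
  ultimately have "\<bar>x - 2 * pi * m\<bar>\<^sup>2 \<le> (7 * B)\<^sup>2"
    unfolding power2_abs by linarith
  then have "\<bar>x - 2 * pi * m\<bar> \<le> 7 * B" by (rule power2_le_imp_le) (use B in simp)
  then show ?thesis using m(1) by blast
qed

definition arc_center :: "vertex \<Rightarrow> real" where
  "arc_center x = 2 * pi * (real (snd x) - 1/2) / 2 ^ level x"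

text \<open>The condition \<open>nearness > 0\<close> of the bump, read off in polar
  coordinates.\<close>

definition near_angles :: "vertex \<Rightarrow> real set" where
  "near_angles x = {\<theta>. 0 \<le> \<theta> \<and> \<theta> < 2 * pi \<and> 4 ^ level x * (2 - 2 * cos (\<theta> - arc_center x)) < 11}"

lemma arc_center_bounds:
  assumes "x \<in> tree_verts"
  shows "0 \<le> arc_center x" "arc_center x < 2 * pi"
proof -
  have *: "1 \<le> real (snd x)" "real (snd x) \<le> 2 ^ level x"
    using assms by (auto simp: tree_verts_def of_nat_le_numeral_power_cancel_iff)
  show "0 \<le> arc_center x" using * by (simp add: arc_center_def)
  have "real (snd x) - 1/2 < 2 ^ level x" using * by linarith
  then have "(real (snd x) - 1/2) / 2 ^ level x < 1" by simp
  then have "2 * pi * ((real (snd x) - 1/2) / 2 ^ level x) < 2 * pi * 1"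
    by (intro mult_strict_left_mono) auto
  then show "arc_center x < 2 * pi" by (simp add: arc_center_def)
qed

lemma near_angles_cases:
  assumes x: "x \<in> tree_verts" and t: "\<theta> \<in> near_angles x"
  shows "\<exists>m\<in>{-1, 0, 1::real}. \<bar>\<theta> - arc_center x - 2 * pi * m\<bar> \<le> 7 / 2 ^ level x"
proof -
  have "(2::real) ^ level x * 2 ^ level x = 4 ^ level x" by (simp flip: power_mult_distrib)
  then have "2 - 2 * cos (\<theta> - arc_center x) < 11 * (1 / 2 ^ level x)\<^sup>2"
    using t by (simp add: near_angles_def power_divide power2_eq_square field_simps)
  moreover have "\<bar>\<theta> - arc_center x\<bar> < 2 * pi"
    using t arc_center_bounds[OF x] by (auto simp: near_angles_def)
  ultimately show ?thesis using cos_near_1_cases[of "\<theta> - arc_center x" "1 / 2 ^ level x"] by simp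
qed

lemma near_angles_borel [measurable]: "near_angles x \<in> sets borel"
  unfolding near_angles_def by measurable

lemma emeasure_near_angles_le:
  assumes x: "x \<in> tree_verts"
  shows "emeasure lborel (near_angles x) \<le> ennreal (42 / 2 ^ level x)"
proof -
  let ?I = "\<lambda>m. {arc_center x + 2 * pi * m - 7 / 2 ^ level x .. arc_center x + 2 * pi * m
    + 7 / 2 ^ level x}"
  have "near_angles x \<subseteq> (\<Union>m\<in>{-1, 0, 1}. ?I m)"
  proof
    fix \<theta> assume "\<theta> \<in> near_angles x"
    then obtain m where m: "m \<in> {-1, 0, 1::real}"
      "\<bar>\<theta> - arc_center x - 2 * pi * m\<bar> \<le> 7 / 2 ^ level x"
      using near_angles_cases[OF x] by blast
    then have "\<theta> \<in> ?I m" unfolding abs_le_iff by auto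
    then show "\<theta> \<in> (\<Union>m\<in>{-1, 0, 1}. ?I m)" using m(1) by blast
  qed
  then have "emeasure lborel (near_angles x) \<le> emeasure lborel (\<Union>m\<in>{-1, 0, 1}. ?I m)"
    by (intro emeasure_mono) auto
  also have "\<dots> \<le> (\<Sum>m\<in>{-1, 0, 1}. emeasure lborel (?I m))"
    by (intro emeasure_subadditive_finite) auto
  also have "\<dots> = (\<Sum>m\<in>{-1, 0, 1::real}. ennreal (14 / 2 ^ level x))"
  proof (rule sum.cong[OF refl])
    fix m :: real
    have "arc_center x + 2 * pi * m - 7 / 2 ^ level x \<le> arc_center x + 2 * pi * m + 7 / 2 ^ level x"
      by (simp add: add_increasing2)
    then show "emeasure lborel (?I m) = ennreal (14 / 2 ^ level x)" by simp
  qed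
  also have "\<dots> = ennreal (\<Sum>m\<in>{-1, 0, 1::real}. 14 / 2 ^ level x)"
    by (rule sum_ennreal) simp
  also have "\<dots> = ennreal (42 / 2 ^ level x)" by simp
  finally show ?thesis .
qed

text \<open>9 = 3 * 3. For each shift the centres, spaced by 2 pi / 2^k, lie in a window of length
  14 / 2^k, and 14 < 3 * 2 pi.\<close>

lemma card_near_angles_le: "finite {j. (k, j) \<in> tree_verts \<and> \<theta> \<in> near_angles (k, j)}
  \<and> card {j. (k, j) \<in> tree_verts \<and> \<theta> \<in> near_angles (k, j)} \<le> 9"
proof -
  let ?J = "\<lambda>m::real. {j. \<bar>\<theta> - arc_center (k, j) - 2 * pi * m\<bar> \<le> 7 / 2 ^ k}"
  have J: "finite (?J m) \<and> card (?J m) \<le> Suc 2" for m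
  proof (rule card_spread_le)
    fix a b assume "a \<in> ?J m" "b \<in> ?J m"
    then have "arc_center (k, b) - arc_center (k, a) \<le> 7 / 2 ^ k + 7 / 2 ^ k"
      unfolding mem_Collect_eq abs_le_iff by linarith
    moreover have "arc_center (k, b) - arc_center (k, a) = 2 * pi * (real b - real a) / 2 ^ k"
      by (simp add: arc_center_def field_simps)
    ultimately have "2 * pi * (real b - real a) \<le> 14"
      by (simp add: divide_le_eq)
    then have "\<not> 3 \<le> real b - real a"
      using mult_left_mono[of 3 "real b - real a" "2 * pi"] pi_gt3 by linarith
    then show "b \<le> a + 2" by linarith
  qed
  have sub: "{j. (k, j) \<in> tree_verts \<and> \<theta> \<in> near_angles (k, j)} \<subseteq> (\<Union>m\<in>{-1, 0, 1}. ?J m)"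
    using near_angles_cases by fastforce
  have "card (\<Union>m\<in>{-1, 0, 1}. ?J m) \<le> (\<Sum>m\<in>{-1, 0, 1::real}. card (?J m))"
    by (rule card_UN_le) simp
  also have "\<dots> \<le> (\<Sum>m\<in>{-1, 0, 1::real}. 3)" using J by (intro sum_mono) simp
  finally have "card (\<Union>m\<in>{-1, 0, 1}. ?J m) \<le> 9" by simp
  moreover have "finite (\<Union>m\<in>{-1, 0, 1}. ?J m)" using J by blast
  ultimately show ?thesis using sub by (meson card_mono finite_subset order_trans)
qed

text \<open>\<open>- sqrt (1 - r\<^sup>2)\<close> is an antiderivative, continuous up to 1. The
  integrand is unbounded there, so it is differentiated in the interior only; at 1 itself division
  by zero gives the harmless value 0.\<close>

lemma nn_integral_radial_weight:
  assumes a: "0 \<le> a" "a < 1"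
  shows "(\<integral>\<^sup>+r\<in>{a..1}. ennreal (r / sqrt (1 - r\<^sup>2)) \<partial>lborel) = ennreal (sqrt (1 - a\<^sup>2))"
proof -
  have le: "r\<^sup>2 \<le> 1" if "0 \<le> r" "r \<le> 1" for r :: real
    using that by (simp add: power_le_one)
  have "((\<lambda>r. r / sqrt (1 - r\<^sup>2)) has_integral (- sqrt (1 - 1\<^sup>2) - - sqrt (1 - a\<^sup>2))) {a..1}"
  proof (rule fundamental_theorem_of_calculus_interior)
    show "continuous_on {a..1} (\<lambda>r. - sqrt (1 - r\<^sup>2))" by (intro continuous_intros)
    fix r assume r: "r \<in> {a<..<1}"
    then have "r\<^sup>2 < 1" using a by (simp add: power2_less_imp_less abs_square_less_1)
    then have "((\<lambda>r. - sqrt (1 - r\<^sup>2)) has_real_derivative (r / sqrt (1 - r\<^sup>2))) (at r)"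
      by (auto intro!: derivative_eq_intros simp: field_simps)
    then show "((\<lambda>r. - sqrt (1 - r\<^sup>2)) has_vector_derivative (r / sqrt (1 - r\<^sup>2))) (at r)"
      by (rule has_real_derivative_iff_has_vector_derivative[THEN iffD1])
  qed (use a in simp)
  then have "((\<lambda>r. r / sqrt (1 - r\<^sup>2)) has_integral sqrt (1 - a\<^sup>2)) {a..1}" by simp
  then show ?thesis
    by (rule nn_integral_has_integral_lebesgue'[rotated]) (use a le in auto)
qed

text \<open>A geometric sum is dominated by its last term; the induction closes because 4 \<le> 3 *
  sqrt 2.\<close>

lemma sum_sqrt2_powers_le: "(\<Sum>k\<le>m. sqrt 2 ^ k) \<le> 4 * sqrt 2 ^ m"
proof (induction m)
  case (Suc m)
  have "4/3 \<le> sqrt (2::real)" by (rule real_le_rsqrt) (simp add: power2_eq_square)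
  then have "4 * sqrt 2 ^ m \<le> 3 * sqrt 2 * sqrt (2::real) ^ m"
    by (intro mult_right_mono) auto
  then show ?case using Suc.IH unfolding sum.atMost_Suc power_Suc by linarith
qed simp

section \<open>The potential of a weight on the tree\<close>

definition vertex_bump :: "vertex \<Rightarrow> complex \<Rightarrow> real" where
  "vertex_bump x = bump (level x) (cis (arc_center x))"

definition grad_vertex_bump :: "vertex \<Rightarrow> complex \<Rightarrow> complex" where
  "grad_vertex_bump x = grad_bump (level x) (cis (arc_center x))"

definition vertex_support :: "vertex \<Rightarrow> complex set" where
  "vertex_support x = bump_support (level x) (cis (arc_center x))"

definition level_verts :: "nat \<Rightarrow> nat \<Rightarrow> vertex set" where
  "level_verts n N = {x \<in> tree_verts. n \<le> level x \<and> level x < N}"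

text \<open>The condition on \<open>depth\<close> discards only vanishing terms, but it makes the
  index set finite at every interior point; over an infinite set \<open>sum\<close> would return
  0.\<close>

definition potential :: "(vertex \<Rightarrow> real) \<Rightarrow> nat \<Rightarrow> complex \<Rightarrow> real" where
  "potential \<phi> n z = (\<Sum>x | x \<in> tree_verts \<and> n \<le> level x \<and> 0 < depth (level x) z. \<phi> x
    * vertex_bump x z)"

lemma finite_level_verts [simp]: "finite (level_verts n N)"
proof (rule finite_subset)
  show "level_verts n N \<subseteq> Sigma {..<N} (\<lambda>k. {1..2 ^ k})"
    by (auto simp: level_verts_def tree_verts_def)
qed auto

lemma level_verts_in_tree: "x \<in> level_verts n N \<Longrightarrow> x \<in> tree_verts"
  by (simp add: level_verts_def)

lemma depth_antimono:
  assumes "norm z \<le> 1" "k \<le> m"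
  shows "depth m z \<le> depth k z"
proof -
  have "(norm z)\<^sup>2 \<le> 1" using assms by (simp add: power_le_one)
  moreover have "(2::real) ^ k \<le> 2 ^ m" using assms by (intro power_increasing) auto
  ultimately have "2 ^ k * (1 - (norm z)\<^sup>2) \<le> 2 ^ m * (1 - (norm z)\<^sup>2)"
    by (intro mult_right_mono) auto
  then show ?thesis by (simp add: depth_def)
qed

lemma ex_depth_neg:
  assumes "norm z < 1"
  shows "\<exists>N. depth N z < 0"
proof -
  have "(norm z)\<^sup>2 < 1" using assms by (simp add: abs_square_less_1)
  then have p: "0 < 1 - (norm z)\<^sup>2" by simp
  obtain N where "1 / (1 - (norm z)\<^sup>2) < 2 ^ N"
    using real_arch_pow[of 2 "1 / (1 - (norm z)\<^sup>2)"] by auto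
  then have "1 < 2 ^ N * (1 - (norm z)\<^sup>2)" using p by (simp add: field_simps)
  then show ?thesis unfolding depth_def by (intro exI[of _ N]) linarith
qed

lemma vertex_bump_nonneg [simp]: "0 \<le> vertex_bump x z"
  by (simp add: vertex_bump_def bump_def)

lemma vertex_bump_eq_0: "depth (level x) z \<le> 0 \<Longrightarrow> vertex_bump x z = 0"
  by (simp add: vertex_bump_def bump_def)

lemma potential_eq:
  assumes "norm z < 1" "depth N z \<le> 0"
  shows "potential \<phi> n z = (\<Sum>x\<in>level_verts n N. \<phi> x * vertex_bump x z)"
  unfolding potential_def
proof (rule sum.mono_neutral_left)
  show "{x \<in> tree_verts. n \<le> level x \<and> 0 < depth (level x) z} \<subseteq> level_verts n N"
    using depth_antimono[of z N] assms unfolding level_verts_def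
      by (force simp: not_less[symmetric])
qed (use finite_level_verts[of n N] in \<open>auto simp: level_verts_def vertex_bump_eq_0 not_less\<close>)

lemma GDERIV_sum:
  assumes "finite X" "\<And>x. x \<in> X \<Longrightarrow> GDERIV (f x) z :> D x"
  shows "GDERIV (\<lambda>z. \<Sum>x\<in>X. f x z) z :> (\<Sum>x\<in>X. D x)"
  using assms by (induction X rule: finite_induct) (auto intro: GDERIV_add GDERIV_const)

lemma open_depth_neg: "open {z \<in> ball 0 1. depth N z < 0}"
proof -
  have "open {z. depth N z < 0}"
    unfolding depth_def by (intro open_Collect_less continuous_intros)
  then have "open (ball 0 1 \<inter> {z. depth N z < 0})" by (rule open_Int[OF open_ball])
  then show ?thesis by (simp add: Int_def)
qed

text \<open>The strict inequality on \<open>depth N\<close> persists near \<open>z\<close>, so the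
  potential agrees there with a fixed finite sum.\<close>

lemma GDERIV_potential:
  assumes n: "1 \<le> n" and z: "z \<in> ball 0 1" "depth N z < 0"
  shows "GDERIV (potential \<phi> n) z :> (\<Sum>x\<in>level_verts n N. \<phi> x *\<^sub>R grad_vertex_bump x z)"
proof -
  have "GDERIV (\<lambda>z. \<Sum>x\<in>level_verts n N. \<phi> x * vertex_bump x z) z :> (\<Sum>x\<in>level_verts n N. \<phi> x
    *\<^sub>R grad_vertex_bump x z)"
  proof (rule GDERIV_sum)
    fix x assume "x \<in> level_verts n N"
    then have "1 \<le> level x" using n by (simp add: level_verts_def)
    from GDERIV_affine[OF GDERIV_bump[OF this], of 0 "\<phi> x"]
    show "GDERIV (\<lambda>z. \<phi> x * vertex_bump x z) z :> \<phi> x *\<^sub>R grad_vertex_bump x z"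
      by (simp add: vertex_bump_def grad_vertex_bump_def)
  qed simp
  then show ?thesis
    unfolding gderiv_def
    by (rule has_derivative_transform_within_open[OF _ open_depth_neg[of N]])
       (use z potential_eq[of _ N \<phi> n] in auto)
qed

lemma C1_disc_potential:
  assumes n: "1 \<le> n"
  shows "C1_disc (potential \<phi> n)"
  unfolding C1_disc_def
proof
  show "potential \<phi> n differentiable_on ball 0 1"
  proof (rule differentiable_at_imp_differentiable_on)
    fix z :: complex assume z: "z \<in> ball 0 1"
    then obtain N where "depth N z < 0" using ex_depth_neg by auto
    from GDERIV_potential[OF n z this] show "potential \<phi> n differentiable (at z)"
      unfolding gderiv_def by (rule differentiableI)
  qed
  show "continuous_on (ball 0 1) (grad (potential \<phi> n))"
    unfolding continuous_on_eq_continuous_at[OF open_ball]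
  proof
    fix z :: complex assume z: "z \<in> ball 0 1"
    then obtain N where N: "depth N z < 0" using ex_depth_neg by auto
    let ?S = "{z \<in> ball 0 1. depth N z < 0}"
    have "continuous_on ?S (\<lambda>z. \<Sum>x\<in>level_verts n N. \<phi> x *\<^sub>R grad_vertex_bump x z)"
    proof (intro continuous_intros)
      fix x assume "x \<in> level_verts n N"
      then have "1 \<le> level x" using n by (simp add: level_verts_def)
      from continuous_on_grad_bump[OF this, of "cis (arc_center x)"]
      show "continuous_on ?S (grad_vertex_bump x)"
        unfolding grad_vertex_bump_def by (rule continuous_on_subset) simp
    qed
    then have "continuous_on ?S (grad (potential \<phi> n))"
      by (rule continuous_on_eq) (auto intro!: grad_eqI[symmetric] GDERIV_potential[OF n])
    then show "isCont (grad (potential \<phi> n)) z"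
      using continuous_on_eq_continuous_at[OF open_depth_neg[of N]] z N by blast
  qed
qed

section \<open>Energy of the potential\<close>

lemma vertex_support_polar:
  assumes z: "rcis r \<theta> \<in> vertex_support x" and r: "0 < r" and t: "0 \<le> \<theta>" "\<theta> < 2 * pi"
  shows "\<theta> \<in> near_angles x" "r < 1" "2 ^ level x * (1 - r\<^sup>2) < 1"
proof -
  let ?c = "cis (arc_center x)"
  have *: "norm (rcis r \<theta>) < 1" "0 < depth (level x) (rcis r \<theta>)" "0
    < nearness (level x) ?c (rcis r \<theta>)"
    using z by (auto simp: vertex_support_def bump_support_def)
  then show "r < 1" "2 ^ level x * (1 - r\<^sup>2) < 1" using r by (auto simp: depth_def)
  have "(rcis r \<theta> \<bullet> ?c) * inverse (norm (rcis r \<theta>)) = cos (\<theta> - arc_center x)"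
    using r by (simp add: inner_complex_def cos_diff field_simps)
  then show "\<theta> \<in> near_angles x"
    using *(3) t by (simp add: near_angles_def nearness_def)
qed

lemma complex_polarE:
  fixes z :: complex
  assumes "z \<noteq> 0"
  obtains r \<theta> where "z = rcis r \<theta>" "r = norm z" "0 < r" "0 \<le> \<theta>" "\<theta> < 2 * pi"
proof -
  have "z = rcis (norm z) (Arg2pi z)"
    using Arg2pi_eq[of z] by (simp add: rcis_def cis_conv_exp mult.commute)
  then show thesis using that assms Arg2pi_ge_0 Arg2pi_lt_2pi by simp
qed

text \<open>At most nine bumps per level are active at \<open>z\<close>, and the deepest active
  level \<open>m\<close> satisfies \<open>2 ^ m * (1 - (norm z)\<^sup>2) < 1\<close>. The geometric
  sum up to \<open>m\<close> gives 36 = 9 * 4.\<close>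

lemma sum_sqrt2_support_le:
  assumes n: "1 \<le> n" and z: "norm z < 1"
  shows "(\<Sum>x | x \<in> level_verts n N \<and> z \<in> vertex_support x. sqrt 2 ^ level x)
    \<le> 36 / sqrt (1 - (norm z)\<^sup>2)"
proof -
  let ?X = "{x. x \<in> level_verts n N \<and> z \<in> vertex_support x}"
  have p: "0 < 1 - (norm z)\<^sup>2" using z by (simp add: abs_square_less_1)
  have fin: "finite ?X" by (rule finite_subset[OF _ finite_level_verts[of n N]]) auto
  show ?thesis
  proof (cases "?X = {}")
    case True
    show ?thesis unfolding True using p by simp
  next
    case False
    define m where "m = Max (level ` ?X)"
    have m: "level x \<le> m" if "x \<in> ?X" for x using fin that by (simp add: m_def)
    have "m \<in> level ` ?X" unfolding m_def using fin False by (intro Max_in) auto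
    then obtain y where y: "y \<in> level_verts n N" "z \<in> vertex_support y" "m = level y" by blast
    have z0: "z \<noteq> 0"
      using y depth_nonpos[of "level y" z] n
        by (auto simp: vertex_support_def bump_support_def level_verts_def)
    obtain r \<theta> where rt: "z = rcis r \<theta>" "r = norm z" "0 < r" "0 \<le> \<theta>" "\<theta> < 2 * pi"
      using complex_polarE[OF z0] by blast
    let ?J = "\<lambda>k. {j. (k, j) \<in> tree_verts \<and> \<theta> \<in> near_angles (k, j)}"
    have sub: "?X \<subseteq> Sigma {..m} ?J"
    proof
      fix x assume x: "x \<in> ?X"
      then have "rcis r \<theta> \<in> vertex_support x" unfolding rt(1)[symmetric] by simp
      then have "\<theta> \<in> near_angles x" by (rule vertex_support_polar(1)[OF _ rt(3-5)])
      then show "x \<in> Sigma {..m} ?J" using m[OF x] x by (cases x) (auto simp: level_verts_def)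
    qed
    have J: "finite (?J k)" "card (?J k) \<le> 9" for k using card_near_angles_le by blast+
    have "(\<Sum>x\<in>?X. sqrt 2 ^ level x) \<le> (\<Sum>x\<in>Sigma {..m} ?J. sqrt 2 ^ level x)"
      using sub J by (intro sum_mono2) auto
    also have "\<dots> = (\<Sum>k\<le>m. \<Sum>j\<in>?J k. sqrt 2 ^ k)"
      using J by (subst sum.Sigma) (auto simp: case_prod_beta)
    also have "\<dots> = (\<Sum>k\<le>m. real (card (?J k)) * sqrt 2 ^ k)" by simp
    also have "\<dots> \<le> (\<Sum>k\<le>m. 9 * sqrt 2 ^ k)"
    proof (intro sum_mono mult_right_mono)
      fix k show "real (card (?J k)) \<le> 9" using J(2)[of k] by linarith
    qed simp
    also have "\<dots> = 9 * (\<Sum>k\<le>m. sqrt 2 ^ k)" by (simp add: sum_distrib_left)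
    also have "\<dots> \<le> 9 * (4 * sqrt 2 ^ m)" by (intro mult_left_mono sum_sqrt2_powers_le) simp
    also have "sqrt 2 ^ m \<le> 1 / sqrt (1 - (norm z)\<^sup>2)"
    proof -
      have "2 ^ m * (1 - (norm z)\<^sup>2) < 1"
        using y by (simp add: vertex_support_def bump_support_def depth_def)
      then have "sqrt (2 ^ m * (1 - (norm z)\<^sup>2)) \<le> sqrt 1" by (intro real_sqrt_le_mono) simp
      then have "sqrt 2 ^ m * sqrt (1 - (norm z)\<^sup>2) \<le> 1"
        by (simp add: real_sqrt_mult real_sqrt_power)
      then show ?thesis using p by (simp add: field_simps)
    qed
    finally show ?thesis by simp
  qed
qed

text \<open>Weighted Cauchy-Schwarz over the bumps active at \<open>z\<close>; 23040000 = 800^2 *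
  36.\<close>

lemma sq_norm_grad_potential_le:
  assumes n: "1 \<le> n" and z: "norm z < 1" "depth N z < 0" and \<phi>: "\<And>x. x \<in> tree_verts \<Longrightarrow> 0 \<le> \<phi> x"
  shows "(norm (grad (potential \<phi> n) z))\<^sup>2 \<le> (\<Sum>x\<in>level_verts n N.
    23040000 * ((\<phi> x)\<^sup>2 * 2 ^ level x * sqrt 2 ^ level x) * (1 / sqrt (1 - (norm z)\<^sup>2)
      * indicator (vertex_support x) z))"
proof -
  let ?L = "level_verts n N"
  let ?X = "{x. x \<in> ?L \<and> z \<in> vertex_support x}"
  let ?w = "1 / sqrt (1 - (norm z)\<^sup>2)"
  \<comment> \<open>\<open>p\<close> is the fourth root of 2. The factor 2^k is split as p^k *
    p^(3k): the squares of the first factors form the geometric sum just estimated, and the second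
    factors stay with \<open>\<phi>\<close>.\<close>
  define p where "p = sqrt (sqrt 2)"
  have p2: "p\<^sup>2 = sqrt 2" by (simp add: p_def)
  have p4: "p ^ 4 = 2"
  proof -
    have "p ^ 4 = (p\<^sup>2)\<^sup>2" by (simp flip: power_mult)
    then show ?thesis by (simp add: p2)
  qed
  have "norm (grad (potential \<phi> n) z) = norm (\<Sum>x\<in>?L. \<phi> x *\<^sub>R grad_vertex_bump x z)"
    using grad_eqI[OF GDERIV_potential[OF n _ z(2)]] z(1) by simp
  also have "\<dots> \<le> (\<Sum>x\<in>?L. \<phi> x * (800 * 2 ^ level x * indicator (vertex_support x) z))"
  proof (rule sum_norm_le)
    fix x assume x: "x \<in> ?L"
    then have l: "1 \<le> level x" "0 \<le> \<phi> x" using n \<phi> by (auto simp: level_verts_def)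
    have "norm (grad_vertex_bump x z) \<le> 800 * 2 ^ level x * indicator (vertex_support x) z"
      unfolding grad_vertex_bump_def vertex_support_def
        by (rule norm_grad_bump_le[OF l(1) _ z(1)]) simp
    then show "norm (\<phi> x *\<^sub>R grad_vertex_bump x z)
      \<le> \<phi> x * (800 * 2 ^ level x * indicator (vertex_support x) z)"
      using l by (simp add: mult_left_mono)
  qed
  also have "\<dots> = (\<Sum>x\<in>?X. 800 * (p ^ level x * (\<phi> x * p ^ (3 * level x))))"
  proof (rule sum.mono_neutral_cong_right)
    fix x
    have "p ^ level x * p ^ (3 * level x) = 2 ^ level x"
    proof -
      have "p ^ level x * p ^ (3 * level x) = (p ^ 4) ^ level x"
        by (simp flip: power_add power_mult)
      then show ?thesis by (simp add: p4)
    qed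
    then show "x \<in> ?X \<Longrightarrow> \<phi> x * (800 * 2 ^ level x * indicator (vertex_support x) z)
      = 800 * (p ^ level x * (\<phi> x * p ^ (3 * level x)))"
      by (simp add: mult.left_commute)
  qed auto
  also have "\<dots> = 800 * (\<Sum>x\<in>?X. p ^ level x * (\<phi> x * p ^ (3 * level x)))"
    by (simp add: sum_distrib_left)
  finally have "(norm (grad (potential \<phi> n) z))\<^sup>2
    \<le> (800 * (\<Sum>x\<in>?X. p ^ level x * (\<phi> x * p ^ (3 * level x))))\<^sup>2"
    by (intro power_mono) auto
  also have "\<dots> = 640000 * (\<Sum>x\<in>?X. p ^ level x * (\<phi> x * p ^ (3 * level x)))\<^sup>2"
    by (simp add: power_mult_distrib)
  also have "\<dots> \<le> 640000 * ((\<Sum>x\<in>?X. (p ^ level x)\<^sup>2) * (\<Sum>x\<in>?X. (\<phi> x * p ^ (3 * level x))\<^sup>2))"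
    by (intro mult_left_mono Cauchy_Schwarz_ineq_sum) simp
  also have "(\<Sum>x\<in>?X. (p ^ level x)\<^sup>2) = (\<Sum>x\<in>?X. sqrt 2 ^ level x)"
    unfolding p2[symmetric] by (intro sum.cong refl) (simp only: power_mult[symmetric] mult.commute)
  also have "(\<Sum>x\<in>?X. (\<phi> x * p ^ (3 * level x))\<^sup>2)
    = (\<Sum>x\<in>?X. (\<phi> x)\<^sup>2 * 2 ^ level x * sqrt 2 ^ level x)"
  proof (intro sum.cong refl)
    fix x
    have "(p ^ (3 * level x))\<^sup>2 = (p ^ 4) ^ level x * (p\<^sup>2) ^ level x"
      by (simp flip: power_add power_mult)
    then show "(\<phi> x * p ^ (3 * level x))\<^sup>2 = (\<phi> x)\<^sup>2 * 2 ^ level x * sqrt 2 ^ level x"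
      by (simp add: power_mult_distrib p4 p2)
  qed
  also have "640000 * ((\<Sum>x\<in>?X. sqrt 2 ^ level x) * (\<Sum>x\<in>?X. (\<phi> x)\<^sup>2 * 2 ^ level x
    * sqrt 2 ^ level x))
    \<le> 640000 * ((36 * ?w) * (\<Sum>x\<in>?X. (\<phi> x)\<^sup>2 * 2 ^ level x * sqrt 2 ^ level x))"
    using sum_sqrt2_support_le[OF n z(1), of N]
    by (intro mult_left_mono mult_right_mono sum_nonneg) auto
  also have "\<dots> = (\<Sum>x\<in>?X. 23040000 * ((\<phi> x)\<^sup>2 * 2 ^ level x * sqrt 2 ^ level x) * (?w
    * indicator (vertex_support x) z))"
    unfolding sum_distrib_left by (intro sum.cong) auto
  also have "\<dots> = (\<Sum>x\<in>?L. 23040000 * ((\<phi> x)\<^sup>2 * 2 ^ level x * sqrt 2 ^ level x) * (?w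
    * indicator (vertex_support x) z))"
    by (rule sum.mono_neutral_left) auto
  finally show ?thesis .
qed

lemma vertex_support_borel [measurable]: "vertex_support x \<in> sets borel"
proof -
  have "bump_support k c \<in> sets borel" for k c
    unfolding bump_support_def depth_def nearness_def by measurable
  then show ?thesis by (simp add: vertex_support_def)
qed

text \<open>In polar coordinates the support lies over \<open>near_angles x\<close>, of measure at
  most 42 / 2^k, and over \<open>{a..1}\<close> with \<open>1 - a\<^sup>2 = 1 / 2 ^ k\<close>, where
  the weight integrates to 2^(-k/2).\<close>

lemma nn_integral_vertex_support_le:
  assumes x: "x \<in> tree_verts"
  shows "(\<integral>\<^sup>+z. ennreal (1 / sqrt (1 - (norm z)\<^sup>2) * indicator (vertex_support x) z) \<partial>lborel)
    \<le> ennreal (42 / (2 ^ level x * sqrt 2 ^ level x))"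
proof -
  let ?k = "level x"
  define a where "a = sqrt (1 - 1 / 2 ^ ?k)"
  have k1: "(1::real) \<le> 2 ^ ?k" by simp
  then have a: "0 \<le> a" "a < 1" "1 - a\<^sup>2 = 1 / 2 ^ ?k" by (auto simp: a_def)
  have "(\<integral>\<^sup>+z. ennreal (1 / sqrt (1 - (norm z)\<^sup>2) * indicator (vertex_support x) z) \<partial>lborel)
    = (\<integral>\<^sup>+\<theta>. \<integral>\<^sup>+r. ennreal (1 / sqrt (1 - (norm (rcis r \<theta>))\<^sup>2)
      * indicator (vertex_support x) (rcis r \<theta>)) * ennreal r * indicator {0<..} r
      * indicator {0..<2*pi} \<theta> \<partial>lborel \<partial>lborel)"
    by (rule nn_integral_polar) measurable
  also have "\<dots> \<le> (\<integral>\<^sup>+\<theta>. \<integral>\<^sup>+r. (ennreal (r / sqrt (1 - r\<^sup>2)) * indicator {a..1} r)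
    * indicator (near_angles x) \<theta> \<partial>lborel \<partial>lborel)"
  proof (intro nn_integral_mono)
    fix \<theta> r :: real
    show "ennreal (1 / sqrt (1 - (norm (rcis r \<theta>))\<^sup>2) * indicator (vertex_support x) (rcis r \<theta>))
      * ennreal r * indicator {0<..} r * indicator {0..<2*pi} \<theta>
      \<le> (ennreal (r / sqrt (1 - r\<^sup>2)) * indicator {a..1} r) * indicator (near_angles x) \<theta>"
    proof (cases "rcis r \<theta> \<in> vertex_support x \<and> 0 < r \<and> 0 \<le> \<theta> \<and> \<theta> < 2 * pi")
      case True
      then have *: "\<theta> \<in> near_angles x" "r < 1" "2 ^ ?k * (1 - r\<^sup>2) < 1"
        using vertex_support_polar[of r \<theta> x] by auto
      then have "1 - r\<^sup>2 < 1 / 2 ^ ?k" by (simp add: field_simps)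
      then have "a\<^sup>2 \<le> r\<^sup>2" using a(3) by linarith
      then have "a \<le> r" by (rule power2_le_imp_le) (use True in simp)
      then show ?thesis using True * by (simp add: ennreal_mult''[symmetric])
    qed (auto simp: indicator_def)
  qed
  also have "\<dots> = (\<integral>\<^sup>+\<theta>. ennreal (sqrt (1 - a\<^sup>2)) * indicator (near_angles x) \<theta> \<partial>lborel)"
    by (subst nn_integral_multc) (simp_all add: nn_integral_radial_weight[OF a(1,2)])
  also have "\<dots> = ennreal (sqrt (1 - a\<^sup>2)) * emeasure lborel (near_angles x)"
    by (simp add: nn_integral_cmult_indicator)
  also have "\<dots> \<le> ennreal (sqrt (1 - a\<^sup>2)) * ennreal (42 / 2 ^ ?k)"
    by (intro mult_left_mono emeasure_near_angles_le[OF x]) simp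
  also have "\<dots> = ennreal (42 / (2 ^ ?k * sqrt 2 ^ ?k))"
    unfolding a(3) by (simp add: ennreal_mult''[symmetric] real_sqrt_divide real_sqrt_power mult.commute)
  finally show ?thesis .
qed

text \<open>The truncation level in the pointwise bound grows as \<open>z\<close> approaches the
  circle, so the bounds are combined by monotone convergence. For each vertex the powers of 2
  cancel, leaving 23040000 * 42.\<close>

lemma dirichlet_energy_potential_le:
  assumes n: "1 \<le> n" and \<phi>: "\<And>x. x \<in> tree_verts \<Longrightarrow> 0 \<le> \<phi> x"
  shows "dirichlet_energy (potential \<phi> n) \<le> 967680000 * tree_energy \<phi>"
proof -
  let ?c = "\<lambda>x. 23040000 * ((\<phi> x)\<^sup>2 * 2 ^ level x * sqrt 2 ^ level x)"
  let ?h = "\<lambda>x z. 1 / sqrt (1 - (norm z)\<^sup>2) * indicator (vertex_support x) z"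
  define F where "F N z = (\<Sum>x\<in>level_verts n N. ennreal (?c x) * ennreal (?h x z))" for N z
  have pos: "0 \<le> ?h x z" for x z
    by (auto simp: indicator_def vertex_support_def bump_support_def power_le_one)
  have mono: "incseq F"
    unfolding incseq_def le_fun_def F_def
    by (intro allI impI sum_mono2 finite_level_verts) (auto simp: level_verts_def)
  have "sq_grad (potential \<phi> n) z \<le> (SUP N. F N z)" for z
  proof (cases "z \<in> ball 0 1")
    case True
    then obtain N where N: "depth N z < 0" using ex_depth_neg by auto
    have "sq_grad (potential \<phi> n) z = ennreal ((norm (grad (potential \<phi> n) z))\<^sup>2)"
      using True by (simp add: sq_grad_def)
    also have "\<dots> \<le> ennreal (\<Sum>x\<in>level_verts n N. ?c x * ?h x z)"
      using sq_norm_grad_potential_le[OF n _ N \<phi>] True by (intro ennreal_leI) auto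
    also have "\<dots> = (\<Sum>x\<in>level_verts n N. ennreal (?c x * ?h x z))"
      by (intro sum_ennreal[symmetric] mult_nonneg_nonneg[OF _ pos]) simp
    also have "\<dots> = F N z"
      unfolding F_def by (intro sum.cong refl ennreal_mult') simp
    also have "\<dots> \<le> (SUP N. F N z)" by (rule SUP_upper) simp
    finally show ?thesis .
  qed (simp add: sq_grad_def)
  then have "dirichlet_energy (potential \<phi> n) \<le> (\<integral>\<^sup>+z. (SUP N. F N z) \<partial>lborel)"
    unfolding dirichlet_energy_eq by (intro nn_integral_mono)
  also have "\<dots> = (SUP N. (\<integral>\<^sup>+z. F N z \<partial>lborel))"
    by (rule nn_integral_monotone_convergence_SUP[OF mono]) (unfold F_def, measurable)
  also have "\<dots> \<le> 967680000 * tree_energy \<phi>"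
  proof (rule SUP_least)
    fix N
    have "(\<integral>\<^sup>+z. F N z \<partial>lborel) = (\<Sum>x\<in>level_verts n N. ennreal (?c x) * (\<integral>\<^sup>+z.
      ennreal (?h x z) \<partial>lborel))"
      unfolding F_def by (subst nn_integral_sum) (auto simp: nn_integral_cmult)
    also have "\<dots> \<le> (\<Sum>x\<in>level_verts n N. ennreal (?c x) * ennreal (42 / (2 ^ level x
      * sqrt 2 ^ level x)))"
      by (intro sum_mono mult_left_mono nn_integral_vertex_support_le level_verts_in_tree) auto
    also have "\<dots> = (\<Sum>x\<in>level_verts n N. 967680000 * ennreal ((\<phi> x)\<^sup>2))"
    proof (intro sum.cong refl)
      fix x
      have "?c x * (42 / (2 ^ level x * sqrt 2 ^ level x)) = 967680000 * (\<phi> x)\<^sup>2" by simp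
      then show "ennreal (?c x) * ennreal (42 / (2 ^ level x * sqrt 2 ^ level x))
        = 967680000 * ennreal ((\<phi> x)\<^sup>2)"
        by (metis ennreal_mult' ennreal_mult'' ennreal_numeral zero_le_numeral divide_nonneg_nonneg mult_nonneg_nonneg zero_le_power real_sqrt_ge_zero)
    qed
    also have "\<dots> = 967680000 * (\<Sum>x\<in>level_verts n N. ennreal ((\<phi> x)\<^sup>2))"
      by (rule sum_distrib_left[symmetric])
    also have "\<dots> \<le> 967680000 * tree_energy \<phi>"
      unfolding tree_energy_def
      by (intro mult_left_mono sum_le_infsum_ennreal finite_level_verts) (auto
        simp: level_verts_def)
    finally show "(\<integral>\<^sup>+z. F N z \<partial>lborel) \<le> 967680000 * tree_energy \<phi>" .
  qed
  finally show ?thesis .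
qed

section \<open>Radial limits of the potential\<close>

text \<open>The geodesic follows the binary expansion of \<open>\<theta> / (2 * pi)\<close>: the arc
  of level \<open>k\<close> is the one containing \<open>z\<close>, numbered from 1. One such
  geodesic suffices, as admissibility covers every geodesic over \<open>E\<close>.\<close>

lemma ex_boundary_point:
  assumes z: "norm z = 1"
  obtains \<zeta> \<theta> where "\<zeta> \<in> tree_boundary" "Lambda \<zeta> = z" "z = cis \<theta>"
    "\<And>k. \<bar>\<theta> - arc_center (\<zeta> k)\<bar> \<le> pi / 2 ^ k"
proof -
  define \<theta> where "\<theta> = Arg2pi z"
  define s where "s = \<theta> / (2 * pi)"
  have zc: "z = cis \<theta>"
    using Arg2pi_eq[of z] z by (simp add: \<theta>_def cis_conv_exp)
  have \<theta>s: "\<theta> = 2 * pi * s" by (simp add: s_def)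
  have s: "0 \<le> s" "s < 1" by (auto simp: s_def \<theta>_def Arg2pi_ge_0 Arg2pi_lt_2pi)
  define m where "m k = nat \<lfloor>2 ^ k * s\<rfloor>" for k
  define \<zeta> where "\<zeta> k = (k, m k + 1)" for k
  have m: "real (m k) \<le> 2 ^ k * s" "2 ^ k * s < real (m k) + 1" for k
    using s(1) by (auto simp: m_def)
  have "real (m k) < 2 ^ k" for k
  proof -
    have "2 ^ k * s < 2 ^ k * 1" using s(2) by (intro mult_strict_left_mono) auto
    then show ?thesis using m(1)[of k] by linarith
  qed
  then have "m k < 2 ^ k" for k by (metis of_nat_less_numeral_power_cancel_iff)
  then have v: "\<zeta> k \<in> tree_verts" for k by (simp add: \<zeta>_def tree_verts_def Suc_le_eq)
  have par: "\<zeta> k = parent (\<zeta> (Suc k))" for k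
  proof -
    have "2 * real (m k) < real (m (Suc k)) + 1" "real (m (Suc k)) < 2 * real (m k) + 2"
      using m[of k] m[of "Suc k"] by (simp_all add: algebra_simps)
    then have "m (Suc k) = 2 * m k \<or> m (Suc k) = 2 * m k + 1" by linarith
    then show ?thesis by (auto simp: parent_def \<zeta>_def)
  qed
  have root: "\<zeta> 0 = tree_root" using v[of 0] by (simp add: \<zeta>_def tree_root_def tree_verts_def)
  have zb: "\<zeta> \<in> tree_boundary"
  proof -
    have "tree_geodesic UNIV \<zeta>"
    proof (rule level_path_geodesic)
      show "level (\<zeta> i) = i" for i by (simp add: \<zeta>_def)
    qed (fact v par)+
    then show ?thesis using root by (simp add: tree_boundary_def)
  qed
  have arc: "z \<in> dyadic_arc (\<zeta> k)" for k
  proof -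
    have "(real (m k + 1) - 1) / 2 ^ k \<le> s" "s < real (m k + 1) / 2 ^ k"
      using m[of k] by (simp_all add: field_simps)
    then show ?thesis unfolding dyadic_arc_def zc \<zeta>_def s_def by auto
  qed
  have "z \<in> (\<Inter>x \<in> pred_boundary \<zeta>. closure (dyadic_arc x))"
    using arc closure_subset by (auto simp: pred_boundary_def)
  then have L: "Lambda \<zeta> = z"
    unfolding Lambda_def using ex1_Lambda[OF zb] by (rule the1_equality[rotated])
  have "\<bar>\<theta> - arc_center (\<zeta> k)\<bar> \<le> pi / 2 ^ k" for k
  proof -
    have "\<theta> - arc_center (\<zeta> k) = 2 * pi / 2 ^ k * (2 ^ k * s - real (m k) - 1/2)"
      by (simp add: \<theta>s arc_center_def \<zeta>_def field_simps)
    then have "\<bar>\<theta> - arc_center (\<zeta> k)\<bar> = 2 * pi / 2 ^ k * \<bar>2 ^ k * s - real (m k) - 1/2\<bar>"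
      by (simp add: abs_mult)
    also have "\<dots> \<le> 2 * pi / 2 ^ k * (1/2)"
    proof (rule mult_left_mono)
      show "\<bar>2 ^ k * s - real (m k) - 1/2\<bar> \<le> 1/2" using m[of k] by linarith
    qed simp
    finally show ?thesis by simp
  qed
  then show thesis using that zb L zc by blast
qed

lemma depth_ray:
  assumes "norm z = 1"
  shows "depth k (of_real r * z) = 1 - 2 ^ k * (1 - r\<^sup>2)"
  using assms by (simp add: depth_def norm_mult power_mult_distrib)

text \<open>\<open>nearness\<close> depends only on the direction of its argument, so it is constant
  along a ray and only the depth factor moves.\<close>

lemma vertex_bump_ray:
  assumes "norm z = 1" "0 < r"
  shows "vertex_bump x (of_real r * z) =
    ramp2 (1 - 2 ^ level x * (1 - r\<^sup>2)) * ramp2 (nearness (level x) (cis (arc_center x)) z)"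
proof -
  have "nearness k c (of_real r * z) = nearness k c z" for k c
    using assms by (simp add: nearness_def norm_mult inner_complex_def field_simps)
  then show ?thesis using depth_ray[OF assms(1)] by (simp add: vertex_bump_def bump_def)
qed

lemma vertex_bump_ray_ge:
  assumes "0 < r" "\<bar>\<theta> - arc_center x\<bar> \<le> pi / 2 ^ level x"
  shows "ramp2 (1 - 2 ^ level x * (1 - r\<^sup>2)) \<le> vertex_bump x (of_real r * cis \<theta>)"
proof -
  let ?k = "level x" and ?d = "\<theta> - arc_center x"
  have "(cis \<theta> \<bullet> cis (arc_center x)) * inverse (norm (cis \<theta>)) = cos ?d"
    by (simp add: inner_complex_def cos_diff)
  then have n: "nearness ?k (cis (arc_center x)) (cis \<theta>) = 11 - 4 ^ ?k * (2 - 2 * cos ?d)"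
    by (simp add: nearness_def)
  have "2 - 2 * cos ?d \<le> \<bar>?d\<bar>\<^sup>2" using two_minus_two_cos_le by simp
  also have "\<dots> \<le> (pi / 2 ^ ?k)\<^sup>2" using assms(2) by (intro power_mono) auto
  finally have "4 ^ ?k * (2 - 2 * cos ?d) \<le> 4 ^ ?k * (pi / 2 ^ ?k)\<^sup>2" by (intro mult_left_mono) auto
  also have "\<dots> = pi\<^sup>2"
  proof -
    have "(4::real) ^ ?k = (2 ^ ?k)\<^sup>2" by (simp add: power2_eq_square flip: power_mult_distrib)
    then show ?thesis by (simp add: power_divide)
  qed
  also have "\<dots> \<le> (315/100)\<^sup>2" using pi_approx by (intro power_mono) auto
  also have "\<dots> \<le> 10" by (simp add: power2_eq_square)
  finally have "1 \<le> nearness ?k (cis (arc_center x)) (cis \<theta>)" unfolding n by linarith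
  then have "ramp2 1 \<le> ramp2 (nearness ?k (cis (arc_center x)) (cis \<theta>))" by (rule ramp2_mono)
  then have "1 \<le> ramp2 (nearness ?k (cis (arc_center x)) (cis \<theta>))" by (simp add: ramp2_def)
  then show ?thesis
    using mult_left_mono[of 1 "ramp2 (nearness ?k (cis (arc_center x)) (cis \<theta>))" "ramp2 (1 - 2 ^ ?k * (1 - r\<^sup>2))"]
    by (simp add: vertex_bump_ray[of "cis \<theta>", OF _ assms(1)])
qed

text \<open>Each term is a nonnegative constant times \<open>ramp2\<close> of an increasing function
  of the radius. Truncating at a level not yet active at the larger radius serves both
  points.\<close>

lemma potential_ray_mono:
  assumes z: "norm z = 1" and rs: "0 < r" "r \<le> s" "s < 1"
    and \<phi>: "\<And>x. x \<in> tree_verts \<Longrightarrow> 0 \<le> \<phi> x"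
  shows "potential \<phi> n (of_real r * z) \<le> potential \<phi> n (of_real s * z)"
proof -
  have n: "norm (of_real r * z) < 1" "norm (of_real s * z) < 1" using z rs by (auto simp: norm_mult)
  obtain N where N: "depth N (of_real s * z) < 0" using ex_depth_neg[OF n(2)] by blast
  have r2: "r\<^sup>2 \<le> s\<^sup>2" using rs by (intro power_mono) auto
  have le: "1 - 2 ^ k * (1 - r\<^sup>2) \<le> 1 - 2 ^ k * (1 - s\<^sup>2)" for k
    using r2 by (intro diff_left_mono mult_left_mono) auto
  then have N': "depth N (of_real r * z) \<le> 0" using N le[of N] unfolding depth_ray[OF z] by linarith
  have "\<phi> x * vertex_bump x (of_real r * z) \<le> \<phi> x * vertex_bump x (of_real s * z)"
    if "x \<in> level_verts n N" for x
    using \<phi>[OF level_verts_in_tree[OF that]] rs le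
    by (intro mult_left_mono) (simp_all add: vertex_bump_ray[OF z] mult_right_mono ramp2_mono)
  then show ?thesis
    unfolding potential_eq[OF n(1) N'] potential_eq[OF n(2) less_imp_le[OF N]] by (intro sum_mono)
qed

text \<open>The initial segment of \<open>\<zeta>\<close> is a geodesic to
  \<open>\<zeta> (n - 1)\<close>, and a vanishing sum of nonnegative terms has vanishing
  terms.\<close>

lemma tree_admissible_eq_0:
  assumes adm: "tree_admissible n F \<phi>" and z: "\<zeta> \<in> tree_boundary" and k: "k < n"
  shows "\<phi> (\<zeta> k) = 0"
proof -
  have "tree_geodesic {..n - 1} \<zeta>" "\<zeta> 0 = tree_root"
    using z by (auto simp: tree_boundary_def tree_geodesic_def)
  then have "\<zeta> ` {..n - 1} \<subseteq> pred_vertex (\<zeta> (n - 1))" unfolding pred_vertex_def by blast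
  then have "\<zeta> k \<in> pred_vertex (\<zeta> (n - 1))" using k by auto
  then have "(\<Sum>x\<in>{\<zeta> k}. ennreal (\<phi> x)) \<le> sum_along \<phi> (pred_vertex (\<zeta> (n - 1)))"
    unfolding sum_along_def by (intro sum_le_infsum_ennreal) auto
  also have "\<dots> = 0"
    using adm boundary_vert[OF z] boundary_level[OF z] unfolding tree_admissible_def by blast
  finally have "\<phi> (\<zeta> k) \<le> 0" by (simp add: ennreal_eq_0_iff)
  moreover have "0 \<le> \<phi> (\<zeta> k)" using adm boundary_vert[OF z] by (auto simp: tree_admissible_def)
  ultimately show ?thesis by simp
qed

text \<open>All vertices off the geodesic are discarded; on it, every bump is at least its depth
  factor.\<close>

lemma sum_potential_ray_le:
  assumes z: "\<zeta> \<in> tree_boundary" "\<And>k. \<bar>\<theta> - arc_center (\<zeta> k)\<bar> \<le> pi / 2 ^ k"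
    and r: "0 < r" "r < 1" and K: "finite K" "K \<subseteq> {n..}"
    and \<phi>: "\<And>x. x \<in> tree_verts \<Longrightarrow> 0 \<le> \<phi> x"
  shows "(\<Sum>k\<in>K. \<phi> (\<zeta> k) * ramp2 (1 - 2 ^ k * (1 - r\<^sup>2))) \<le> potential \<phi> n (of_real r * cis \<theta>)"
proof -
  note lev = boundary_level[OF z(1)]
  let ?w = "of_real r * cis \<theta>"
  have n: "norm ?w < 1" using r by (simp add: norm_mult)
  obtain N where N: "depth N ?w < 0" using ex_depth_neg[OF n] by blast
  \<comment> \<open>Large enough that the truncated sum equals the potential and still contains
    every index of \<open>K\<close>.\<close>
  define M where "M = max N (Suc (Max (insert 0 K)))"
  have KM: "k < M" if "k \<in> K" for k
  proof -
    have "k \<le> Max (insert 0 K)" using that K(1) by (intro Max_ge) auto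
    then show ?thesis by (simp add: M_def)
  qed
  have M: "depth M ?w \<le> 0" using depth_antimono[of ?w N M] n N by (simp add: M_def)
  have inj: "inj_on \<zeta> K" using lev by (metis inj_onI)
  have "(\<Sum>k\<in>K. \<phi> (\<zeta> k) * ramp2 (1 - 2 ^ k * (1 - r\<^sup>2))) \<le> (\<Sum>k\<in>K. \<phi> (\<zeta> k) * vertex_bump (\<zeta> k) ?w)"
  proof (intro sum_mono mult_left_mono \<phi> boundary_vert[OF z(1)])
    fix k
    have "\<bar>\<theta> - arc_center (\<zeta> k)\<bar> \<le> pi / 2 ^ level (\<zeta> k)" using z(2) unfolding lev .
    from vertex_bump_ray_ge[OF r(1) this]
    show "ramp2 (1 - 2 ^ k * (1 - r\<^sup>2)) \<le> vertex_bump (\<zeta> k) ?w" unfolding lev .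
  qed
  also have "\<dots> = (\<Sum>x\<in>\<zeta> ` K. \<phi> x * vertex_bump x ?w)"
    by (simp add: sum.reindex[OF inj])
  also have "\<dots> \<le> (\<Sum>x\<in>level_verts n M. \<phi> x * vertex_bump x ?w)"
  proof (rule sum_mono2)
    show "\<zeta> ` K \<subseteq> level_verts n M"
      using K(2) KM lev boundary_vert[OF z(1)] by (auto simp: level_verts_def)
    show "0 \<le> \<phi> x * vertex_bump x ?w" if "x \<in> level_verts n M - \<zeta> ` K" for x
      using \<phi> level_verts_in_tree[of x n M] that by simp
  qed simp
  also have "\<dots> = potential \<phi> n ?w" by (rule potential_eq[symmetric, OF n M])
  finally show ?thesis .
qed

lemma mono_tendsto_at_left_SUP:
  fixes f :: "real \<Rightarrow> ereal"
  assumes "a < b" and "\<And>r s. a < r \<Longrightarrow> r \<le> s \<Longrightarrow> s < b \<Longrightarrow> f r \<le> f s"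
  shows "(f \<longlongrightarrow> (SUP r\<in>{a<..<b}. f r)) (at_left b)"
proof (rule increasing_tendsto)
  show "\<forall>\<^sub>F r in at_left b. f r \<le> (SUP r\<in>{a<..<b}. f r)"
    unfolding eventually_at_left[OF assms(1)] using assms(1)
      by (intro exI[of _ a]) (auto intro: SUP_upper)
  fix x assume "x < (SUP r\<in>{a<..<b}. f r)"
  then obtain r where r: "a < r" "r < b" "x < f r" by (auto simp: less_SUP_iff)
  then have "\<forall>s>r. s < b \<longrightarrow> x < f s" using assms(2) by (meson less_imp_le less_le_trans)
  then show "\<forall>\<^sub>F r in at_left b. x < f r"
    unfolding eventually_at_left[OF assms(1)] using r by blast
qed

text \<open>The factors \<open>ramp2 (1 - 2 ^ k * (1 - r\<^sup>2))\<close> tend to 1 along the ray,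
  so the radial limit dominates every finite part of the path sum, hence the whole sum.\<close>

lemma disc_admissible_potential:
  assumes adm: "tree_admissible n (Lambda_preimage E) \<phi>" and E: "E \<subseteq> sphere 0 1" and n: "1 \<le> n"
  shows "disc_admissible E (cball 0 (1 - 1 / 2 ^ n)) (potential \<phi> n)"
proof -
  let ?u = "potential \<phi> n"
  let ?F = "cball 0 (1 - 1 / 2 ^ n) :: complex set"
  have \<phi>: "0 \<le> \<phi> x" if "x \<in> tree_verts" for x
    using adm that by (simp add: tree_admissible_def)
  have nonneg: "0 \<le> ?u z" for z
    unfolding potential_def using \<phi> by (intro sum_nonneg mult_nonneg_nonneg) auto
  have ray: "\<exists>l. ((\<lambda>r. ereal (?u (of_real r * z))) \<longlongrightarrow> l) (at_left 1) \<and> 1 \<le> l" if zE: "z \<in> E" for z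
  proof -
    have z: "norm z = 1" using E zE by auto
    define f where "f r = ereal (?u (of_real r * z))" for r
    define l where "l = (SUP r\<in>{0<..<1}. f r)"
    have lim: "(f \<longlongrightarrow> l) (at_left 1)"
      unfolding l_def f_def
      by (rule mono_tendsto_at_left_SUP) (auto intro: potential_ray_mono[OF z _ _ _ \<phi>])
    have fl: "f r \<le> l" if "0 < r" "r < 1" for r
      unfolding l_def using that by (intro SUP_upper) auto
    have "0 \<le> f (1/2)" using nonneg by (simp add: f_def)
    then have l0: "0 \<le> l" using fl[of "1/2"] by (rule order_trans) auto
    have "1 \<le> l"
    \<comment> \<open>Only a finite limit needs work: \<open>l0\<close> excludes the value minus
      infinity, and plus infinity is allowed.\<close>
    proof (cases l)
      case (real L)
      obtain \<zeta> \<theta> where \<zeta>: "\<zeta> \<in> tree_boundary" "Lambda \<zeta> = z" "z = cis \<theta>"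
          "\<And>k. \<bar>\<theta> - arc_center (\<zeta> k)\<bar> \<le> pi / 2 ^ k"
        using ex_boundary_point[OF z] by blast
      have "sum_along \<phi> (pred_boundary \<zeta>) \<le> ennreal L"
        unfolding sum_along_def pred_boundary_def
      proof (rule infsum_ennreal_le)
        fix X assume "finite X" "X \<subseteq> range \<zeta>"
        then obtain K where K: "finite K" "X = \<zeta> ` K" by (metis finite_subset_image subset_UNIV)
        have inj: "inj_on \<zeta> K" using boundary_level[OF \<zeta>(1)] by (metis inj_onI)
        \<comment> \<open>The potential sees only levels from \<open>n\<close> on; on the lower
          levels an admissible weight vanishes.\<close>
        let ?K = "K \<inter> {n..}"
        have "(\<Sum>x\<in>X. ennreal (\<phi> x)) = (\<Sum>k\<in>K. ennreal (\<phi> (\<zeta> k)))"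
          unfolding K(2) by (simp add: sum.reindex[OF inj])
        also have "\<dots> = (\<Sum>k\<in>?K. ennreal (\<phi> (\<zeta> k)))"
        proof (rule sum.mono_neutral_right)
          show "\<forall>k\<in>K - ?K. ennreal (\<phi> (\<zeta> k)) = 0"
          proof
            fix k assume "k \<in> K - ?K"
            then have "k < n" by auto
            from tree_admissible_eq_0[OF adm \<zeta>(1) this] show "ennreal (\<phi> (\<zeta> k)) = 0" by simp
          qed
        qed (use K(1) in auto)
        also have "\<dots> = ennreal (\<Sum>k\<in>?K. \<phi> (\<zeta> k))"
          using \<phi> boundary_vert[OF \<zeta>(1)] by (intro sum_ennreal) auto
        also have "\<dots> \<le> ennreal L"
        proof (rule ennreal_leI)
          have "((\<lambda>r. \<Sum>k\<in>?K. \<phi> (\<zeta> k) * ramp2 (1 - 2 ^ k * (1 - r\<^sup>2))) \<longlongrightarrow>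
              (\<Sum>k\<in>?K. \<phi> (\<zeta> k) * ramp2 (1 - 2 ^ k * (1 - 1\<^sup>2)))) (at_left 1)"
            unfolding ramp2_def by (intro tendsto_intros)
          then have "((\<lambda>r. \<Sum>k\<in>?K. \<phi> (\<zeta> k) * ramp2 (1 - 2 ^ k * (1 - r\<^sup>2)))
            \<longlongrightarrow> (\<Sum>k\<in>?K. \<phi> (\<zeta> k))) (at_left 1)"
            by (simp add: ramp2_def)
          moreover have "\<forall>\<^sub>F r in at_left 1. (\<Sum>k\<in>?K. \<phi> (\<zeta> k) * ramp2 (1 - 2 ^ k * (1 - r\<^sup>2))) \<le> L"
            unfolding eventually_at_left[OF zero_less_one]
          proof (intro exI[of _ 0] conjI allI impI)
            fix r :: real assume r: "0 < r" "r < 1"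
            have "(\<Sum>k\<in>?K. \<phi> (\<zeta> k) * ramp2 (1 - 2 ^ k * (1 - r\<^sup>2))) \<le> ?u (of_real r * cis \<theta>)"
              using K(1) by (intro sum_potential_ray_le \<zeta> r \<phi>) auto
            also have "\<dots> \<le> L" using fl[OF r] by (simp add: f_def real \<zeta>(3))
            finally show "(\<Sum>k\<in>?K. \<phi> (\<zeta> k) * ramp2 (1 - 2 ^ k * (1 - r\<^sup>2))) \<le> L" .
          qed simp
          ultimately show "(\<Sum>k\<in>?K. \<phi> (\<zeta> k)) \<le> L"
            by (rule tendsto_upperbound) simp
        qed
        finally show "(\<Sum>x\<in>X. ennreal (\<phi> x)) \<le> ennreal L" .
      qed
      moreover have "1 \<le> sum_along \<phi> (pred_boundary \<zeta>)"
        using adm \<zeta> zE by (auto simp: tree_admissible_def Lambda_preimage_def)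
      ultimately have "1 \<le> ennreal L" by (rule order_trans[rotated])
      then show ?thesis by (simp add: real)
    qed (use l0 in auto)
    then show ?thesis using lim unfolding f_def by blast
  qed
  have F: "?F \<subseteq> ball 0 1"
  proof
    fix z assume "z \<in> ?F"
    then have "norm z \<le> 1 - 1 / 2 ^ n" by simp
    moreover have "(0::real) < 1 / 2 ^ n" by simp
    ultimately have "norm z < 1" by linarith
    then show "z \<in> ball 0 1" by simp
  qed
  have "?u z = 0" if z: "z \<in> ?F" for z
  proof -
    have nz: "norm z \<le> 1 - 1 / 2 ^ n" "norm z < 1" using z F by auto
    \<comment> \<open>Since \<open>1 - (norm z)\<^sup>2 \<ge> 1 - norm z\<close>, even the bumps of
      level \<open>n\<close> vanish on the closed inner disc.\<close>
    have "1 / 2 ^ n \<le> (1 - norm z) * 1" using nz by simp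
    also have "\<dots> \<le> (1 - norm z) * (1 + norm z)" using nz by (intro mult_left_mono) auto
    also have "\<dots> = 1 - (norm z)\<^sup>2" by (simp add: power2_eq_square algebra_simps)
    finally have "depth n z \<le> 0" by (simp add: depth_def field_simps)
    moreover have "level_verts n n = {}" by (auto simp: level_verts_def)
    ultimately show ?thesis using potential_eq[OF nz(2), of n \<phi> n] by simp
  qed
  then have F0: "disc_value ?u z \<le> 0" if "z \<in> ?F" for z
    using that F by (auto simp: disc_value_def)
  have Ev: "1 \<le> disc_value ?u z" if zE: "z \<in> E" for z
  proof -
    obtain l where l: "((\<lambda>r. ereal (?u (of_real r * z))) \<longlongrightarrow> l) (at_left 1)" "1 \<le> l"
      using ray[OF zE] by blast
    have "Lim (at_left 1) (\<lambda>r. ereal (?u (of_real r * z))) = l"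
      using l by (intro tendsto_Lim) auto
    moreover have "z \<notin> ball 0 1" using E zE by auto
    ultimately show ?thesis using l(2) by (simp add: disc_value_def)
  qed
  have "\<exists>l. l \<noteq> -\<infinity> \<and> ((\<lambda>r. ereal (?u (of_real r * z))) \<longlongrightarrow> l) (at_left 1)"
    if "z \<in> (E \<union> ?F) - ball 0 1" for z
  proof -
    have "z \<in> E" using that F by auto
    from ray[OF this] show ?thesis
      by (metis MInfty_neq_ereal(1) ereal_infty_less_eq(2) one_ereal_def)
  qed
  then show ?thesis
    unfolding disc_admissible_def using C1_disc_potential[OF n] Ev F0 by blast
qed

theorem theorem8:
  shows "\<exists>c C :: real. 0 < c \<and> c \<le> C \<and>
    (\<forall>(E :: complex set) (n :: nat). closed E \<longrightarrow> E \<subseteq> sphere 0 1 \<longrightarrow> 1 \<le> n \<longrightarrow>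
       ennreal c * tree_Cap_n n (Lambda_preimage E) \<le> disc_Cap_n n E \<and>
       disc_Cap_n n E \<le> ennreal C * tree_Cap_n n (Lambda_preimage E))"
proof (intro exI conjI allI impI)
  show "(0::real) < 1 / 2592" "(1 / 2592 :: real) \<le> 967680000" by simp_all
  fix E :: "complex set" and n :: nat
  assume E: "E \<subseteq> sphere 0 1" and n: "1 \<le> n"
  have cancel: "ennreal (1 / c) * (ennreal c * x) = x" if "0 < c" for c :: real and x
    using that by (simp add: mult.assoc[symmetric] flip: ennreal_mult')
  show "ennreal (1 / 2592) * tree_Cap_n n (Lambda_preimage E) \<le> disc_Cap_n n E"
    unfolding disc_Cap_n_def disc_Cap_def
  proof (rule INF_greatest)
    fix u assume "u \<in> {u. disc_admissible E (cball 0 (1 - 1 / 2 ^ n)) u}"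
    then have "tree_Cap_n n (Lambda_preimage E) \<le> ennreal 2592 * dirichlet_energy u"
      using tree_Cap_n_le_dirichlet_energy[OF _ E n] by simp
    then have "ennreal (1 / 2592) * tree_Cap_n n (Lambda_preimage E)
      \<le> ennreal (1 / 2592) * (ennreal 2592 * dirichlet_energy u)"
      by (rule mult_left_mono) simp
    then show "ennreal (1 / 2592) * tree_Cap_n n (Lambda_preimage E) \<le> dirichlet_energy u"
      by (subst (asm) cancel) auto
  qed
  \<comment> \<open>The constant is moved to the left so that the claim is a lower bound for an
    infimum over \<open>\<phi>\<close>; it is multiplied back afterwards.\<close>
  have "ennreal (1 / 967680000) * disc_Cap_n n E \<le> tree_Cap_n n (Lambda_preimage E)"
    unfolding tree_Cap_n_def
  proof (rule INF_greatest)
    fix \<phi> assume "\<phi> \<in> {\<phi>. tree_admissible n (Lambda_preimage E) \<phi>}"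
    then have adm: "tree_admissible n (Lambda_preimage E) \<phi>" by simp
    have "disc_Cap_n n E \<le> dirichlet_energy (potential \<phi> n)"
      unfolding disc_Cap_n_def disc_Cap_def
      using disc_admissible_potential[OF adm E n] by (intro INF_lower) simp
    also have "\<dots> \<le> ennreal 967680000 * tree_energy \<phi>"
      using dirichlet_energy_potential_le[OF n] adm by (simp add: tree_admissible_def)
    finally have "ennreal (1 / 967680000) * disc_Cap_n n E
      \<le> ennreal (1 / 967680000) * (ennreal 967680000 * tree_energy \<phi>)"
      by (rule mult_left_mono) simp
    then show "ennreal (1 / 967680000) * disc_Cap_n n E \<le> tree_energy \<phi>"
      by (subst (asm) cancel) auto
  qed
  then have "ennreal 967680000 * (ennreal (1 / 967680000) * disc_Cap_n n E)
    \<le> ennreal 967680000 * tree_Cap_n n (Lambda_preimage E)"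
    by (rule mult_left_mono) simp
  then show "disc_Cap_n n E \<le> ennreal 967680000 * tree_Cap_n n (Lambda_preimage E)"
    using cancel[of "1 / 967680000" "disc_Cap_n n E"] by simp
qed

end
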